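(* For every integer $q \geq 0$ there exists a constant $A_q$, depending only on $q$ (in particular independent of the dimension), such that every smooth toric Fano variety $X$ which has a minimal component of codegree $q$ satisfies $\rho(X) \leq A_q$, where $\rho(X)$ denotes the Picard rank of $X$.
   Context: Let $X$ be a smooth projective uniruled variety and $\operatorname{RatCurves}^n(X)$ the normalised space of rational curves on $X$. For an irreducible component $\mathcal{C}\subseteq \operatorname{RatCurves}^n(X)$ let $\psi\colon\mathcal{U}\to\mathcal{C}$ be the universal family, with its evaluation map $\mu\colon\mathcal{U}\to X$. $\mathcal{C}$ is a dominating component if $\mu$ is dominant; it is a minimal component if in addition $\mu^{-1}(x)$ is complete for general $x\in X$. The degree of a minimal component is $\deg(\mathcal{C})=-K_X\cdot C$ for a curve $C$ in the family, and its codegree is $\operatorname{codeg}(\mathcal{C})=\dim(X)+1-\deg(\mathcal{C})$. Toric description (Chen--Fu--Hwang): a primitive collection of a fan $\Sigma$ is a set of rays of $\Sigma$ which do not together span a cone of $\Sigma$ but every proper subset of which spans a cone of $\Sigma$. For a smooth projective toric variety $X_\Sigma$, minimal components of degree $k$ correspond to primitive collections $\{\rho_1,\dots,\rho_k\}$ whose primitive ray generators $v_1,\dots,v_k$ satisfy $v_1+\dots+v_k=0$. So, with $n=\dim X_\Sigma$, a minimal component of codegree $q$ corresponds to a primitive collection of $n+1-q$ rays whose primitive generators satisfy $v_1+\dots+v_{n+1-q}=0$. *)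

theory Defs
  imports "Jordan_Normal_Form.Matrix" "HOL-Algebra.Product_Groups"
begin

text \<open>
  Toric varieties are represented by their fans. The lattice \<open>N\<close> of one-parameter subgroups is
  \<open>\<int>\<^sup>n\<close>, i.e. the carrier \<open>carrier_vec n\<close> of integer vectors; \<open>N\<^sub>\<real>\<close> is the carrier of real vectors,
  and the dual lattice \<open>M\<close> is identified with \<open>\<int>\<^sup>n\<close> through the standard scalar product.
\<close>

section \<open>Cones and fans\<close>

definition cone_gen :: "nat \<Rightarrow> int vec set \<Rightarrow> real vec set" where
  "cone_gen n S =
     {finsum_vec TYPE(real) n (\<lambda>v. c v \<cdot>\<^sub>v map_vec real_of_int v) S | c. \<forall>v\<in>S. 0 \<le> c v}"

definition rational_polyhedral_cone :: "nat \<Rightarrow> real vec set \<Rightarrow> bool" where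
  "rational_polyhedral_cone n \<sigma> \<longleftrightarrow> (\<exists>S. finite S \<and> S \<subseteq> carrier_vec n \<and> \<sigma> = cone_gen n S)"

definition strongly_convex :: "nat \<Rightarrow> real vec set \<Rightarrow> bool" where
  "strongly_convex n \<sigma> \<longleftrightarrow> (\<forall>x\<in>\<sigma>. - x \<in> \<sigma> \<longrightarrow> x = 0\<^sub>v n)"

definition is_face :: "nat \<Rightarrow> real vec set \<Rightarrow> real vec set \<Rightarrow> bool" where
  "is_face n \<tau> \<sigma> \<longleftrightarrow>
     (\<exists>m\<in>carrier_vec n. (\<forall>x\<in>\<sigma>. 0 \<le> m \<bullet> x) \<and> \<tau> = {x\<in>\<sigma>. m \<bullet> x = 0})"

definition fan :: "nat \<Rightarrow> real vec set set \<Rightarrow> bool" where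
  "fan n \<Sigma> \<longleftrightarrow>
     finite \<Sigma> \<and>
     (\<forall>\<sigma>\<in>\<Sigma>. rational_polyhedral_cone n \<sigma> \<and> strongly_convex n \<sigma>) \<and>
     (\<forall>\<sigma>\<in>\<Sigma>. \<forall>\<tau>. is_face n \<tau> \<sigma> \<longrightarrow> \<tau> \<in> \<Sigma>) \<and>
     (\<forall>\<sigma>\<in>\<Sigma>. \<forall>\<tau>\<in>\<Sigma>. is_face n (\<sigma> \<inter> \<tau>) \<sigma> \<and> is_face n (\<sigma> \<inter> \<tau>) \<tau>)"

definition complete_fan :: "nat \<Rightarrow> real vec set set \<Rightarrow> bool" where
  "complete_fan n \<Sigma> \<longleftrightarrow> \<Union>\<Sigma> = carrier_vec n"

definition primitive_vec :: "nat \<Rightarrow> int vec \<Rightarrow> bool" where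
  "primitive_vec n v \<longleftrightarrow>
     v \<in> carrier_vec n \<and> v \<noteq> 0\<^sub>v n \<and>
     (\<forall>k. \<forall>w\<in>carrier_vec n. v = k \<cdot>\<^sub>v w \<longrightarrow> \<bar>k\<bar> = 1)"

text \<open>
  A ray is represented by its primitive generator, so \<open>fan_rays n \<Sigma>\<close> and \<open>cone_rays n \<sigma>\<close> stand for
  the sets usually written \<open>\<Sigma>(1)\<close> and \<open>\<sigma>(1)\<close>.
\<close>

definition fan_rays :: "nat \<Rightarrow> real vec set set \<Rightarrow> int vec set" where
  "fan_rays n \<Sigma> = {v. primitive_vec n v \<and> cone_gen n {v} \<in> \<Sigma>}"

definition cone_rays :: "nat \<Rightarrow> real vec set \<Rightarrow> int vec set" where
  "cone_rays n \<sigma> = {v. primitive_vec n v \<and> is_face n (cone_gen n {v}) \<sigma>}"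

definition lattice_basis :: "nat \<Rightarrow> int vec set \<Rightarrow> bool" where
  "lattice_basis n B \<longleftrightarrow>
     finite B \<and> B \<subseteq> carrier_vec n \<and>
     (\<forall>w\<in>carrier_vec n. \<exists>!c. c \<in> B \<rightarrow>\<^sub>E UNIV \<and> w = finsum_vec TYPE(int) n (\<lambda>v. c v \<cdot>\<^sub>v v) B)"

definition smooth_fan :: "nat \<Rightarrow> real vec set set \<Rightarrow> bool" where
  "smooth_fan n \<Sigma> \<longleftrightarrow> (\<forall>\<sigma>\<in>\<Sigma>. \<exists>B. lattice_basis n B \<and> cone_rays n \<sigma> \<subseteq> B)"

section \<open>Torus-invariant divisors and the Picard group\<close>

text \<open>The function \<open>D\<close> stands for the divisor \<open>\<Sum>\<^sub>\<rho> D(u\<^sub>\<rho>) D\<^sub>\<rho>\<close>.\<close>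

definition weil_divisors :: "nat \<Rightarrow> real vec set set \<Rightarrow> (int vec \<Rightarrow> int) monoid" where
  "weil_divisors n \<Sigma> = product_group (fan_rays n \<Sigma>) (\<lambda>_. integer_group)"

text \<open>The divisor of the character \<open>\<chi>\<^sup>m\<close>.\<close>

definition char_divisor :: "nat \<Rightarrow> real vec set set \<Rightarrow> int vec \<Rightarrow> int vec \<Rightarrow> int" where
  "char_divisor n \<Sigma> m = (\<lambda>v\<in>fan_rays n \<Sigma>. m \<bullet> v)"

definition principal_divisors :: "nat \<Rightarrow> real vec set set \<Rightarrow> (int vec \<Rightarrow> int) set" where
  "principal_divisors n \<Sigma> = char_divisor n \<Sigma> ` carrier_vec n"

text \<open>
  A torus-invariant divisor is Cartier iff on every affine chart \<open>U\<^sub>\<sigma>\<close> it is the divisor of a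
  character \<open>\<chi>\<^bsup>-m\<^esup>\<close>; the vectors \<open>m = m\<^sub>\<sigma>\<close> are its Cartier data.
\<close>

definition cartier_divisors :: "nat \<Rightarrow> real vec set set \<Rightarrow> (int vec \<Rightarrow> int) set" where
  "cartier_divisors n \<Sigma> =
     {D \<in> carrier (weil_divisors n \<Sigma>).
        \<forall>\<sigma>\<in>\<Sigma>. \<exists>m\<in>carrier_vec n. \<forall>v\<in>cone_rays n \<sigma>. D v = - (m \<bullet> v)}"

text \<open>
  \<open>Pic(X\<^sub>\<Sigma>)\<close>: every line bundle comes from a torus-invariant Cartier divisor, and such a divisor is
  trivial iff it is the divisor of a character (valid for complete \<open>\<Sigma>\<close>).
\<close>

definition picard_group :: "nat \<Rightarrow> real vec set set \<Rightarrow> (int vec \<Rightarrow> int) set monoid" where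
  "picard_group n \<Sigma> =
     (weil_divisors n \<Sigma>)\<lparr>carrier := cartier_divisors n \<Sigma>\<rparr> Mod principal_divisors n \<Sigma>"

definition int_independent :: "('a, 'b) monoid_scheme \<Rightarrow> 'a set \<Rightarrow> bool" where
  "int_independent G S \<longleftrightarrow>
     finite S \<and> S \<subseteq> carrier G \<and>
     (\<forall>c. finprod G (\<lambda>x. x [^]\<^bsub>G\<^esub> (c x :: int)) S = \<one>\<^bsub>G\<^esub> \<longrightarrow> (\<forall>x\<in>S. c x = 0))"

text \<open>
  The (torsion-free) rank of a finitely generated abelian group. On \<^typ>\<open>nat\<close> the supremum is only
  meaningful for bounded sets, which is guaranteed by finite generation.
\<close>

definition abelian_rank :: "('a, 'b) monoid_scheme \<Rightarrow> nat" where
  "abelian_rank G = Sup (card ` {S. int_independent G S})"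

definition picard_rank :: "nat \<Rightarrow> real vec set set \<Rightarrow> nat" where
  "picard_rank n \<Sigma> = abelian_rank (picard_group n \<Sigma>)"

section \<open>Smooth toric Fano varieties\<close>

text \<open>
  A torus-invariant Cartier divisor on a complete toric variety is ample iff its support function is
  strictly convex. In terms of the Cartier data \<open>m\<^sub>\<sigma>\<close> of the maximal cones this says
  \<open>D(u\<^sub>\<rho>) = - \<langle>m\<^sub>\<sigma>, u\<^sub>\<rho>\<rangle>\<close> for \<open>\<rho> \<in> \<sigma>(1)\<close> and \<open>D(u\<^sub>\<rho>) > - \<langle>m\<^sub>\<sigma>, u\<^sub>\<rho>\<rangle>\<close> for all other rays.
\<close>

definition ample :: "nat \<Rightarrow> real vec set set \<Rightarrow> (int vec \<Rightarrow> int) \<Rightarrow> bool" where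
  "ample n \<Sigma> D \<longleftrightarrow>
     D \<in> cartier_divisors n \<Sigma> \<and>
     (\<forall>\<sigma>\<in>\<Sigma>. (\<forall>\<tau>\<in>\<Sigma>. \<sigma> \<subseteq> \<tau> \<longrightarrow> \<tau> = \<sigma>) \<longrightarrow>
        (\<exists>m\<in>carrier_vec n.
           (\<forall>v\<in>cone_rays n \<sigma>. D v = - (m \<bullet> v)) \<and>
           (\<forall>v\<in>fan_rays n \<Sigma> - cone_rays n \<sigma>. D v > - (m \<bullet> v))))"

text \<open>\<open>- K = \<Sum>\<^sub>\<rho> D\<^sub>\<rho>\<close>\<close>

definition anticanonical :: "nat \<Rightarrow> real vec set set \<Rightarrow> int vec \<Rightarrow> int" where
  "anticanonical n \<Sigma> = (\<lambda>v\<in>fan_rays n \<Sigma>. 1)"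

definition smooth_toric_fano :: "nat \<Rightarrow> real vec set set \<Rightarrow> bool" where
  "smooth_toric_fano n \<Sigma> \<longleftrightarrow>
     fan n \<Sigma> \<and> complete_fan n \<Sigma> \<and> smooth_fan n \<Sigma> \<and> ample n \<Sigma> (anticanonical n \<Sigma>)"

section \<open>Minimal components\<close>

definition primitive_collection :: "nat \<Rightarrow> real vec set set \<Rightarrow> int vec set \<Rightarrow> bool" where
  "primitive_collection n \<Sigma> P \<longleftrightarrow>
     P \<subseteq> fan_rays n \<Sigma> \<and> cone_gen n P \<notin> \<Sigma> \<and> (\<forall>Q. Q \<subset> P \<longrightarrow> cone_gen n Q \<in> \<Sigma>)"

text \<open>
  By Chen--Fu--Hwang, the minimal components of \<open>RatCurves\<^sup>n(X\<^sub>\<Sigma>)\<close> of a smooth projective toric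
  variety correspond bijectively to the primitive collections with vanishing sum of primitive
  generators, the degree \<open>-K \<cdot> C\<close> being the number of rays. A minimal component is represented by
  the corresponding primitive collection.
\<close>

definition minimal_components :: "nat \<Rightarrow> real vec set set \<Rightarrow> int vec set set" where
  "minimal_components n \<Sigma> =
     {P. primitive_collection n \<Sigma> P \<and> finsum_vec TYPE(int) n (\<lambda>v. v) P = 0\<^sub>v n}"

definition component_degree :: "int vec set \<Rightarrow> nat" where
  "component_degree P = card P"

definition codegree :: "nat \<Rightarrow> int vec set \<Rightarrow> int" where
  "codegree n P = int n + 1 - int (component_degree P)"

end

theory Submission
  imports Defs "HOL-Library.Multiset" "HOL-Library.Function_Algebras"
begin

text \<open>
  Let \<open>V\<close> be the rays of the fan, \<open>C\<close> a primitive collection of \<open>n + 1 - q\<close> rays with sum zero and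
  \<open>W = V - C\<close>. Ampleness of \<open>-K\<close> makes every maximal cone \<open>\<sigma>\<close> a facet \<open>{v\<in>V. u v = 1}\<close> with
  \<open>u = -m\<^sub>\<sigma> \<le> 1\<close> on \<open>V\<close>. Two facts are combined.

  First, the number of rays which do not span a cone together with a given cone is bounded in terms
  of the dimension of that cone alone, by induction on the dimension. Rewriting a sum \<open>v + \<Sum>Y\<close> over
  its minimal cone never increases the number of summands, and if \<open>v\<^sub>1\<close>, \<open>v\<^sub>2\<close> lead to equally many
  summands, then \<open>v\<^sub>2\<close> is not adjacent to the rewriting of \<open>v\<^sub>1 + \<Sum>Y\<close>. If the rewriting has fewer
  summands than \<open>Y\<close>, this is covered by induction; if it has as many, the relation is extremal, and a
  second rewriting is shorter.

  Second, modulo the span of \<open>C\<close> the rays of \<open>W\<close> live in a lattice of rank at most \<open>q\<close>, and no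
  subset of \<open>W\<close> carrying a nontrivial nonnegative relation modulo \<open>C\<close> spans a cone. The cone of
  \<open>W\<close>-rays opposite to \<open>v \<in> W\<close> yields such a subset containing \<open>v\<close> with at most \<open>q + 1\<close>
  elements. Suppose that these subsets cannot be hit by a set of bounded size. Then many of them can be
  chosen to be mutually joined by cones, and a colourful Caratheodory argument picks one ray from each
  so that the chosen rays span a cone but satisfy a nontrivial nonnegative relation. Iterating the
  hitting argument \<open>q + 1\<close> times exhausts \<open>W\<close>.

  Finally \<open>C\<close> minus a ray lies in a facet, whose rays are part of a lattice basis, so the Picard rank
  is at most the number \<open>\<le> card W + 1\<close> of the rays outside that facet.
\<close>

declare mult_hom.hom_sum_mset [simp del]  \<comment> \<open>pushes scalars into multiset sums, against \<open>algebra_simps\<close>\<close>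

section \<open>Non-adjacent rays of a smooth Fano polytope\<close>

text \<open>
  \<open>V\<close> stands for the rays of the fan, \<open>s\<close> for their inclusion into the lattice, and \<open>U\<close> for the
  functionals \<open>u = -m\<^sub>\<sigma>\<close> given by the maximal cones, so that \<open>{v\<in>V. u v = 1}\<close> are the vertices of a
  facet of the Fano polytope. Lattice points are written as sums over multisets of rays, hence the
  linearity of \<open>u\<close> takes the form of the axiom \<open>linear\<close>.
\<close>

locale smooth_fano =
  fixes V :: "'v set" and s :: "'v \<Rightarrow> 'a::ab_group_add" and U :: "('v \<Rightarrow> int) set"
  assumes finite_V: "finite V"
    and finite_U: "finite U"
    and nonzero: "v \<in> V \<Longrightarrow> s v \<noteq> 0"
    and le_1: "\<lbrakk>u \<in> U; v \<in> V\<rbrakk> \<Longrightarrow> u v \<le> 1"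
    and linear: "\<lbrakk>u \<in> U; set_mset A \<subseteq> V; set_mset B \<subseteq> V; (\<Sum>x\<in>#A. s x) = (\<Sum>x\<in>#B. s x)\<rbrakk>
      \<Longrightarrow> (\<Sum>x\<in>#A. u x) = (\<Sum>x\<in>#B. u x)"
    and complete: "\<lbrakk>set_mset A \<subseteq> V; set_mset B \<subseteq> V\<rbrakk>
      \<Longrightarrow> \<exists>u\<in>U. \<exists>M. set_mset M \<subseteq> {v\<in>V. u v = 1} \<and> (\<Sum>x\<in>#A. s x) = (\<Sum>x\<in>#B. s x) + (\<Sum>x\<in>#M. s x)"
    and independent: "\<lbrakk>u \<in> U; set_mset A \<subseteq> {v\<in>V. u v = 1}; set_mset B \<subseteq> {v\<in>V. u v = 1};
      (\<Sum>x\<in>#A. s x) = (\<Sum>x\<in>#B. s x)\<rbrakk> \<Longrightarrow> A = B"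
begin

section \<open>Shortest expressions of lattice points as sums of rays\<close>

abbreviation S :: "'v multiset \<Rightarrow> 'a" where "S M \<equiv> (\<Sum>x\<in>#M. s x)"

definition F :: "('v \<Rightarrow> int) \<Rightarrow> 'v set" where "F u = {v\<in>V. u v = 1}"

definition face :: "'v set \<Rightarrow> bool" where "face X \<longleftrightarrow> (\<exists>u\<in>U. X \<subseteq> F u)"

lemma face_subset: "face X \<Longrightarrow> Y \<subseteq> X \<Longrightarrow> face Y"
  unfolding face_def by blast

lemma F_subset: "F u \<subseteq> V"
  unfolding F_def by blast

lemma face_in_V: "face X \<Longrightarrow> X \<subseteq> V"
  unfolding face_def F_def by blast

lemma face_finite: "face X \<Longrightarrow> finite X"
  using face_in_V finite_V finite_subset by blast

lemma sum_le_size: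
  assumes "u \<in> U" "set_mset A \<subseteq> V"
  shows "(\<Sum>x\<in>#A. u x) \<le> int (size A)"
  using assms(2)
proof (induction A)
  case (add x A)
  then show ?case using le_1[OF assms(1), of x] by simp
qed simp

lemma sum_eq_size_iff:
  assumes "u \<in> U" "set_mset A \<subseteq> V"
  shows "(\<Sum>x\<in>#A. u x) = int (size A) \<longleftrightarrow> set_mset A \<subseteq> F u"
  using assms(2)
proof (induction A)
  case (add x A)
  then show ?case using le_1[OF assms(1), of x] sum_le_size[OF assms(1), of A]
    by (auto simp: F_def)
qed simp

text \<open>The total deficit against the maximal value is one, and by integrality \<open>x\<close>
  alone already accounts for it.\<close>

lemma sum_almost_size:
  assumes "u \<in> U" "set_mset A \<subseteq> V" "(\<Sum>x\<in>#A. u x) = int (size A) - 1" "x \<in># A" "x \<notin> F u"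
  shows "set_mset (A - {#x#}) \<subseteq> F u"
proof -
  obtain B where B: "A = add_mset x B" using assms(4) by (metis insert_DiffM)
  have "u x \<le> 0" using assms(5,4,2) le_1[OF assms(1), of x] by (auto simp: F_def)
  moreover have "(\<Sum>x\<in>#B. u x) \<le> int (size B)" using sum_le_size[OF assms(1), of B] assms(2) B by auto
  ultimately have "(\<Sum>x\<in>#B. u x) = int (size B)" using assms(3) B by auto
  then show ?thesis using sum_eq_size_iff[OF assms(1), of B] assms(2) B by auto
qed

text \<open>The functional of a facet containing \<open>M\<close> takes the value
  \<open>size M\<close> at the common point, while each ray of \<open>A\<close> contributes at most
  1. Equality forces \<open>A\<close> into that facet, where \<open>independent\<close>
  applies.\<close>

lemma face_minimal:
  assumes M: "face (set_mset M)" and A: "set_mset A \<subseteq> V" and eq: "S A = S M"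
  shows "size M \<le> size A" "size A = size M \<Longrightarrow> A = M"
proof -
  obtain u where u: "u \<in> U" "set_mset M \<subseteq> F u" using M unfolding face_def by blast
  have MV: "set_mset M \<subseteq> V" using u F_subset by blast
  have "(\<Sum>x\<in>#A. u x) = (\<Sum>x\<in>#M. u x)" by (rule linear[OF u(1) A MV eq])
  also have "\<dots> = int (size M)" using sum_eq_size_iff[OF u(1) MV] u(2) by simp
  finally have e: "(\<Sum>x\<in>#A. u x) = int (size M)" .
  then show "size M \<le> size A" using sum_le_size[OF u(1) A] by simp
  assume "size A = size M"
  then have "set_mset A \<subseteq> F u" using e sum_eq_size_iff[OF u(1) A] by simp
  then show "A = M" using independent[OF u(1), of A M] u(2) eq unfolding F_def by blast
qed

lemma face_unique:
  assumes "face (set_mset M)" "face (set_mset M')" "S M = S M'"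
  shows "M = M'"
  using face_minimal[OF assms(1) face_in_V[OF assms(2)]] face_minimal[OF assms(2) face_in_V[OF assms(1)]] assms(3)
  by (metis order_antisym)

text \<open>The coordinates of the lattice point \<open>S A\<close> in the smallest cone of the fan
  containing it. For rays in \<open>V\<close>, existence comes from \<open>complete\<close> and
  uniqueness from \<open>face_unique\<close>, so the choice is canonical.\<close>

definition D :: "'v multiset \<Rightarrow> 'v multiset" where
  "D A = (SOME M. face (set_mset M) \<and> S M = S A)"

lemma D:
  assumes "set_mset A \<subseteq> V"
  shows "face (set_mset (D A))" "S (D A) = S A"
proof -
  obtain u M where "u \<in> U" "set_mset M \<subseteq> F u" "S A = S {#} + S M"
    using complete[OF assms, of "{#}"] unfolding F_def by auto
  then have "\<exists>M. face (set_mset M) \<and> S M = S A" unfolding face_def by auto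
  then have "face (set_mset (D A)) \<and> S (D A) = S A" unfolding D_def by (rule someI_ex)
  then show "face (set_mset (D A))" "S (D A) = S A" by auto
qed

lemma D_eqI: "face (set_mset M) \<Longrightarrow> set_mset A \<subseteq> V \<Longrightarrow> S M = S A \<Longrightarrow> D A = M"
  using D face_unique by metis

lemma D_le: "set_mset A \<subseteq> V \<Longrightarrow> size (D A) \<le> size A"
  using D face_minimal(1) by metis

lemma D_size_eq: "set_mset A \<subseteq> V \<Longrightarrow> size (D A) = size A \<Longrightarrow> face (set_mset A)"
  using D face_minimal(2) by metis

lemma not_face_D_less: "set_mset A \<subseteq> V \<Longrightarrow> \<not> face (set_mset A) \<Longrightarrow> size (D A) < size A"
  using D_le D_size_eq by (metis order_le_imp_less_or_eq)

lemma face_D: "face (set_mset A) \<Longrightarrow> D A = A"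
  using D_eqI face_in_V by metis

section \<open>Neighbouring facets and relations of degree one\<close>

text \<open>The facet across the ridge \<open>F u - {x}\<close>: a large multiple of the sum of the
  ridge, minus \<open>x\<close>, lies just beyond the ridge, in a cone that contains the ridge but
  not \<open>x\<close>.\<close>

lemma neighbour:
  assumes u: "u \<in> U" and x: "x \<in> F u"
  obtains u' where "u' \<in> U" "F u - {x} \<subseteq> F u'" "x \<notin> F u'"
proof -
  have finF: "finite (F u)" using finite_V F_subset finite_subset by blast
  define R where "R = mset_set (F u - {x})"
  have setR: "set_mset R = F u - {x}" using finF by (simp add: R_def)
  have setRV: "set_mset R \<subseteq> V" using setR F_subset by blast
  define b where "b = Max ((\<lambda>u'. \<bar>u' x\<bar>) ` U)"
  have b: "\<bar>u' x\<bar> \<le> b" if "u' \<in> U" for u' unfolding b_def using that finite_U by simp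
  \<comment> \<open>Exceeding every absolute value of \<open>u' x\<close> by 2 ensures that a
    functional losing one unit on the ridge cannot compensate for it by its value at
    \<open>x\<close>.\<close>
  define N where "N = nat (b + 2)"
  have b0: "b \<ge> 0" using b[OF u] by linarith
  have Npos: "int N = b + 2" using b0 by (simp add: N_def)
  have setNR: "set_mset (repeat_mset N R) = F u - {x}"
  proof -
    have "N > 0" using Npos b0 by linarith
    then have "set_mset (repeat_mset N R) = set_mset R"
      by (simp add: set_eq_iff flip: count_greater_zero_iff)
    then show ?thesis using setR by simp
  qed
  have xV: "x \<in> V" using x F_subset by blast
  obtain u' M where u': "u' \<in> U" "set_mset M \<subseteq> F u'" "S (repeat_mset N R) = S {#x#} + S M"
    using complete[of "repeat_mset N R" "{#x#}"] setNR F_subset xV unfolding F_def by auto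
  have MV: "set_mset M \<subseteq> V" using u'(2) F_subset by blast
  have eqS: "S (add_mset x M) = S (repeat_mset N R)" using u'(3) by simp
  have lin: "u'' x + (\<Sum>y\<in>#M. u'' y) = int N * (\<Sum>y\<in>#R. u'' y)" if "u'' \<in> U" for u''
  proof -
    have "(\<Sum>y\<in>#add_mset x M. u'' y) = (\<Sum>y\<in>#repeat_mset N R. u'' y)"
      using linear[OF that, of "add_mset x M" "repeat_mset N R"] MV xV setNR F_subset eqS by auto
    moreover have "(\<Sum>y\<in>#repeat_mset N R. u'' y) = int N * c" if c: "(\<Sum>y\<in>#R. u'' y) = c" for c
      by (induction N) (simp_all add: c distrib_right)
    ultimately show ?thesis by simp
  qed
  have RuF: "(\<Sum>y\<in>#R. u y) = int (size R)" using sum_eq_size_iff[OF u setRV] setR by simp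
  have ux: "u x = 1" using x by (simp add: F_def)
  have 1: "1 + (\<Sum>y\<in>#M. u y) = int N * int (size R)" using lin[OF u] RuF ux by simp
  have 2: "(\<Sum>y\<in>#M. u y) \<le> int (size M)" by (rule sum_le_size[OF u MV])
  have 3: "(\<Sum>y\<in>#M. u' y) = int (size M)" using sum_eq_size_iff[OF u'(1) MV] u'(2) by simp
  have 4: "u' x + int (size M) = int N * (\<Sum>y\<in>#R. u' y)" using lin[OF u'(1)] 3 by simp
  have 5: "(\<Sum>y\<in>#R. u' y) = int (size R)"
  proof (rule ccontr)
    assume "(\<Sum>y\<in>#R. u' y) \<noteq> int (size R)"
    then have "(\<Sum>y\<in>#R. u' y) \<le> int (size R) - 1" using sum_le_size[OF u'(1) setRV] by simp
    then have "int N * (\<Sum>y\<in>#R. u' y) \<le> int N * (int (size R) - 1)" by (simp add: mult_left_mono)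
    then have "u' x + int (size M) \<le> int N * int (size R) - int N" using 4 by (simp add: algebra_simps)
    then have "u' x + int N \<le> 1" using 1 2 by linarith
    then show False using b[OF u'(1)] Npos by linarith
  qed
  then have sub: "F u - {x} \<subseteq> F u'" using sum_eq_size_iff[OF u'(1) setRV] setR by simp
  have "x \<notin> F u'"
  proof
    assume "x \<in> F u'"
    \<comment> \<open>Both sides of the relation would lie on one facet and hence agree, although
      only the left one contains \<open>x\<close>.\<close>
    then have "set_mset (add_mset x M) \<subseteq> F u'" using u'(2) by simp
    moreover have "set_mset (repeat_mset N R) \<subseteq> F u'" using setNR sub by simp
    ultimately have "add_mset x M = repeat_mset N R"
      using independent[OF u'(1)] eqS unfolding F_def by blast
    then have "x \<in># repeat_mset N R" by (metis union_single_eq_member)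
    then show False using setNR by simp
  qed
  then show ?thesis using that u'(1) sub by blast
qed

text \<open>
  A primitive relation \<open>v + \<Sum>Z' = \<Sum>Z\<close> of degree one is extremal: in a facet containing \<open>Z\<close>
  exactly one of the summands on the left is missing, and it can be exchanged for \<open>v\<close>.
\<close>

lemma move_out:
  assumes Z: "set_mset Z \<subseteq> F u" "u \<in> U" and Z': "face (set_mset Z')" and v: "v \<in> V"
    and eq: "s v + S Z' = S Z" and size: "size Z' = size Z" and vZ: "v \<notin># Z"
  obtains u' where "u' \<in> U" "set_mset Z \<subseteq> F u'" "set_mset Z' \<subseteq> F u'" "F u - {v} \<subseteq> F u'"
proof -
  have out: "set_mset Z' \<subseteq> F w" if w: "w \<in> U" "set_mset Z \<subseteq> F w" "v \<notin> F w" for w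
  proof -
    have inV: "set_mset (add_mset v Z') \<subseteq> V" using v face_in_V[OF Z'] by simp
    have ZV: "set_mset Z \<subseteq> V" using w F_subset by blast
    have "(\<Sum>x\<in>#add_mset v Z'. w x) = (\<Sum>x\<in>#Z. w x)"
      by (rule linear[OF w(1) inV ZV]) (simp add: eq)
    also have "\<dots> = int (size Z)" using sum_eq_size_iff[OF w(1) ZV] w(2) by simp
    finally have "(\<Sum>x\<in>#add_mset v Z'. w x) = int (size (add_mset v Z')) - 1" using size by simp
    from sum_almost_size[OF w(1) inV this, of v] w(3) show ?thesis by simp
  qed
  show ?thesis
  proof (cases "v \<in> F u")
    case False
    then show ?thesis using that[of u] out[of u] Z by blast
  next
    case True
    \<comment> \<open>Crossing the ridge opposite \<open>v\<close> keeps \<open>Z\<close> on the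
      facet, since \<open>v\<close> is not in \<open>Z\<close>.\<close>
    then obtain u' where "u' \<in> U" "F u - {v} \<subseteq> F u'" "v \<notin> F u'" using neighbour Z(2) by metis
    moreover have "set_mset Z \<subseteq> F u'" using calculation(2) Z(1) vZ by blast
    ultimately show ?thesis using that[of u'] out[of u'] by blast
  qed
qed

text \<open>As \<open>v1\<close> is off the common facet, its value there is at most 0, so
  \<open>Y\<close> must attain its maximal value and lies on the facet. Crossing the ridge opposite
  some \<open>x\<close> in \<open>Y\<close> keeps \<open>Z1\<close> and \<open>Z2\<close> but lowers
  the value of \<open>Y\<close>; this forces \<open>v1\<close> onto the new facet, together with
  \<open>Z2\<close>.\<close>

lemma no_common_facet:
  assumes Y: "face (set_mset Y)" "Y \<noteq> {#}"
    and v: "v1 \<in> V" "v2 \<in> V"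
    and Z: "set_mset Z1 \<subseteq> F u" "set_mset Z2 \<subseteq> F u" "u \<in> U"
    and eq: "s v1 + S Y = S Z1" "s v2 + S Y = S Z2" and size: "size Z1 = size Y" "size Z2 = size Y"
    and disj: "Y \<inter># Z1 = {#}" "Y \<inter># Z2 = {#}"
    and nonface: "\<not> face (insert v1 (set_mset Z2))"
  shows False
proof -
  have YV: "set_mset Y \<subseteq> V" by (rule face_in_V[OF Y(1)])
  have rel: "w v1 + (\<Sum>x\<in>#Y. w x) = int (size Y)" "w v2 + (\<Sum>x\<in>#Y. w x) = int (size Y)"
    if w: "w \<in> U" "set_mset Z1 \<subseteq> F w" "set_mset Z2 \<subseteq> F w" for w
  proof -
    have V12: "set_mset Z1 \<subseteq> V" "set_mset Z2 \<subseteq> V" using w F_subset by blast+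
    have "(\<Sum>x\<in>#add_mset v1 Y. w x) = (\<Sum>x\<in>#Z1. w x)"
      by (rule linear[OF w(1) _ V12(1)]) (use v YV eq in auto)
    then show "w v1 + (\<Sum>x\<in>#Y. w x) = int (size Y)"
      using sum_eq_size_iff[OF w(1) V12(1)] w(2) size by simp
    have "(\<Sum>x\<in>#add_mset v2 Y. w x) = (\<Sum>x\<in>#Z2. w x)"
      by (rule linear[OF w(1) _ V12(2)]) (use v YV eq in auto)
    then show "w v2 + (\<Sum>x\<in>#Y. w x) = int (size Y)"
      using sum_eq_size_iff[OF w(1) V12(2)] w(3) size by simp
  qed
  have notin: "v1 \<notin> F w" if w: "w \<in> U" "set_mset Z1 \<subseteq> F w" "set_mset Z2 \<subseteq> F w" for w
    using nonface w unfolding face_def by blast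
  have "v1 \<notin> F u" by (rule notin[OF Z(3,1,2)])
  then have "u v1 \<le> 0" using le_1[OF Z(3) v(1)] v(1) by (auto simp: F_def)
  obtain x where x: "x \<in># Y" using Y(2) by blast
  have YF: "set_mset Y \<subseteq> F u"
    using rel(1)[OF Z(3,1,2)] \<open>u v1 \<le> 0\<close> sum_le_size[OF Z(3) YV] sum_eq_size_iff[OF Z(3) YV] by linarith
  obtain u' where u': "u' \<in> U" "F u - {x} \<subseteq> F u'" "x \<notin> F u'"
    using neighbour[OF Z(3)] YF x by blast
  have "x \<notin># Z1" "x \<notin># Z2" using disj x by (metis disjunct_not_in)+
  then have Z': "set_mset Z1 \<subseteq> F u'" "set_mset Z2 \<subseteq> F u'" using u' Z by blast+
  have "\<not> set_mset Y \<subseteq> F u'" using x u' by blast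
  then have "(\<Sum>x\<in>#Y. u' x) < int (size Y)"
    using sum_le_size[OF u'(1) YV] sum_eq_size_iff[OF u'(1) YV] by linarith
  then have "u' v1 = 1" using rel(1)[OF u'(1) Z'] le_1[OF u'(1) v(1)] by linarith
  then show False using notin[OF u'(1) Z'] v(1) by (simp add: F_def)
qed

section \<open>Counting the rays not adjacent to a face\<close>

definition nonadj :: "'v multiset \<Rightarrow> 'v set" where
  "nonadj Y = {v\<in>V. \<not> face (insert v (set_mset Y))}"

lemma finite_nonadj: "finite (nonadj Y)"
  unfolding nonadj_def using finite_V by simp

text \<open>A face is its own \<open>D\<close>, and a non-face loses at least one summand, so
  non-adjacency can be read off from the number of summands.\<close>

lemma nonadj_iff:
  assumes Y: "face (set_mset Y)"
  shows "v \<in> nonadj Y \<longleftrightarrow> v \<in> V \<and> size (D (add_mset v Y)) \<le> size Y"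
proof (cases "v \<in> V")
  case True
  then have A: "set_mset (add_mset v Y) \<subseteq> V" using face_in_V[OF Y] by simp
  have "\<not> face (insert v (set_mset Y)) \<longleftrightarrow> size (D (add_mset v Y)) \<le> size Y"
    using not_face_D_less[OF A] face_D[of "add_mset v Y"] by auto
  then show ?thesis using True by (simp add: nonadj_def)
qed (simp add: nonadj_def)

text \<open>If \<open>add_mset v2 Z1\<close> were a face, then \<open>add_mset v1 Z2\<close>, which
  has the same sum and size, would equal it. So \<open>v1\<close> would occur in \<open>Z1\<close>,
  and cancelling it would express the sum of \<open>Y\<close> with fewer rays than the face
  \<open>Y\<close>.\<close>

lemma exchange:
  assumes Y: "face (set_mset Y)" and v: "v1 \<in> V" "v2 \<in> V" "v1 \<noteq> v2"
    and c: "size (D (add_mset v1 Y)) = c" "size (D (add_mset v2 Y)) = c" "c \<le> size Y"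
  shows "v2 \<in> nonadj (D (add_mset v1 Y))"
proof (rule ccontr)
  define Z1 where "Z1 = D (add_mset v1 Y)"
  define Z2 where "Z2 = D (add_mset v2 Y)"
  have YV: "set_mset Y \<subseteq> V" by (rule face_in_V[OF Y])
  have Z1: "face (set_mset Z1)" "S Z1 = s v1 + S Y" using D[of "add_mset v1 Y"] v YV by (auto simp: Z1_def)
  have Z2: "face (set_mset Z2)" "S Z2 = s v2 + S Y" using D[of "add_mset v2 Y"] v YV by (auto simp: Z2_def)
  assume "\<not> ?thesis"
  then have f: "face (set_mset (add_mset v2 Z1))" using v by (simp add: nonadj_def Z1_def)
  have "S (add_mset v1 Z2) = S (add_mset v2 Z1)" using Z1 Z2 by (simp add: algebra_simps)
  moreover have "set_mset (add_mset v1 Z2) \<subseteq> V" using v face_in_V[OF Z2(1)] by simp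
  moreover have "size (add_mset v1 Z2) = size (add_mset v2 Z1)" using c by (simp add: Z1_def Z2_def)
  ultimately have "add_mset v1 Z2 = add_mset v2 Z1" using face_minimal(2)[OF f] by blast
  then obtain R where R: "Z1 = add_mset v1 R" using v(3) by (metis add_eq_conv_ex)
  then have "S R = S Y" using Z1 by simp
  moreover have "set_mset R \<subseteq> V" using R face_in_V[OF Z1(1)] by auto
  ultimately have "size Y \<le> size R" using face_minimal(1)[OF Y] by blast
  then show False using R c Z1_def by auto
qed

text \<open>By \<open>exchange\<close> the size is at most \<open>size Y\<close>. Equality would
  make \<open>add_mset v2 Z1\<close> and \<open>add_mset v1 Z2\<close> left-hand sides of degree-one
  relations with the same right-hand side \<open>Z\<close>, and \<open>move_out\<close> would lead
  to a facet containing \<open>Z1\<close> and \<open>Z2\<close>, which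
  \<open>no_common_facet\<close> excludes.\<close>

lemma degree_one_exchange:
  assumes Y: "face (set_mset Y)" "Y \<noteq> {#}" and v: "v1 \<in> V" "v2 \<in> V" "v1 \<noteq> v2"
    and size: "size (D (add_mset v1 Y)) = size Y" "size (D (add_mset v2 Y)) = size Y"
    and disj: "Y \<inter># D (add_mset v1 Y) = {#}" "Y \<inter># D (add_mset v2 Y) = {#}"
  shows "size (D (add_mset v2 (D (add_mset v1 Y)))) < size Y"
proof (rule ccontr)
  define Z1 where "Z1 = D (add_mset v1 Y)"
  define Z2 where "Z2 = D (add_mset v2 Y)"
  define Z where "Z = D (add_mset v2 Z1)"
  have YV: "set_mset Y \<subseteq> V" by (rule face_in_V[OF Y(1)])
  have Z1: "face (set_mset Z1)" "S Z1 = s v1 + S Y" using D[of "add_mset v1 Y"] v YV by (auto simp: Z1_def)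
  have Z2: "face (set_mset Z2)" "S Z2 = s v2 + S Y" using D[of "add_mset v2 Y"] v YV by (auto simp: Z2_def)
  have na: "v2 \<in> nonadj Z1" "v1 \<in> nonadj Z2"
    using exchange[OF Y(1) v] exchange[OF Y(1) v(2,1)] v(3) size by (auto simp: Z1_def Z2_def)
  have inV: "set_mset (add_mset v2 Z1) \<subseteq> V" using v face_in_V[OF Z1(1)] by simp
  have Z: "face (set_mset Z)" "S Z = s v2 + S Z1" using D[OF inV] by (auto simp: Z_def)
  then have eq: "s v2 + S Z1 = S Z" "s v1 + S Z2 = S Z" using Z1 Z2 by (auto simp: algebra_simps)
  assume "\<not> ?thesis"
  then have sZ: "size Z = size Y"
    using na(1) nonadj_iff[OF Z1(1)] size by (auto simp: Z_def Z1_def)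
  \<comment> \<open>Cancelling an occurrence of \<open>a\<close> would express \<open>S B\<close>
    with one summand fewer than the face \<open>B\<close>.\<close>
  have notin: "a \<notin># Z" if a: "face (set_mset B)" "size B = size Y" "s a + S B = S Z" for a B
  proof
    assume "a \<in># Z"
    then obtain R where R: "Z = add_mset a R" by (metis insert_DiffM)
    then have "S R = S B" using a(3) by simp
    moreover have "set_mset R \<subseteq> V" using R face_in_V[OF Z(1)] by auto
    ultimately have "size B \<le> size R" using face_minimal(1)[OF a(1)] by blast
    then show False using R sZ a(2) by auto
  qed
  have v2Z2: "v2 \<notin># Z2"
  proof
    assume "v2 \<in># Z2"
    then obtain R where R: "Z2 = add_mset v2 R" by (metis insert_DiffM)
    then have "S R = S Y" using Z2(2) by simp
    moreover have "set_mset R \<subseteq> V" using R face_in_V[OF Z2(1)] by auto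
    ultimately have "size Y \<le> size R" using face_minimal(1)[OF Y(1)] by blast
    then show False using R size Z2_def by auto
  qed
  obtain u where u: "u \<in> U" "set_mset Z \<subseteq> F u" using Z(1) unfolding face_def by blast
  have s12: "size Z1 = size Z" "size Z2 = size Z" using size sZ by (auto simp: Z1_def Z2_def)
  obtain u1 where u1: "u1 \<in> U" "set_mset Z \<subseteq> F u1" "set_mset Z2 \<subseteq> F u1"
    by (rule move_out[OF u(2,1) Z2(1) v(1) eq(2) s12(2) notin[OF Z2(1) _ eq(2)]]) (use s12 sZ in simp)
  \<comment> \<open>The second move drops at most \<open>v2\<close> from the facet, and
    \<open>v2\<close> is not in \<open>Z2\<close>, so \<open>Z2\<close> survives it.\<close>
  obtain u2 where u2: "u2 \<in> U" "set_mset Z1 \<subseteq> F u2" "F u1 - {v2} \<subseteq> F u2"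
    by (rule move_out[OF u1(2,1) Z1(1) v(2) eq(1) s12(1) notin[OF Z1(1) _ eq(1)]]) (use s12 sZ in simp)
  have "set_mset Z2 \<subseteq> F u2" using u1(3) u2(3) v2Z2 by blast
  moreover have "\<not> face (insert v1 (set_mset Z2))" using na(2) by (simp add: nonadj_def)
  ultimately show False
    using no_common_facet[OF Y v(1,2) u2(2) _ u2(1), of Z2] Z1(2) Z2(2) size disj
    unfolding Z1_def[symmetric] Z2_def[symmetric] by simp
qed

end

text \<open>The three groups of summands bound the sets \<open>A\<close>, \<open>B\<close> and
  \<open>E\<close> in \<open>card_nonadj\<close>: expansions sharing a ray with \<open>Y\<close>,
  expansions shorter than \<open>Y\<close>, and disjoint expansions of the same length.\<close>

fun nonadj_bound :: "nat \<Rightarrow> nat" where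
  "nonadj_bound 0 = 0"
| "nonadj_bound (Suc t) = Suc t * nonadj_bound t + Suc t * (1 + nonadj_bound t) + 1 + Suc t * (1 + nonadj_bound t)"

context smooth_fano
begin

text \<open>Sort the rays by the size \<open>c\<close> of their expansion. By
  \<open>exchange\<close>, all rays of one class but one are non-adjacent to the expansion of that
  one, which has at most \<open>t\<close> summands.\<close>

lemma card_nonadj_less:
  assumes IH: "\<And>Y. face (set_mset Y) \<Longrightarrow> size Y \<le> t \<Longrightarrow> card (nonadj Y) \<le> nonadj_bound t"
    and Y: "face (set_mset Y)" "size Y = Suc t"
  shows "card {v\<in>V. size (D (add_mset v Y)) < size Y} \<le> Suc t * (1 + nonadj_bound t)"
proof -
  define L where "L c = {v\<in>V. size (D (add_mset v Y)) = c}" for c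
  have finL: "finite (L c)" for c using finite_V by (simp add: L_def)
  have one: "card (L c) \<le> 1 + nonadj_bound t" if c: "c \<le> t" for c
  proof (cases "L c = {}")
    case False
    then obtain v1 where v1: "v1 \<in> L c" by blast
    let ?Z = "D (add_mset v1 Y)"
    have Zf: "face (set_mset ?Z)" using D(1)[of "add_mset v1 Y"] v1 face_in_V[OF Y(1)] by (simp add: L_def)
    have "v \<in> nonadj ?Z" if "v \<in> L c - {v1}" for v
      by (rule exchange[OF Y(1), of v1 v c]) (use that v1 c Y(2) in \<open>auto simp: L_def\<close>)
    then have "L c - {v1} \<subseteq> nonadj ?Z" by blast
    then have "card (L c - {v1}) \<le> card (nonadj ?Z)" by (rule card_mono[OF finite_nonadj])
    also have "\<dots> \<le> nonadj_bound t" using IH[OF Zf] v1 c by (simp add: L_def)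
    finally show ?thesis using card_Diff_singleton[OF v1] by simp
  qed simp
  have "{v\<in>V. size (D (add_mset v Y)) < size Y} = (\<Union>c\<in>{..t}. L c)" using Y(2) by (auto simp: L_def)
  then have "card {v\<in>V. size (D (add_mset v Y)) < size Y} \<le> (\<Sum>c\<in>{..t}. card (L c))"
    using card_UN_le[of "{..t}" L] by simp
  also have "\<dots> \<le> (\<Sum>c\<in>{..t}. 1 + nonadj_bound t)" by (rule sum_mono) (use one in auto)
  finally show ?thesis by simp
qed

lemma card_nonadj:
  "\<lbrakk>face (set_mset Y); size Y \<le> t\<rbrakk> \<Longrightarrow> card (nonadj Y) \<le> nonadj_bound t"
proof (induction t arbitrary: Y)
  case 0
  then have [simp]: "Y = {#}" by simp
  have "v \<notin> nonadj Y" for v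
  proof
    assume "v \<in> nonadj Y"
    then have v: "v \<in> V" "D {#v#} = {#}" using nonadj_iff[OF 0(1), of v] by auto
    then have "s v = 0" using D(2)[of "{#v#}"] by simp
    then show False using nonzero v by blast
  qed
  then have "nonadj Y = {}" by blast
  then show ?case by simp
next
  case (Suc t)
  note IH = Suc.IH
  show ?case
  proof (cases "size Y \<le> t")
    case True
    then have "card (nonadj Y) \<le> nonadj_bound t" using IH Suc.prems by blast
    also have "\<dots> \<le> nonadj_bound (Suc t)" by simp
    finally show ?thesis .
  next
    case False
    then have sY: "size Y = Suc t" using Suc.prems by simp
    note Yf = Suc.prems(1)
    have YV: "set_mset Y \<subseteq> V" by (rule face_in_V[OF Yf])
    have Y0: "Y \<noteq> {#}" using sY by auto
    define A where "A = (\<Union>x\<in>set_mset Y. nonadj (Y - {#x#}))"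
    define B where "B = {v\<in>V. size (D (add_mset v Y)) < size Y}"
    define E where "E = {v\<in>V. size (D (add_mset v Y)) = size Y \<and> Y \<inter># D (add_mset v Y) = {#}}"
    have "nonadj Y \<subseteq> A \<union> B \<union> E"
    proof
      fix v assume "v \<in> nonadj Y"
      then have v: "v \<in> V" "size (D (add_mset v Y)) \<le> size Y" using nonadj_iff[OF Yf] by auto
      let ?Z = "D (add_mset v Y)"
      have Z: "face (set_mset ?Z)" "S ?Z = s v + S Y" using D[of "add_mset v Y"] v YV by auto
      show "v \<in> A \<union> B \<union> E"
      proof (cases "Y \<inter># ?Z = {#}")
        case True
        then show ?thesis using v by (auto simp: B_def E_def)
      next
        case False
        \<comment> \<open>A ray common to \<open>Y\<close> and the expansion cancels, which leaves a
          non-adjacency to the smaller face \<open>Q\<close>.\<close>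
        then obtain x where "x \<in># Y \<inter># ?Z" by blast
        then have x: "x \<in># Y" "x \<in># ?Z" by auto
        obtain R where R: "?Z = add_mset x R" using x(2) by (metis insert_DiffM)
        obtain Q where Q: "Y = add_mset x Q" using x(1) by (metis insert_DiffM)
        have Qf: "face (set_mset Q)" "face (set_mset R)"
          using face_subset[OF Yf, of "set_mset Q"] face_subset[OF Z(1), of "set_mset R"] R Q by auto
        have "S R = S (add_mset v Q)" using Z(2) R Q by simp
        then have "D (add_mset v Q) = R" using D_eqI[OF Qf(2)] v YV Q by auto
        then have "v \<in> nonadj Q" using nonadj_iff[OF Qf(1)] v R Q by simp
        then show ?thesis using x Q by (auto simp: A_def intro!: bexI[of _ x])
      qed
    qed
    moreover have fin: "finite A" "finite B" "finite E"
      using finite_nonadj finite_V by (auto simp: A_def B_def E_def)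
    ultimately have "card (nonadj Y) \<le> card (A \<union> B \<union> E)" by (intro card_mono) auto
    also have "\<dots> \<le> card A + card B + card E"
      using card_Un_le[of "A \<union> B" E] card_Un_le[of A B] by linarith
    finally have tot: "card (nonadj Y) \<le> card A + card B + card E" .
    have less: "card {v\<in>V. size (D (add_mset v Y')) < size Y'} \<le> Suc t * (1 + nonadj_bound t)"
      if "face (set_mset Y')" "size Y' = Suc t" for Y'
      by (rule card_nonadj_less[OF IH that])
    have cB: "card B \<le> Suc t * (1 + nonadj_bound t)" unfolding B_def by (rule less[OF Yf sY])
    have "card A \<le> (\<Sum>x\<in>set_mset Y. card (nonadj (Y - {#x#})))"
      unfolding A_def by (rule card_UN_le) simp
    also have "\<dots> \<le> (\<Sum>x\<in>set_mset Y. nonadj_bound t)"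
    proof (rule sum_mono)
      fix x assume "x \<in> set_mset Y"
      then have "size (Y - {#x#}) \<le> t" using sY by (simp add: size_Diff_singleton)
      moreover have "face (set_mset (Y - {#x#}))"
        by (rule face_subset[OF Yf]) (auto dest: in_diffD)
      ultimately show "card (nonadj (Y - {#x#})) \<le> nonadj_bound t" using IH by blast
    qed
    also have "\<dots> \<le> Suc t * nonadj_bound t"
    proof -
      have "card (set_mset Y) \<le> Suc t" using size_mset_mono[OF mset_set_set_mset_msubset[of Y]] sY by simp
      then show ?thesis unfolding sum_constant by (simp add: mult_le_mono1 del: mult_Suc)
    qed
    finally have cA: "card A \<le> Suc t * nonadj_bound t" .
    have cE: "card E \<le> 1 + Suc t * (1 + nonadj_bound t)"
    proof (cases "E = {}")
      case False
      then obtain v1 where v1: "v1 \<in> E" by blast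
      let ?Z = "D (add_mset v1 Y)"
      have Zf: "face (set_mset ?Z)" using D(1)[of "add_mset v1 Y"] v1 YV by (simp add: E_def)
      have sZ: "size ?Z = Suc t" using v1 sY by (simp add: E_def)
      let ?W = "{v\<in>V. size (D (add_mset v ?Z)) < size ?Z}"
      \<comment> \<open>The face \<open>?Z\<close> again has size \<open>Suc t\<close>, out of reach
        of the induction hypothesis; but relative to \<open>?Z\<close> all of \<open>E\<close>
        except \<open>v1\<close> has strictly shorter expansions, a case already bounded.\<close>
      have "E - {v1} \<subseteq> ?W"
        using degree_one_exchange[OF Yf Y0] v1 by (auto simp: E_def)
      moreover have "finite ?W" using finite_V by simp
      ultimately have "card (E - {v1}) \<le> card ?W" by (intro card_mono)
      also have "\<dots> \<le> Suc t * (1 + nonadj_bound t)" by (rule less[OF Zf sZ])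
      finally show ?thesis using card_Diff_singleton[OF v1] by simp
    qed simp
    show ?thesis using tot cA cB cE by simp
  qed
qed

end

section \<open>Positive relations modulo finitely many functionals\<close>

definition balanced :: "('v \<Rightarrow> int) set \<Rightarrow> 'v set \<Rightarrow> ('v \<Rightarrow> int) \<Rightarrow> bool" where
  "balanced \<Phi> T e \<longleftrightarrow> (\<forall>\<phi>\<in>\<Phi>. (\<Sum>x\<in>T. e x * \<phi> x) = 0)"

text \<open>\<open>\<Phi>\<close> encodes the quotient of a lattice by a common kernel. A finite
  zero set is one whose image there has 0 in its convex hull; integer coefficients avoid
  division.\<close>

definition zero_set :: "('v \<Rightarrow> int) set \<Rightarrow> 'v set \<Rightarrow> bool" where
  "zero_set \<Phi> T \<longleftrightarrow> (\<exists>e. (\<forall>x\<in>T. 0 \<le> e x) \<and> (\<exists>x\<in>T. 0 < e x) \<and> balanced \<Phi> T e)"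

text \<open>The factor \<open>a\<close> clears denominators. A positive coefficient is demanded so
  that substituting such expressions into a nontrivial relation gives a nontrivial one.\<close>

definition in_cone :: "('v \<Rightarrow> int) set \<Rightarrow> 'v set \<Rightarrow> 'v \<Rightarrow> bool" where
  "in_cone \<Phi> T x \<longleftrightarrow> (\<exists>a>0. \<exists>e. (\<forall>y\<in>T. 0 \<le> e y) \<and> (\<exists>y\<in>T. 0 < e y) \<and>
     (\<forall>\<phi>\<in>\<Phi>. (\<Sum>y\<in>T. e y * \<phi> y) = a * \<phi> x))"

text \<open>Pivoting on \<open>\<psi>\<close>: the new functionals vanish at \<open>x\<close> and,
  if \<open>\<psi> x\<close> is nonzero, describe the further quotient by \<open>x\<close>.\<close>

definition eliminate :: "('v \<Rightarrow> int) \<Rightarrow> 'v \<Rightarrow> ('v \<Rightarrow> int) set \<Rightarrow> ('v \<Rightarrow> int) set" where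
  "eliminate \<psi> x \<Phi> = (\<lambda>\<phi> y. \<psi> x * \<phi> y - \<phi> x * \<psi> y) ` (\<Phi> - {\<psi>})"

lemma card_eliminate:
  assumes "finite \<Phi>" "\<psi> \<in> \<Phi>"
  shows "finite (eliminate \<psi> x \<Phi>)" "card (eliminate \<psi> x \<Phi>) < card \<Phi>"
proof -
  show "finite (eliminate \<psi> x \<Phi>)" using assms by (simp add: eliminate_def)
  have "card (eliminate \<psi> x \<Phi>) \<le> card (\<Phi> - {\<psi>})"
    unfolding eliminate_def by (rule card_image_le) (use assms in simp)
  also have "\<dots> < card \<Phi>" by (rule card_Diff1_less[OF assms])
  finally show "card (eliminate \<psi> x \<Phi>) < card \<Phi>" .
qed

lemma balanced_eliminate:
  assumes "balanced (eliminate \<psi> x \<Phi>) T e" "\<phi> \<in> \<Phi>"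
  shows "\<psi> x * (\<Sum>y\<in>T. e y * \<phi> y) = \<phi> x * (\<Sum>y\<in>T. e y * \<psi> y)"
proof (cases "\<phi> = \<psi>")
  case False
  then have "(\<Sum>y\<in>T. e y * (\<psi> x * \<phi> y - \<phi> x * \<psi> y)) = 0"
    using assms unfolding balanced_def eliminate_def by auto
  moreover have "(\<Sum>y\<in>T. e y * (\<psi> x * \<phi> y - \<phi> x * \<psi> y))
      = \<psi> x * (\<Sum>y\<in>T. e y * \<phi> y) - \<phi> x * (\<Sum>y\<in>T. e y * \<psi> y)"
    by (simp add: sum_distrib_left sum_subtractf algebra_simps)
  ultimately show ?thesis by simp
qed simp

text \<open>Gaussian elimination over the integers, trading one functional for one element of
  \<open>T\<close>.\<close>

lemma exists_dependency:
  assumes "finite \<Phi>" "finite T" "card \<Phi> < card T"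
  shows "\<exists>d. (\<exists>x\<in>T. d x \<noteq> 0) \<and> balanced \<Phi> T d"
  using assms
proof (induction "card \<Phi>" arbitrary: \<Phi> T rule: less_induct)
  case less
  show ?case
  proof (cases "\<exists>\<psi>\<in>\<Phi>. \<exists>x\<in>T. \<psi> x \<noteq> 0")
    case False
    moreover obtain x where "x \<in> T" using less.prems by fastforce
    ultimately show ?thesis unfolding balanced_def
      by (intro exI[of _ "\<lambda>_. 1"]) auto
  next
    case True
    then obtain \<psi> x where \<psi>: "\<psi> \<in> \<Phi>" "x \<in> T" "\<psi> x \<noteq> 0" by blast
    note el = card_eliminate[OF less.prems(1) \<psi>(1), of x]
    have "card (eliminate \<psi> x \<Phi>) < card (T - {x})"
      using el less.prems \<psi> by (simp add: card_Diff_singleton)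
    then obtain d where d: "\<exists>y\<in>T - {x}. d y \<noteq> 0" "balanced (eliminate \<psi> x \<Phi>) (T - {x}) d"
      using less.hyps[OF el(2,1), of "T - {x}"] less.prems(2) by auto
    \<comment> \<open>The entry at \<open>x\<close> solves the equation of the pivot
      \<open>\<psi>\<close>; scaling the others by \<open>\<psi> x\<close> keeps it
      integral.\<close>
    define d' where "d' y = (if y = x then - (\<Sum>y\<in>T - {x}. d y * \<psi> y) else \<psi> x * d y)" for y
    have "(\<Sum>y\<in>T. d' y * \<phi> y) = 0" if \<phi>: "\<phi> \<in> \<Phi>" for \<phi>
    proof -
      have "(\<Sum>y\<in>T. d' y * \<phi> y) = d' x * \<phi> x + (\<Sum>y\<in>T - {x}. d' y * \<phi> y)"
        by (rule sum.remove[OF less.prems(2) \<psi>(2)])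
      also have "(\<Sum>y\<in>T - {x}. d' y * \<phi> y) = \<psi> x * (\<Sum>y\<in>T - {x}. d y * \<phi> y)"
        by (simp add: d'_def sum_distrib_left mult.assoc)
      also have "\<dots> = \<phi> x * (\<Sum>y\<in>T - {x}. d y * \<psi> y)" by (rule balanced_eliminate[OF d(2) \<phi>])
      finally show ?thesis by (simp add: d'_def)
    qed
    moreover have "\<exists>y\<in>T. d' y \<noteq> 0" using d(1) \<psi>(3) by (auto simp: d'_def)
    ultimately show ?thesis unfolding balanced_def by blast
  qed
qed

text \<open>While \<open>T\<close> has more elements than \<open>\<Phi>\<close>, a dependency among
  the elements of \<open>T\<close> is subtracted until a first coefficient vanishes; the coefficient
  of \<open>v\<close> stays positive.\<close>

lemma conic_caratheodory:
  assumes "finite \<Phi>" "finite T" "0 < a" "\<forall>y\<in>T. 0 \<le> e y" "\<forall>\<phi>\<in>\<Phi>. a * \<phi> v + (\<Sum>y\<in>T. e y * \<phi> y) = 0"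
  shows "\<exists>T'\<subseteq>T. card T' \<le> card \<Phi> \<and> (\<exists>a>0. \<exists>e. (\<forall>y\<in>T'. 0 \<le> e y) \<and>
    (\<forall>\<phi>\<in>\<Phi>. a * \<phi> v + (\<Sum>y\<in>T'. e y * \<phi> y) = (0::int)))"
  using assms(2-)
proof (induction "card T" arbitrary: T a e rule: less_induct)
  case less
  show ?case
  proof (cases "card T \<le> card \<Phi>")
    case True
    then show ?thesis using less.prems by blast
  next
    case False
    then obtain d0 where d0: "\<exists>x\<in>T. d0 x \<noteq> 0" "balanced \<Phi> T d0"
      using exists_dependency[OF assms(1) less.prems(1)] by auto
    obtain d where d: "\<exists>x\<in>T. d x > 0" "balanced \<Phi> T d"
    proof (cases "\<exists>x\<in>T. d0 x > 0")
      case True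
      then show ?thesis using that d0 by blast
    next
      case False
      then have "\<exists>x\<in>T. - d0 x > 0" using d0(1) by (metis neg_0_less_iff_less linorder_neqE)
      moreover have "balanced \<Phi> T (\<lambda>x. - d0 x)" using d0(2) by (simp add: balanced_def sum_negf)
      ultimately show ?thesis by (rule that)
    qed
    define P where "P = {x\<in>T. d x > 0}"
    have P: "finite P" "P \<noteq> {}" using less.prems(1) d(1) by (auto simp: P_def)
    \<comment> \<open>The place where a coefficient first vanishes when multiples of
      \<open>d\<close> are subtracted from \<open>e\<close>.\<close>
    define x where "x = arg_min_on (\<lambda>x. real_of_int (e x) / real_of_int (d x)) P"
    have xP: "x \<in> P" unfolding x_def by (rule arg_min_if_finite(1)[OF P])
    have dx: "d x > 0" "x \<in> T" using xP by (auto simp: P_def)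
    have min: "e x * d y \<le> e y * d x" if "y \<in> T" "d y > 0" for y
    proof -
      have "y \<in> P" using that by (simp add: P_def)
      then have "real_of_int (e x) / real_of_int (d x) \<le> real_of_int (e y) / real_of_int (d y)"
        unfolding x_def by (rule arg_min_least[OF P])
      then have "real_of_int (e x) * real_of_int (d y) \<le> real_of_int (e y) * real_of_int (d x)"
        using dx that by (simp add: field_simps)
      then show ?thesis by (metis of_int_le_iff of_int_mult)
    qed
    \<comment> \<open>Scaled by \<open>d x\<close> to stay integral; it vanishes at
      \<open>x\<close>.\<close>
    define e' where "e' y = d x * e y - e x * d y" for y
    have e'0: "0 \<le> e' y" if y: "y \<in> T" for y
    proof (cases "d y > 0")
      case True
      then show ?thesis using min[OF y] by (simp add: e'_def mult.commute)
    next
      case False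
      then have "e x * d y \<le> 0" using less.prems(3) dx(2) by (simp add: mult_nonneg_nonpos)
      moreover have "0 \<le> d x * e y" using less.prems(3) dx y by simp
      ultimately show ?thesis by (simp add: e'_def)
    qed
    have bal: "d x * a * \<phi> v + (\<Sum>y\<in>T - {x}. e' y * \<phi> y) = 0" if \<phi>: "\<phi> \<in> \<Phi>" for \<phi>
    proof -
      have "(\<Sum>y\<in>T. e' y * \<phi> y) = d x * (\<Sum>y\<in>T. e y * \<phi> y) - e x * (\<Sum>y\<in>T. d y * \<phi> y)"
        by (simp add: e'_def sum_distrib_left sum_subtractf algebra_simps)
      also have "(\<Sum>y\<in>T. d y * \<phi> y) = 0" using d(2) \<phi> by (simp add: balanced_def)
      also have "(\<Sum>y\<in>T. e y * \<phi> y) = - (a * \<phi> v)" using less.prems(4) \<phi> by (metis add.inverse_unique add.commute minus_equation_iff)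
      finally have "(\<Sum>y\<in>T. e' y * \<phi> y) = - (d x * a * \<phi> v)" by simp
      moreover have "(\<Sum>y\<in>T. e' y * \<phi> y) = (\<Sum>y\<in>T - {x}. e' y * \<phi> y)"
        using sum.remove[OF less.prems(1) dx(2), of "\<lambda>y. e' y * \<phi> y"] by (simp add: e'_def mult.commute)
      ultimately show ?thesis by simp
    qed
    have c: "card (T - {x}) < card T" using less.prems(1) dx(2) by (rule card_Diff1_less)
    have "\<exists>T'\<subseteq>T - {x}. card T' \<le> card \<Phi> \<and> (\<exists>a>0. \<exists>e. (\<forall>y\<in>T'. 0 \<le> e y) \<and>
        (\<forall>\<phi>\<in>\<Phi>. a * \<phi> v + (\<Sum>y\<in>T'. e y * \<phi> y) = 0))"
      by (rule less.hyps[OF c, of "d x * a" e']) (use less.prems dx e'0 bal in auto)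
    then show ?thesis by blast
  qed
qed

section \<open>A weak colourful Caratheodory theorem\<close>

text \<open>One colour for the first class and a block of \<open>colour_bound b q\<close> colours
  for each of its at most \<open>b\<close> elements.\<close>

fun colour_bound :: "nat \<Rightarrow> nat \<Rightarrow> nat" where
  "colour_bound b 0 = 1"
| "colour_bound b (Suc q) = Suc (b * colour_bound b q)"

definition transversal :: "'v list \<Rightarrow> 'v set list \<Rightarrow> bool" where
  "transversal ts Ps \<longleftrightarrow> list_all2 (\<in>) ts Ps"

lemma transversal_simps [simp]:
  "transversal [] []"
  "transversal ts [] \<longleftrightarrow> ts = []"
  "transversal (t # ts) (P # Ps) \<longleftrightarrow> t \<in> P \<and> transversal ts Ps"
  by (auto simp: transversal_def)

lemma transversal_append: "transversal ts Ps \<Longrightarrow> transversal ts' Ps' \<Longrightarrow> transversal (ts @ ts') (Ps @ Ps')"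
  by (simp add: transversal_def list_all2_appendI)

lemma transversal_exists: "\<forall>P\<in>set Ps. P \<noteq> {} \<Longrightarrow> \<exists>ts. transversal ts Ps"
proof (induction Ps)
  case (Cons P Ps)
  then obtain ts t where "transversal ts Ps" "t \<in> P" by fastforce
  then have "transversal (t # ts) (P # Ps)" by simp
  then show ?case by blast
qed auto

lemma zero_set_nonempty: "zero_set \<Phi> P \<Longrightarrow> P \<noteq> {}"
  by (auto simp: zero_set_def)

lemma sum_extend_zero:
  fixes e :: "'v \<Rightarrow> int"
  assumes "finite T'" "T \<subseteq> T'"
  shows "(\<Sum>x\<in>T'. (if x \<in> T then e x else 0) * \<phi> x) = (\<Sum>x\<in>T. e x * \<phi> x)"
  using assms by (intro sum.mono_neutral_cong_right) auto

lemma zero_set_mono: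
  assumes "zero_set \<Phi> T" "T \<subseteq> T'" "finite T'"
  shows "zero_set \<Phi> T'"
proof -
  obtain e where e: "\<forall>x\<in>T. 0 \<le> e x" "\<exists>x\<in>T. 0 < e x" "balanced \<Phi> T e"
    using assms(1) by (auto simp: zero_set_def)
  show ?thesis unfolding zero_set_def
    using e assms(2) sum_extend_zero[OF assms(3,2)]
    by (intro exI[of _ "\<lambda>x. if x \<in> T then e x else 0"]) (auto simp: balanced_def)
qed

lemma in_cone_mono:
  assumes "in_cone \<Phi> T x" "T \<subseteq> T'" "finite T'"
  shows "in_cone \<Phi> T' x"
proof -
  obtain a e where e: "a > 0" "\<forall>x\<in>T. 0 \<le> e x" "\<exists>x\<in>T. 0 < e x"
    "\<forall>\<phi>\<in>\<Phi>. (\<Sum>y\<in>T. e y * \<phi> y) = a * \<phi> x"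
    using assms(1) by (auto simp: in_cone_def)
  show ?thesis unfolding in_cone_def
    using e assms(2) sum_extend_zero[OF assms(3,2)]
    by (intro exI[of _ a] conjI exI[of _ "\<lambda>x. if x \<in> T then e x else 0"]) auto
qed

text \<open>The expressions of the elements of \<open>P\<close> over \<open>T\<close> are
  substituted into the relation on \<open>P\<close>.\<close>

lemma zero_set_combine:
  assumes P: "zero_set \<Phi> P" "finite P" and T: "finite T" and cone: "\<And>x. x \<in> P \<Longrightarrow> in_cone \<Phi> T x"
  shows "zero_set \<Phi> T"
proof -
  obtain c where c: "\<forall>x\<in>P. 0 \<le> c x" "\<exists>x\<in>P. 0 < c x" "balanced \<Phi> P c"
    using P by (auto simp: zero_set_def)
  define Q where "Q x a e \<longleftrightarrow> (\<forall>y\<in>T. 0 \<le> e y) \<and> (\<exists>y\<in>T. 0 < e y) \<and>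
     (\<forall>\<phi>\<in>\<Phi>. (\<Sum>y\<in>T. e y * \<phi> y) = (a::int) * \<phi> x)" for x a e
  have "\<forall>x\<in>P. \<exists>a. a > 0 \<and> (\<exists>e. Q x a e)"
    using cone unfolding in_cone_def Q_def by blast
  from bchoice[OF this] obtain a where a: "\<forall>x\<in>P. a x > 0 \<and> (\<exists>e. Q x (a x) e)" by blast
  then have "\<forall>x\<in>P. \<exists>e. Q x (a x) e" by blast
  from bchoice[OF this] obtain e where e: "\<forall>x\<in>P. Q x (a x) (e x)" by blast
  have ae: "\<And>x. x \<in> P \<Longrightarrow> a x > 0" "\<And>x y. x \<in> P \<Longrightarrow> y \<in> T \<Longrightarrow> 0 \<le> e x y"
    "\<And>x. x \<in> P \<Longrightarrow> \<exists>y\<in>T. 0 < e x y"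
    "\<And>x \<phi>. x \<in> P \<Longrightarrow> \<phi> \<in> \<Phi> \<Longrightarrow> (\<Sum>y\<in>T. e x y * \<phi> y) = a x * \<phi> x"
    using a e unfolding Q_def by blast+
  \<comment> \<open>The product of the other multipliers makes \<open>w x * a x\<close> equal to
    \<open>c x\<close> times a factor common to all \<open>x\<close>.\<close>
  define w where "w x = c x * (\<Prod>z\<in>P - {x}. a z)" for x
  have w0: "0 \<le> w x" if "x \<in> P" for x
    unfolding w_def using c(1) that ae(1) by (intro mult_nonneg_nonneg prod_nonneg) (auto simp: less_imp_le)
  have wpos: "0 < w x" if "x \<in> P" "0 < c x" for x
    unfolding w_def using that ae(1) by (intro mult_pos_pos prod_pos) auto
  have wa: "w x * a x = c x * (\<Prod>z\<in>P. a z)" if "x \<in> P" for x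
    using prod.remove[OF P(2) that, of a] by (simp add: w_def mult_ac)
  define e' where "e' y = (\<Sum>x\<in>P. w x * e x y)" for y
  have "\<forall>y\<in>T. 0 \<le> e' y" unfolding e'_def using w0 ae(2) by (auto intro!: sum_nonneg)
  moreover have "\<exists>y\<in>T. 0 < e' y"
  proof -
    obtain x where x: "x \<in> P" "0 < c x" using c(2) by blast
    obtain y where y: "y \<in> T" "0 < e x y" using ae(3)[OF x(1)] by blast
    have "0 < e' y" unfolding e'_def
      by (rule sum_pos2[OF P(2) x(1)]) (use w0 ae(2) wpos x y in auto)
    then show ?thesis using y by blast
  qed
  moreover have "balanced \<Phi> T e'" unfolding balanced_def
  proof
    fix \<phi> assume \<phi>: "\<phi> \<in> \<Phi>"
    have "(\<Sum>y\<in>T. e' y * \<phi> y) = (\<Sum>y\<in>T. \<Sum>x\<in>P. w x * (e x y * \<phi> y))"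
      by (simp add: e'_def sum_distrib_right mult.assoc)
    also have "\<dots> = (\<Sum>x\<in>P. \<Sum>y\<in>T. w x * (e x y * \<phi> y))" by (rule sum.swap)
    also have "\<dots> = (\<Sum>x\<in>P. w x * (a x * \<phi> x))"
      by (rule sum.cong) (simp_all add: ae(4) \<phi> flip: sum_distrib_left)
    also have "\<dots> = (\<Sum>x\<in>P. (\<Prod>z\<in>P. a z) * (c x * \<phi> x))"
    proof (rule sum.cong)
      fix x assume "x \<in> P"
      have "w x * (a x * \<phi> x) = (w x * a x) * \<phi> x" by simp
      then show "w x * (a x * \<phi> x) = (\<Prod>z\<in>P. a z) * (c x * \<phi> x)" using wa[OF \<open>x \<in> P\<close>] by simp
    qed simp
    also have "\<dots> = (\<Prod>z\<in>P. a z) * (\<Sum>x\<in>P. c x * \<phi> x)" by (simp add: sum_distrib_left)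
    finally show "(\<Sum>y\<in>T. e' y * \<phi> y) = 0" using c(3) \<phi> by (simp add: balanced_def)
  qed
  ultimately show ?thesis unfolding zero_set_def by blast
qed

text \<open>A relation on \<open>T\<close> modulo \<open>x\<close> equates a combination of
  \<open>T\<close> with a multiple of \<open>x\<close>. A positive multiple puts \<open>x\<close>
  into the cone; any other changes sides and joins the relation.\<close>

lemma zero_set_or_in_cone:
  assumes "zero_set (eliminate \<psi> x \<Phi>) T" "finite T" "\<psi> x \<noteq> 0"
  shows "zero_set \<Phi> (insert x T) \<or> in_cone \<Phi> T x"
proof -
  obtain e where e: "\<forall>y\<in>T. 0 \<le> e y" "\<exists>y\<in>T. 0 < e y" "balanced (eliminate \<psi> x \<Phi>) T e"
    using assms(1) by (auto simp: zero_set_def)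
  define a where "a = \<psi> x"
  define \<beta> where "\<beta> = (\<Sum>y\<in>T. e y * \<psi> y)"
  have aa: "a * a > 0" using assms(3) by (auto simp: a_def zero_less_mult_iff)
  \<comment> \<open>The factor \<open>a * a\<close> clears the pivot and keeps the coefficients
    nonnegative whatever the sign of \<open>\<psi> x\<close>.\<close>
  have eq: "(\<Sum>y\<in>T. (a * a * e y) * \<phi> y) = (a * \<beta>) * \<phi> x" if "\<phi> \<in> \<Phi>" for \<phi>
  proof -
    have "(\<Sum>y\<in>T. (a * a * e y) * \<phi> y) = a * (a * (\<Sum>y\<in>T. e y * \<phi> y))"
      by (simp add: sum_distrib_left mult_ac)
    also have "a * (\<Sum>y\<in>T. e y * \<phi> y) = \<phi> x * \<beta>"
      using balanced_eliminate[OF e(3) that] by (simp add: a_def \<beta>_def)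
    finally show ?thesis by (simp add: mult_ac)
  qed
  have nonneg: "\<forall>y\<in>T. 0 \<le> a * a * e y" using e(1) aa by simp
  have pos: "\<exists>y\<in>T. 0 < a * a * e y" using e(2) aa by (metis mult_pos_pos)
  show ?thesis
  proof (cases "a * \<beta> > 0")
    case True
    then have "in_cone \<Phi> T x" unfolding in_cone_def using eq nonneg pos
      by (intro exI[of _ "a * \<beta>"] conjI exI[of _ "\<lambda>y. a * a * e y"]) auto
    then show ?thesis ..
  next
    case False
    define e' where "e' y = (if y \<in> T then a * a * e y else 0) + (if y = x then - (a * \<beta>) else 0)" for y
    have "balanced \<Phi> (insert x T) e'" unfolding balanced_def
    proof
      fix \<phi> assume \<phi>: "\<phi> \<in> \<Phi>"
      have "(\<Sum>y\<in>insert x T. e' y * \<phi> y)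
          = (\<Sum>y\<in>insert x T. (if y \<in> T then a * a * e y else 0) * \<phi> y)
            + (\<Sum>y\<in>insert x T. (if y = x then - (a * \<beta>) else 0) * \<phi> y)"
        by (simp add: e'_def distrib_right sum.distrib)
      also have "(\<Sum>y\<in>insert x T. (if y \<in> T then a * a * e y else 0) * \<phi> y) = (a * \<beta>) * \<phi> x"
        using sum_extend_zero[of "insert x T" T "\<lambda>y. a * a * e y" \<phi>] assms(2) eq[OF \<phi>] by auto
      also have "(\<Sum>y\<in>insert x T. (if y = x then - (a * \<beta>) else 0) * \<phi> y) = (\<Sum>y\<in>{x}. - (a * \<beta>) * \<phi> y)"
        using assms(2) by (intro sum.mono_neutral_cong_right) auto
      finally show "(\<Sum>y\<in>insert x T. e' y * \<phi> y) = 0" by simp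
    qed
    moreover have "\<forall>y\<in>insert x T. 0 \<le> e' y" using nonneg False by (auto simp: e'_def)
    moreover have "\<exists>y\<in>insert x T. 0 < e' y"
    proof -
      obtain y where "y \<in> T" "0 < a * a * e y" using pos by blast
      then show ?thesis using False by (intro bexI[of _ y]) (auto simp: e'_def)
    qed
    ultimately show ?thesis unfolding zero_set_def by blast
  qed
qed

text \<open>
  A weak form of the colourful Caratheodory theorem, with more colours than necessary: given the
  first colour class \<open>P\<close>, work modulo each of its elements with a separate block of colours.
\<close>

lemma colourful_caratheodory:
  assumes "finite \<Phi>" "card \<Phi> \<le> q" "length Ps \<ge> colour_bound b q"
    "\<forall>P\<in>set Ps. finite P \<and> card P \<le> b \<and> zero_set \<Phi> P"
  shows "\<exists>ts. transversal ts Ps \<and> zero_set \<Phi> (set ts)"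
  using assms
proof (induction q arbitrary: \<Phi> Ps)
  case 0
  \<comment> \<open>Without functionals every nonempty finite set is a zero set, so one colour
    suffices.\<close>
  then have [simp]: "\<Phi> = {}" by simp
  obtain ts where ts: "transversal ts Ps"
    using transversal_exists[of Ps] 0 zero_set_nonempty by metis
  obtain P Qs where "Ps = P # Qs" using 0 by (cases Ps) auto
  then obtain t ts' where "ts = t # ts'" using ts by (auto simp: transversal_def list_all2_Cons2)
  then have "zero_set \<Phi> (set ts)"
    unfolding zero_set_def balanced_def by (intro exI[of _ "\<lambda>_. 1"]) auto
  then show ?case using ts by blast
next
  case (Suc q)
  obtain P Qs where PQ: "Ps = P # Qs" using Suc.prems by (cases Ps) auto
  define R where "R = colour_bound b q"
  have P: "finite P" "card P \<le> b" "zero_set \<Phi> P" using Suc.prems PQ by auto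
  have len: "b * R \<le> length Qs" using Suc.prems PQ by (simp add: R_def)
  have Qs: "\<forall>P\<in>set Qs. finite P \<and> card P \<le> b \<and> zero_set \<Phi> P" using Suc.prems PQ by simp
  have zero_set_el: "zero_set (eliminate \<psi> x \<Phi>) Q" if Q: "zero_set \<Phi> Q" and \<psi>: "\<psi> \<in> \<Phi>" for \<psi> x Q
  proof -
    obtain e where e: "\<forall>x\<in>Q. 0 \<le> e x" "\<exists>x\<in>Q. 0 < e x" "balanced \<Phi> Q e"
      using Q by (auto simp: zero_set_def)
    have "balanced (eliminate \<psi> x \<Phi>) Q e" unfolding balanced_def
    proof
      fix \<phi>' assume "\<phi>' \<in> eliminate \<psi> x \<Phi>"
      then obtain \<phi> where \<phi>: "\<phi> \<in> \<Phi>" "\<phi>' = (\<lambda>y. \<psi> x * \<phi> y - \<phi> x * \<psi> y)"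
        unfolding eliminate_def by blast
      have "(\<Sum>y\<in>Q. e y * \<phi>' y) = \<psi> x * (\<Sum>y\<in>Q. e y * \<phi> y) - \<phi> x * (\<Sum>y\<in>Q. e y * \<psi> y)"
        by (simp add: \<phi>(2) sum_distrib_left sum_subtractf algebra_simps)
      then show "(\<Sum>y\<in>Q. e y * \<phi>' y) = 0" using e(3) \<psi> \<phi>(1) by (simp add: balanced_def)
    qed
    then show ?thesis using e unfolding zero_set_def by blast
  qed
  \<comment> \<open>Each element of \<open>xs\<close> consumes its own block of \<open>R\<close>
    colours, treated in the quotient by that element. Either one of them completes the chosen
    elements to a zero set, or all of them lie in the cone of the chosen elements.\<close>
  have blocks: "\<exists>ts. transversal ts Qs \<and>
      ((\<exists>x\<in>set xs. zero_set \<Phi> (insert x (set ts))) \<or> (\<forall>x\<in>set xs. in_cone \<Phi> (set ts) x))"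
    if "length xs * R \<le> length Qs" "\<forall>P\<in>set Qs. finite P \<and> card P \<le> b \<and> zero_set \<Phi> P" for xs Qs
    using that
  proof (induction xs arbitrary: Qs)
    case Nil
    then show ?case using transversal_exists[of Qs] zero_set_nonempty by auto
  next
    case (Cons x xs)
    define Q1 where "Q1 = take R Qs"
    define Q2 where "Q2 = drop R Qs"
    have Q12: "Qs = Q1 @ Q2" by (simp add: Q1_def Q2_def)
    have lQ: "length Q1 = R" "length xs * R \<le> length Q2" using Cons.prems(1) by (auto simp: Q1_def Q2_def)
    have "\<forall>P\<in>set Q2. finite P \<and> card P \<le> b \<and> zero_set \<Phi> P" using Cons.prems(2) Q12 by simp
    from Cons.IH[OF lQ(2) this] obtain ts2 where ts2: "transversal ts2 Q2"
      "(\<exists>x\<in>set xs. zero_set \<Phi> (insert x (set ts2))) \<or> (\<forall>x\<in>set xs. in_cone \<Phi> (set ts2) x)" by blast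
    have Q1: "\<forall>P\<in>set Q1. finite P \<and> card P \<le> b \<and> zero_set \<Phi> P" using Cons.prems(2) Q12 by simp
    have "\<exists>ts1. transversal ts1 Q1 \<and> (zero_set \<Phi> (insert x (set ts1)) \<or> in_cone \<Phi> (set ts1) x)"
    proof (cases "\<exists>\<psi>\<in>\<Phi>. \<psi> x \<noteq> 0")
      case True
      then obtain \<psi> where \<psi>: "\<psi> \<in> \<Phi>" "\<psi> x \<noteq> 0" by blast
      note el = card_eliminate[OF Suc.prems(1) \<psi>(1), of x]
      have "\<exists>ts. transversal ts Q1 \<and> zero_set (eliminate \<psi> x \<Phi>) (set ts)"
        by (rule Suc.IH[OF el(1)]) (use el(2) Suc.prems(2) lQ(1) Q1 zero_set_el[OF _ \<psi>(1)] in \<open>auto simp: R_def\<close>)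
      then show ?thesis using zero_set_or_in_cone[of \<psi> x \<Phi>] \<psi>(2) by blast
    next
      case False
      obtain ts1 where ts1: "transversal ts1 Q1" using transversal_exists[of Q1] Q1 zero_set_nonempty by metis
      \<comment> \<open>Here \<open>x\<close> vanishes modulo \<open>\<Phi>\<close>, so its block
        may be chosen arbitrarily.\<close>
      have "zero_set \<Phi> {x}" unfolding zero_set_def balanced_def
        using False by (intro exI[of _ "\<lambda>_. 1"]) auto
      then have "zero_set \<Phi> (insert x (set ts1))" by (rule zero_set_mono) auto
      then show ?thesis using ts1 by blast
    qed
    then obtain ts1 where ts1: "transversal ts1 Q1" "zero_set \<Phi> (insert x (set ts1)) \<or> in_cone \<Phi> (set ts1) x"
      by blast
    have "transversal (ts1 @ ts2) Qs" unfolding Q12 by (rule transversal_append[OF ts1(1) ts2(1)])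
    moreover have "(\<exists>y\<in>set (x # xs). zero_set \<Phi> (insert y (set (ts1 @ ts2)))) \<or>
        (\<forall>y\<in>set (x # xs). in_cone \<Phi> (set (ts1 @ ts2)) y)"
    proof -
      have m1: "zero_set \<Phi> (insert x (set (ts1 @ ts2)))" if "zero_set \<Phi> (insert x (set ts1))"
        using zero_set_mono[OF that] by auto
      have m2: "in_cone \<Phi> (set (ts1 @ ts2)) x" if "in_cone \<Phi> (set ts1) x"
        using in_cone_mono[OF that] by auto
      have m3: "zero_set \<Phi> (insert y (set (ts1 @ ts2)))" if "zero_set \<Phi> (insert y (set ts2))" for y
        using zero_set_mono[OF that, of "insert y (set (ts1 @ ts2))"] by auto
      have m4: "in_cone \<Phi> (set (ts1 @ ts2)) y" if "in_cone \<Phi> (set ts2) y" for y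
        using in_cone_mono[OF that, of "set (ts1 @ ts2)"] by auto
      show ?thesis using ts1(2) ts2(2) m1 m2 m3 m4 by (metis list.set_intros(1) list.set_intros(2) set_ConsD)
    qed
    ultimately show ?case by blast
  qed
  obtain xs where xs: "set xs = P" "length xs = card P"
    using finite_distinct_list[OF P(1)] distinct_card by metis
  have "length xs * R \<le> b * R" using xs(2) P(2) by simp
  then have "length xs * R \<le> length Qs" using len by linarith
  from blocks[OF this Qs] obtain ts where ts: "transversal ts Qs"
    "(\<exists>x\<in>P. zero_set \<Phi> (insert x (set ts))) \<or> (\<forall>x\<in>P. in_cone \<Phi> (set ts) x)" using xs(1) by blast
  from ts(2) show ?case
  proof
    assume "\<exists>x\<in>P. zero_set \<Phi> (insert x (set ts))"
    then obtain x where "x \<in> P" "zero_set \<Phi> (insert x (set ts))" by blast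
    then have "transversal (x # ts) Ps \<and> zero_set \<Phi> (set (x # ts))" using ts(1) PQ by simp
    then show ?thesis by blast
  next
    assume c: "\<forall>x\<in>P. in_cone \<Phi> (set ts) x"
    obtain x where x: "x \<in> P" using zero_set_nonempty[OF P(3)] by blast
    \<comment> \<open>The relation on the first class is transported to the chosen elements, and any
      \<open>x\<close> in \<open>P\<close> completes the transversal.\<close>
    have "zero_set \<Phi> (set ts)" by (rule zero_set_combine[OF P(3,1)]) (use c in auto)
    then have "zero_set \<Phi> (set (x # ts))" by (rule zero_set_mono) auto
    moreover have "transversal (x # ts) Ps" using ts(1) PQ x by simp
    ultimately show ?thesis by blast
  qed
qed

section \<open>Exhausting the complement of a zero-sum collection\<close>

text \<open>In \<open>hitting\<close>, \<open>b\<close> bounds the colour classes, \<open>r\<close>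
  is the number of colours and \<open>e\<close> the size of \<open>E\<close>. Each of at most
  \<open>b ^ r\<close> transversals forbids at most \<open>nonadj_bound (r + e)\<close>
  rays.\<close>

definition hit_bound :: "nat \<Rightarrow> nat \<Rightarrow> nat" where
  "hit_bound q e = (let b = q + 1 + e; r = colour_bound b q in b ^ r * nonadj_bound (r + e))"

text \<open>Bounds the exhausting set after \<open>t\<close> rounds; each round adds one hitting set
  for every face inside the current set, hence the power of 2.\<close>

fun exhaust_bound :: "nat \<Rightarrow> nat \<Rightarrow> nat" where
  "exhaust_bound q 0 = 0"
| "exhaust_bound q (Suc t) =
     exhaust_bound q t + 2 ^ exhaust_bound q t * (\<Sum>e\<le>exhaust_bound q t. hit_bound q e)"

lemma finite_card_transversals:
  assumes "\<forall>P\<in>set Ps. finite P \<and> card P \<le> b"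
  shows "finite {ts. transversal ts Ps} \<and> card {ts. transversal ts Ps} \<le> b ^ length Ps"
  using assms
proof (induction Ps)
  case (Cons P Ps)
  have eq: "{ts. transversal ts (P # Ps)} = (\<lambda>(t, ts). t # ts) ` (P \<times> {ts. transversal ts Ps})"
    by (auto simp: transversal_def list_all2_Cons2)
  have fin: "finite P" "finite {ts. transversal ts Ps}" using Cons by auto
  have "card {ts. transversal ts (P # Ps)} \<le> card (P \<times> {ts. transversal ts Ps})"
    unfolding eq by (rule card_image_le) (use fin in simp)
  also have "\<dots> \<le> b * b ^ length Ps"
    unfolding card_cartesian_product by (rule mult_le_mono) (use Cons in auto)
  finally show ?case unfolding eq using fin by simp
qed simp

context smooth_fano
begin

definition nb :: "'v set \<Rightarrow> 'v set" where
  "nb X = {v\<in>V. \<not> face (insert v X)}"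

lemma card_nb:
  assumes "face X" "card X \<le> t"
  shows "card (nb X) \<le> nonadj_bound t"
proof -
  have "finite X" by (rule face_finite[OF assms(1)])
  then have "nb X = nonadj (mset_set X)" by (simp add: nb_def nonadj_def)
  then show ?thesis using card_nonadj[of "mset_set X" t] assms \<open>finite X\<close> by simp
qed

text \<open>Otherwise \<open>r\<close> members of \<open>\<P>\<close> can be chosen greedily, each
  avoiding all rays that span no cone with \<open>E\<close> and some transversal of the earlier
  ones. Then every transversal is a face, while \<open>colourful_caratheodory\<close> finds one that
  is a zero set, against \<open>no_zero_face\<close>.\<close>

lemma hitting:
  assumes \<Phi>: "finite \<Phi>" "card \<Phi> \<le> q" and W: "W \<subseteq> V"
    and no_zero_face: "\<And>T. T \<subseteq> W \<Longrightarrow> zero_set \<Phi> T \<Longrightarrow> \<not> face T"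
    and E: "face E" "E \<subseteq> W"
    and fam: "\<And>P. P \<in> \<P> \<Longrightarrow> P \<subseteq> W \<and> card P \<le> q + 1 \<and> zero_set \<Phi> (P \<union> E)"
  shows "\<exists>X\<subseteq>V. card X \<le> hit_bound q (card E) \<and> (\<forall>P\<in>\<P>. P \<inter> X \<noteq> {})"
proof (rule ccontr)
  assume "\<not> ?thesis"
  then have no: "\<exists>P\<in>\<P>. P \<inter> X = {}" if "X \<subseteq> V" "card X \<le> hit_bound q (card E)" for X
    using that by blast
  define b where "b = q + 1 + card E"
  define r where "r = colour_bound b q"
  \<comment> \<open>Only together with \<open>E\<close> is a member of \<open>\<P>\<close> known to
    be a zero set. Choosing an element of \<open>E\<close> from a class is harmless, as
    \<open>E\<close> belongs to all faces considered.\<close>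
  define ext where "ext Ps = map (\<lambda>P. P \<union> E) Ps" for Ps
  have finE: "finite E" by (rule face_finite[OF E(1)])
  have ext: "\<forall>P\<in>set (ext Ps). finite P \<and> card P \<le> b \<and> zero_set \<Phi> P \<and> P \<subseteq> W" if Ps: "set Ps \<subseteq> \<P>" for Ps
  proof
    fix Q assume "Q \<in> set (ext Ps)"
    then obtain P where P: "P \<in> \<P>" "Q = P \<union> E" using Ps by (auto simp: ext_def)
    have "P \<subseteq> V" using fam[OF P(1)] W by auto
    then have "finite P" by (rule finite_subset[OF _ finite_V])
    moreover have "card Q \<le> card P + card E" unfolding P(2) by (rule card_Un_le)
    ultimately show "finite Q \<and> card Q \<le> b \<and> zero_set \<Phi> Q \<and> Q \<subseteq> W"
      using fam[OF P(1)] P(2) finE E(2) by (auto simp: b_def)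
  qed
  have "\<exists>Ps. length Ps = m \<and> set Ps \<subseteq> \<P> \<and> (\<forall>ts. transversal ts (ext Ps) \<longrightarrow> face (set ts \<union> E))"
    if "m \<le> r" for m
    using that
  proof (induction m)
    case 0
    show ?case using E by (intro exI[of _ "[]"]) (simp add: ext_def)
  next
    case (Suc m)
    then obtain Ps where Ps: "length Ps = m" "set Ps \<subseteq> \<P>"
      "\<And>ts. transversal ts (ext Ps) \<Longrightarrow> face (set ts \<union> E)" by auto
    define TR where "TR = {ts. transversal ts (ext Ps)}"
    have lenext: "length (ext Ps) = m" using Ps(1) by (simp add: ext_def)
    have TR: "finite TR" "card TR \<le> b ^ m"
      using finite_card_transversals[of "ext Ps" b] ext[OF Ps(2)] lenext by (auto simp: TR_def)
    define X where "X = (\<Union>ts\<in>TR. nb (set ts \<union> E))"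
    have "card X \<le> (\<Sum>ts\<in>TR. card (nb (set ts \<union> E)))"
      unfolding X_def by (rule card_UN_le[OF TR(1)])
    also have "\<dots> \<le> (\<Sum>ts\<in>TR. nonadj_bound (r + card E))"
    proof (rule sum_mono)
      fix ts assume ts: "ts \<in> TR"
      then have "length ts = m" using lenext by (auto simp: TR_def transversal_def dest: list_all2_lengthD)
      then have "card (set ts) \<le> r" using card_length[of ts] Suc.prems by linarith
      then have "card (set ts \<union> E) \<le> r + card E" using card_Un_le[of "set ts" E] by linarith
      then show "card (nb (set ts \<union> E)) \<le> nonadj_bound (r + card E)"
        using card_nb Ps(3) ts by (simp add: TR_def)
    qed
    also have "\<dots> = card TR * nonadj_bound (r + card E)" by simp
    also have "\<dots> \<le> b ^ r * nonadj_bound (r + card E)"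
    proof (rule mult_le_mono1)
      have "b ^ m \<le> b ^ r" using Suc.prems by (intro power_increasing) (auto simp: b_def)
      then show "card TR \<le> b ^ r" using TR(2) by linarith
    qed
    also have "\<dots> = hit_bound q (card E)" by (simp add: hit_bound_def b_def r_def Let_def)
    finally have "card X \<le> hit_bound q (card E)" .
    moreover have "X \<subseteq> V" by (auto simp: X_def nb_def)
    ultimately obtain P where P: "P \<in> \<P>" "P \<inter> X = {}" using no by blast
    have "face (set ts \<union> E)" if ts: "transversal ts (ext (P # Ps))" for ts
    proof -
      obtain t ts' where t: "ts = t # ts'" "t \<in> P \<union> E" "transversal ts' (ext Ps)"
        using ts by (auto simp: ext_def transversal_def list_all2_Cons2)
      have f: "face (set ts' \<union> E)" by (rule Ps(3)[OF t(3)])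
      show ?thesis
      proof (cases "t \<in> E")
        case True
        then show ?thesis using f t(1) by (simp add: insert_absorb)
      next
        case False
        then have "t \<in> P" using t(2) by blast
        then have "t \<in> V" "t \<notin> nb (set ts' \<union> E)" using P fam[OF P(1)] W t(3) by (auto simp: X_def TR_def)
        then show ?thesis using t(1) by (simp add: nb_def)
      qed
    qed
    then show ?case using Ps(1,2) P(1) by (intro exI[of _ "P # Ps"]) auto
  qed
  from this[of r] obtain Ps where Ps: "length Ps = r" "set Ps \<subseteq> \<P>"
    "\<And>ts. transversal ts (ext Ps) \<Longrightarrow> face (set ts \<union> E)" by auto
  have "\<exists>ts. transversal ts (ext Ps) \<and> zero_set \<Phi> (set ts)"
    by (rule colourful_caratheodory[OF \<Phi>, where b = b]) (use Ps ext[OF Ps(2)] in \<open>auto simp: ext_def r_def\<close>)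
  then obtain ts where ts: "transversal ts (ext Ps)" "zero_set \<Phi> (set ts)" by blast
  have "set ts \<subseteq> W"
  proof
    fix t assume "t \<in> set ts"
    then obtain Q where "Q \<in> set (ext Ps)" "t \<in> Q"
      using ts(1) unfolding transversal_def list_all2_conv_all_nth in_set_conv_nth by fastforce
    then show "t \<in> W" using ext[OF Ps(2)] by blast
  qed
  moreover have "face (set ts)" using Ps(3)[OF ts(1)] face_subset by blast
  ultimately show False using no_zero_face ts(2) by blast
qed

text \<open>Each \<open>v\<close> gets a face \<open>T v\<close> of at most \<open>q\<close> rays
  such that \<open>insert v (T v)\<close> is a zero set. A set \<open>E\<close> grows in rounds,
  each catching one more ray of \<open>T v\<close> for every remaining \<open>v\<close>; after
  \<open>q + 1\<close> rounds no \<open>v\<close> can remain.\<close>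

theorem card_le_exhaust_bound:
  assumes \<Phi>: "finite \<Phi>" "card \<Phi> \<le> q" and W: "W \<subseteq> V"
    and no_zero_face: "\<And>T. T \<subseteq> W \<Longrightarrow> zero_set \<Phi> T \<Longrightarrow> \<not> face T"
    and opposite: "\<And>v. v \<in> W \<Longrightarrow> \<exists>T\<subseteq>W. face T \<and> (\<exists>a>0. \<exists>e. (\<forall>y\<in>T. 0 \<le> e y) \<and>
      (\<forall>\<phi>\<in>\<Phi>. a * \<phi> v + (\<Sum>y\<in>T. e y * \<phi> y) = (0::int)))"
  shows "card W \<le> exhaust_bound q (Suc q)"
proof -
  have finW: "finite W" using W finite_V finite_subset by blast
  have "\<exists>T\<subseteq>W. face T \<and> card T \<le> q \<and> zero_set \<Phi> (insert v T)" if v: "v \<in> W" for v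
  proof -
    obtain T a e where T: "T \<subseteq> W" "face T" "a > 0" "\<forall>y\<in>T. 0 \<le> e y"
      "\<forall>\<phi>\<in>\<Phi>. a * \<phi> v + (\<Sum>y\<in>T. e y * \<phi> y) = (0::int)" using opposite[OF v] by blast
    obtain T' a' e' where T': "T' \<subseteq> T" "card T' \<le> card \<Phi>" "a' > 0" "\<forall>y\<in>T'. 0 \<le> e' y"
      "\<forall>\<phi>\<in>\<Phi>. a' * \<phi> v + (\<Sum>y\<in>T'. e' y * \<phi> y) = (0::int)"
      using conic_caratheodory[OF \<Phi>(1) face_finite[OF T(2)] T(3-5)] by blast
    have finT': "finite T'" using T'(1) face_finite[OF T(2)] finite_subset by blast
    \<comment> \<open>The two contributions are added, since \<open>v\<close> may itself lie in
      \<open>T'\<close>.\<close>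
    define f where "f y = (if y \<in> T' then e' y else 0) + (if y = v then a' else 0)" for y
    have "balanced \<Phi> (insert v T') f" unfolding balanced_def
    proof
      fix \<phi> assume \<phi>: "\<phi> \<in> \<Phi>"
      have "(\<Sum>y\<in>insert v T'. f y * \<phi> y)
          = (\<Sum>y\<in>insert v T'. (if y \<in> T' then e' y else 0) * \<phi> y)
            + (\<Sum>y\<in>insert v T'. (if y = v then a' else 0) * \<phi> y)"
        by (simp add: f_def distrib_right sum.distrib)
      also have "(\<Sum>y\<in>insert v T'. (if y \<in> T' then e' y else 0) * \<phi> y) = (\<Sum>y\<in>T'. e' y * \<phi> y)"
        by (rule sum_extend_zero) (use finT' in auto)
      also have "(\<Sum>y\<in>insert v T'. (if y = v then a' else 0) * \<phi> y) = (\<Sum>y\<in>{v}. a' * \<phi> y)"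
        using finT' by (intro sum.mono_neutral_cong_right) auto
      finally show "(\<Sum>y\<in>insert v T'. f y * \<phi> y) = 0" using T'(5) \<phi> by (simp add: add.commute)
    qed
    moreover have "\<forall>y\<in>insert v T'. 0 \<le> f y" using T'(3,4) by (simp add: f_def)
    moreover have "\<exists>y\<in>insert v T'. 0 < f y" using T'(3,4) by (auto simp: f_def add_nonneg_pos)
    ultimately have "zero_set \<Phi> (insert v T')" unfolding zero_set_def by blast
    moreover have "face T'" using face_subset[OF T(2) T'(1)] .
    ultimately show ?thesis using T' T(1) \<Phi>(2) by (intro exI[of _ T']) auto
  qed
  then obtain T where T: "\<And>v. v \<in> W \<Longrightarrow> T v \<subseteq> W" "\<And>v. v \<in> W \<Longrightarrow> face (T v)"
    "\<And>v. v \<in> W \<Longrightarrow> card (T v) \<le> q" "\<And>v. v \<in> W \<Longrightarrow> zero_set \<Phi> (insert v (T v))" by metis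
  have "\<exists>E\<subseteq>W. card E \<le> exhaust_bound q t \<and> (\<forall>v\<in>W - E. t \<le> card (T v \<inter> E))" for t
  proof (induction t)
    case 0
    show ?case by (intro exI[of _ "{}"]) simp
  next
    case (Suc t)
    then obtain E where E: "E \<subseteq> W" "card E \<le> exhaust_bound q t" "\<forall>v\<in>W - E. t \<le> card (T v \<inter> E)" by blast
    have finE: "finite E" using E(1) finW finite_subset by blast
    \<comment> \<open>The remaining rays are grouped by the trace \<open>E'\<close> of
      \<open>T v\<close> on \<open>E\<close>, because \<open>hitting\<close> works with one common
      face.\<close>
    define \<P> where "\<P> E' = (\<lambda>v. insert v (T v) - E) ` {v\<in>W - E. T v \<inter> E = E'}" for E'
    have "\<exists>X\<subseteq>V. card X \<le> hit_bound q (card E') \<and> (\<forall>P\<in>\<P> E'. P \<inter> X \<noteq> {})"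
      if E': "face E'" "E' \<subseteq> E" for E'
    proof (rule hitting[OF \<Phi> W no_zero_face E'(1)])
      show "E' \<subseteq> W" using E' E by blast
      fix P assume "P \<in> \<P> E'"
      then obtain v where v: "v \<in> W" "v \<notin> E" "T v \<inter> E = E'" "P = insert v (T v) - E"
        by (auto simp: \<P>_def)
      have finT: "finite (T v)" using T(2) face_finite v(1) by blast
      have "card P \<le> card (insert v (T v))" unfolding v(4) by (rule card_mono) (use finT in auto)
      also have "\<dots> \<le> q + 1" using T(3)[OF v(1)] card_insert_le_m1[of "q+1" "T v" v] by simp
      finally have "card P \<le> q + 1" .
      moreover have "P \<union> E' = insert v (T v)" using v by blast
      ultimately show "P \<subseteq> W \<and> card P \<le> q + 1 \<and> zero_set \<Phi> (P \<union> E')"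
        using T(1,4) v(1,4) by auto
    qed
    then obtain X where X: "\<And>E'. face E' \<Longrightarrow> E' \<subseteq> E \<Longrightarrow> X E' \<subseteq> V"
      "\<And>E'. face E' \<Longrightarrow> E' \<subseteq> E \<Longrightarrow> card (X E') \<le> hit_bound q (card E')"
      "\<And>E' P. face E' \<Longrightarrow> E' \<subseteq> E \<Longrightarrow> P \<in> \<P> E' \<Longrightarrow> P \<inter> X E' \<noteq> {}" by metis
    define N where "N = (\<Union>E'\<in>{E'. E' \<subseteq> E \<and> face E'}. X E' \<inter> W)"
    define h where "h = (\<Sum>e\<le>exhaust_bound q t. hit_bound q e)"
    have finP: "finite {E'. E' \<subseteq> E \<and> face E'}" using finE by simp
    have "card N \<le> (\<Sum>E'\<in>{E'. E' \<subseteq> E \<and> face E'}. card (X E' \<inter> W))"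
      unfolding N_def by (rule card_UN_le[OF finP])
    also have "\<dots> \<le> (\<Sum>E'\<in>{E'. E' \<subseteq> E \<and> face E'}. h)"
    proof (rule sum_mono)
      fix E' assume "E' \<in> {E'. E' \<subseteq> E \<and> face E'}"
      then have E': "face E'" "E' \<subseteq> E" by auto
      have "card (X E' \<inter> W) \<le> card (X E')"
        by (rule card_mono) (use X(1)[OF E'] finite_V finite_subset in auto)
      also have "\<dots> \<le> hit_bound q (card E')" by (rule X(2)[OF E'])
      also have "\<dots> \<le> h" unfolding h_def
        by (rule member_le_sum) (use card_mono[OF finE E'(2)] E(2) in auto)
      finally show "card (X E' \<inter> W) \<le> h" .
    qed
    also have "\<dots> \<le> 2 ^ exhaust_bound q t * h"
    proof -
      have "card {E'. E' \<subseteq> E \<and> face E'} \<le> card (Pow E)" by (rule card_mono) (use finE in auto)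
      also have "\<dots> \<le> 2 ^ exhaust_bound q t" using E(2) finE by (simp add: card_Pow power_increasing)
      finally show ?thesis by simp
    qed
    finally have cN: "card N \<le> 2 ^ exhaust_bound q t * h" .
    have "card (E \<union> N) \<le> exhaust_bound q (Suc t)"
      using card_Un_le[of E N] E(2) cN by (simp add: h_def)
    moreover have "E \<union> N \<subseteq> W" using E(1) by (auto simp: N_def)
    moreover have "\<forall>v\<in>W - (E \<union> N). Suc t \<le> card (T v \<inter> (E \<union> N))"
    proof
      fix v assume v: "v \<in> W - (E \<union> N)"
      let ?E' = "T v \<inter> E"
      have finT: "finite (T v)" using T(2) face_finite v by blast
      have E': "face ?E'" "?E' \<subseteq> E" using face_subset[OF T(2)] v by auto
      have "insert v (T v) - E \<in> \<P> ?E'" using v by (auto simp: \<P>_def)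
      from X(3)[OF E' this] obtain x where x: "x \<in> insert v (T v) - E" "x \<in> X ?E'" by blast
      have "x \<in> W" using x(1) T(1) v by auto
      then have xN: "x \<in> N" using x(2) E' by (auto simp: N_def)
      \<comment> \<open>The ray that is hit cannot be \<open>v\<close>, which lies outside
        \<open>N\<close>, so it is a new element of \<open>T v\<close>.\<close>
      then have xT: "x \<in> T v" "x \<notin> E" using x(1) v by auto
      have "t \<le> card (T v \<inter> E)" using E(3) v by blast
      also have "\<dots> < card (T v \<inter> (E \<union> N))"
        by (rule psubset_card_mono) (use finT xT xN in auto)
      finally show "Suc t \<le> card (T v \<inter> (E \<union> N))" by simp
    qed
    ultimately show ?case by blast
  qed
  from this[of "Suc q"] obtain E where E: "E \<subseteq> W" "card E \<le> exhaust_bound q (Suc q)"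
    "\<forall>v\<in>W - E. Suc q \<le> card (T v \<inter> E)" by blast
  have "v \<in> E" if v: "v \<in> W" for v
  proof (rule ccontr)
    assume "v \<notin> E"
    then have "Suc q \<le> card (T v \<inter> E)" using E(3) v by blast
    also have "\<dots> \<le> card (T v)" by (rule card_mono) (use T(2) face_finite v in auto)
    finally show False using T(3)[OF v] by simp
  qed
  then have "W = E" using E(1) by blast
  then show ?thesis using E(2) by simp
qed

end

section \<open>Rays and cones\<close>

text \<open>Gordan's theorem. If \<open>y\<close>, positive on \<open>A\<close>, is not positive on
  the new vector, the induction hypothesis is applied to combinations of that vector with the
  members of \<open>A\<close> on which \<open>y\<close> vanishes. A relation there unfolds to one on
  \<open>insert a A\<close>; a functional \<open>z\<close> positive there is corrected by a multiple
  of \<open>y\<close>.\<close>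

lemma gordan_alternative:
  fixes f :: "'b \<Rightarrow> nat \<Rightarrow> real"
  assumes "finite A"
  shows "(\<exists>y. \<forall>w\<in>A. 0 < (\<Sum>i<n. y i * f w i)) \<or>
    (\<exists>l. (\<forall>w\<in>A. 0 \<le> l w) \<and> (\<exists>w\<in>A. 0 < l w) \<and> (\<forall>i<n. (\<Sum>w\<in>A. l w * f w i) = 0))"
  using assms
proof (induction A arbitrary: f rule: finite_induct)
  case (insert a A)
  define dot where "dot x y = (\<Sum>i<n. x i * y i)" for x y :: "nat \<Rightarrow> real"
  have dot_lin: "dot z (\<lambda>i. p * x i - q * y i) = p * dot z x - q * dot z y" for z x y p q
    by (simp add: dot_def sum_subtractf sum_distrib_left algebra_simps)
  have dot_lin': "dot (\<lambda>i. z i + r * y i) x = dot z x + r * dot y x" for z x y r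
    by (simp add: dot_def sum.distrib sum_distrib_left algebra_simps)
  show ?case
  proof (cases "A = {}")
    case True
    show ?thesis
    proof (cases "\<forall>i<n. f a i = 0")
      case True
      then show ?thesis using \<open>A = {}\<close> by (intro disjI2 exI[of _ "\<lambda>_. 1"]) auto
    next
      case False
      then obtain j where j: "j < n" "f a j \<noteq> 0" by blast
      have "0 < (\<Sum>i<n. f a i * f a i)"
        by (rule sum_pos2[of _ j]) (use j in \<open>auto simp: zero_less_mult_iff\<close>)
      then show ?thesis using \<open>A = {}\<close> by (intro disjI1 exI[of _ "f a"]) auto
    qed
  next
    case False
    from insert.IH[of f] show ?thesis
    proof
      assume "\<exists>l. (\<forall>w\<in>A. 0 \<le> l w) \<and> (\<exists>w\<in>A. 0 < l w) \<and> (\<forall>i<n. (\<Sum>w\<in>A. l w * f w i) = 0)"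
      then obtain l where l: "\<forall>w\<in>A. 0 \<le> l w" "\<exists>w\<in>A. 0 < l w" "\<forall>i<n. (\<Sum>w\<in>A. l w * f w i) = 0"
        by blast
      define l' where "l' = l(a := 0)"
      have "(\<Sum>w\<in>A. l' w * f w i) = (\<Sum>w\<in>A. l w * f w i)" for i
        by (rule sum.cong) (use insert.hyps in \<open>auto simp: l'_def\<close>)
      then have "\<forall>i<n. (\<Sum>w\<in>insert a A. l' w * f w i) = 0"
        using l(3) insert.hyps by (simp add: l'_def)
      moreover have "\<exists>w\<in>insert a A. 0 < l' w" using l(2) insert.hyps(2) by (auto simp: l'_def)
      moreover have "\<forall>w\<in>insert a A. 0 \<le> l' w" using l(1) by (auto simp: l'_def)
      ultimately show ?thesis by blast
    next
      assume "\<exists>y. \<forall>w\<in>A. 0 < (\<Sum>i<n. y i * f w i)"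
      then obtain y where y: "\<And>w. w \<in> A \<Longrightarrow> 0 < dot y (f w)" by (auto simp: dot_def)
      define c where "c = dot y (f a)"
      show ?thesis
      proof (cases "c > 0")
        case True
        then show ?thesis using y by (intro disjI1 exI[of _ y]) (auto simp: dot_def c_def)
      next
        case False
        define f' where "f' w = (\<lambda>i. dot y (f w) * f a i - c * f w i)" for w
        from insert.IH[of f'] show ?thesis
        proof
          assume "\<exists>l. (\<forall>w\<in>A. 0 \<le> l w) \<and> (\<exists>w\<in>A. 0 < l w) \<and> (\<forall>i<n. (\<Sum>w\<in>A. l w * f' w i) = 0)"
          then obtain l where l: "\<forall>w\<in>A. 0 \<le> l w" "\<exists>w\<in>A. 0 < l w" "\<forall>i<n. (\<Sum>w\<in>A. l w * f' w i) = 0"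
            by blast
          define k where "k = (\<Sum>w\<in>A. l w * dot y (f w))"
          define l' where "l' w = (if w = a then k else - c * l w)" for w
          have "0 < k" unfolding k_def
          proof -
            obtain w where w: "w \<in> A" "0 < l w" using l(2) by blast
            show "0 < (\<Sum>w\<in>A. l w * dot y (f w))"
              by (rule sum_pos2[OF insert.hyps(1) w(1)]) (use w y l(1) in \<open>auto simp: less_imp_le\<close>)
          qed
          moreover have "(\<Sum>w\<in>insert a A. l' w * f w i) = 0" if i: "i < n" for i
          proof -
            have "(\<Sum>w\<in>A. l' w * f w i) = (\<Sum>w\<in>A. - c * l w * f w i)"
              by (rule sum.cong) (use insert.hyps in \<open>auto simp: l'_def\<close>)
            then have "(\<Sum>w\<in>insert a A. l' w * f w i) = k * f a i + (\<Sum>w\<in>A. - c * l w * f w i)"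
              using insert.hyps by (simp add: l'_def)
            also have "\<dots> = (\<Sum>w\<in>A. l w * f' w i)"
              by (simp add: k_def f'_def sum_distrib_right sum_subtractf sum_negf sum_distrib_left algebra_simps)
            finally show ?thesis using l(3) i by simp
          qed
          moreover have "\<forall>w\<in>insert a A. 0 \<le> l' w"
            using \<open>0 < k\<close> l(1) False by (auto simp: l'_def mult_nonpos_nonneg)
          moreover have "0 < l' a" using \<open>0 < k\<close> by (simp add: l'_def)
          ultimately show ?thesis by blast
        next
          assume "\<exists>z. \<forall>w\<in>A. 0 < (\<Sum>i<n. z i * f' w i)"
          then obtain z where z: "\<And>w. w \<in> A \<Longrightarrow> 0 < dot z (f' w)" by (auto simp: dot_def)
          have z': "0 < dot y (f w) * dot z (f a) - c * dot z (f w)" if "w \<in> A" for w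
            using z[OF that] unfolding f'_def dot_lin .
          \<comment> \<open>Every \<open>r\<close> above \<open>L\<close> makes
            \<open>z + r * y\<close> positive on \<open>A\<close>. If \<open>c < 0\<close>,
            positivity at \<open>a\<close> bounds \<open>r\<close> from above, compatibly with
            \<open>L\<close> by \<open>z'\<close>.\<close>
          define L where "L = Max ((\<lambda>w. - dot z (f w) / dot y (f w)) ` A)"
          have L: "- dot z (f w) / dot y (f w) \<le> L" if "w \<in> A" for w
            unfolding L_def using that insert.hyps by simp
          have good: "0 < dot z (f w) + r * dot y (f w)" if "w \<in> A" "L < r" for w r
          proof -
            have "- dot z (f w) / dot y (f w) < r" using L[OF that(1)] that(2) by linarith
            then show ?thesis using y[OF that(1)] by (simp add: field_simps)
          qed
          have "\<exists>r. L < r \<and> 0 < dot z (f a) + r * c"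
          proof (cases "c = 0")
            case True
            obtain w where w: "w \<in> A" using \<open>A \<noteq> {}\<close> by blast
            have "0 < dot z (f a)" using z'[OF w] y[OF w] True by (simp add: zero_less_mult_iff)
            then show ?thesis using True by (intro exI[of _ "L + 1"]) simp
          next
            case c0: False
            then have c: "c < 0" using False by simp
            have "L < dot z (f a) / (- c)"
            proof -
              have "L \<in> (\<lambda>w. - dot z (f w) / dot y (f w)) ` A"
                unfolding L_def by (rule Max_in) (use insert.hyps \<open>A \<noteq> {}\<close> in auto)
              then obtain w where w: "w \<in> A" "L = - dot z (f w) / dot y (f w)" by blast
              have "- dot z (f w) * (- c) < dot z (f a) * dot y (f w)"
                using z'[OF w(1)] by (simp add: algebra_simps)
              then show ?thesis unfolding w(2) using c y[OF w(1)]
                by (simp add: divide_simps mult.commute)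
            qed
            then obtain r where r: "L < r" "r < dot z (f a) / (- c)" using dense by blast
            then have "r * (- c) < dot z (f a)" using c by (subst (asm) pos_less_divide_eq) auto
            then show ?thesis using r(1) by (intro exI[of _ r]) (simp add: algebra_simps)
          qed
          then obtain r where r: "L < r" "0 < dot z (f a) + r * c" by blast
          have "\<forall>w\<in>insert a A. 0 < dot (\<lambda>i. z i + r * y i) (f w)"
            unfolding dot_lin' using good r by (auto simp: c_def)
          then show ?thesis unfolding dot_def by (intro disjI1 exI[of _ "\<lambda>i. z i + r * y i"])
        qed
      qed
    qed
  qed
qed simp

section \<open>Generators and rays of rational cones\<close>

lemma cone_gen_iff:
  assumes "finite S" "S \<subseteq> carrier_vec n"
  shows "x \<in> cone_gen n S \<longleftrightarrow> x \<in> carrier_vec n \<and>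
    (\<exists>c. (\<forall>v\<in>S. 0 \<le> c v) \<and> (\<forall>i<n. x $ i = (\<Sum>v\<in>S. c v * real_of_int (v $ i))))"
proof -
  define g where "g c = finsum_vec TYPE(real) n (\<lambda>v. c v \<cdot>\<^sub>v map_vec real_of_int v) S" for c
  have car: "(\<lambda>v. c v \<cdot>\<^sub>v map_vec real_of_int v) \<in> S \<rightarrow> carrier_vec n" for c :: "int vec \<Rightarrow> real"
    using assms(2) by auto
  have gc: "g c \<in> carrier_vec n" for c unfolding g_def by (rule finsum_vec_closed[OF car])
  have gi: "g c $ i = (\<Sum>v\<in>S. c v * real_of_int (v $ i))" if "i < n" for c i
  proof -
    have "g c $ i = (\<Sum>v\<in>S. (c v \<cdot>\<^sub>v map_vec real_of_int v) $ i)"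
      unfolding g_def by (rule index_finsum_vec[OF assms(1) that car])
    also have "\<dots> = (\<Sum>v\<in>S. c v * real_of_int (v $ i))"
      by (rule sum.cong) (use that assms(2) in auto)
    finally show ?thesis .
  qed
  have "x = g c \<longleftrightarrow> x \<in> carrier_vec n \<and> (\<forall>i<n. x $ i = (\<Sum>v\<in>S. c v * real_of_int (v $ i)))" for c
    using gc[of c] gi by (auto intro!: eq_vecI)
  moreover have "cone_gen n S = {g c | c. \<forall>v\<in>S. 0 \<le> c v}" by (simp add: cone_gen_def g_def)
  ultimately show ?thesis by blast
qed

lemma cone_gen_mono:
  assumes "finite S" "S \<subseteq> carrier_vec n" "S' \<subseteq> S"
  shows "cone_gen n S' \<subseteq> cone_gen n S"
proof
  fix x assume "x \<in> cone_gen n S'"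
  moreover have S': "finite S'" "S' \<subseteq> carrier_vec n" using assms finite_subset by auto
  ultimately obtain c where c: "x \<in> carrier_vec n" "\<forall>v\<in>S'. 0 \<le> c v"
    "\<forall>i<n. x $ i = (\<Sum>v\<in>S'. c v * real_of_int (v $ i))" by (auto simp: cone_gen_iff)
  have "(\<Sum>v\<in>S. (if v \<in> S' then c v else 0) * real_of_int (v $ i)) = (\<Sum>v\<in>S'. c v * real_of_int (v $ i))" for i
    by (rule sum.mono_neutral_cong_right) (use assms in auto)
  then show "x \<in> cone_gen n S" unfolding cone_gen_iff[OF assms(1,2)]
    using c by (intro conjI exI[of _ "\<lambda>v. if v \<in> S' then c v else 0"]) auto
qed

lemma cone_gen_generator:
  assumes "finite S" "S \<subseteq> carrier_vec n" "v \<in> S"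
  shows "map_vec real_of_int v \<in> cone_gen n S"
proof -
  have "(\<Sum>w\<in>S. (if w = v then 1 else 0) * real_of_int (w $ i)) = (\<Sum>w\<in>{v}. real_of_int (w $ i))" for i
    by (rule sum.mono_neutral_cong_right) (use assms in auto)
  then show ?thesis unfolding cone_gen_iff[OF assms(1,2)]
    using assms by (intro conjI exI[of _ "\<lambda>w. if w = v then 1 else 0"]) auto
qed

lemma cone_gen_redundant:
  assumes S: "finite S" "S \<subseteq> carrier_vec n" "v \<in> S" and l: "\<forall>w\<in>S - {v}. 0 \<le> l w"
    and eq: "\<forall>i<n. real_of_int (v $ i) = (\<Sum>w\<in>S - {v}. l w * real_of_int (w $ i))"
  shows "cone_gen n (S - {v}) = cone_gen n S"
proof
  show "cone_gen n (S - {v}) \<subseteq> cone_gen n S" by (rule cone_gen_mono) (use S in auto)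
  show "cone_gen n S \<subseteq> cone_gen n (S - {v})"
  proof
    fix x assume "x \<in> cone_gen n S"
    then obtain c where c: "x \<in> carrier_vec n" "\<forall>v\<in>S. 0 \<le> c v"
      "\<forall>i<n. x $ i = (\<Sum>v\<in>S. c v * real_of_int (v $ i))" using S by (auto simp: cone_gen_iff)
    have "x $ i = (\<Sum>w\<in>S - {v}. (c w + c v * l w) * real_of_int (w $ i))" if i: "i < n" for i
    proof -
      have "x $ i = c v * real_of_int (v $ i) + (\<Sum>w\<in>S - {v}. c w * real_of_int (w $ i))"
        using c(3) i sum.remove[OF S(1,3), of "\<lambda>w. c w * real_of_int (w $ i)"] by simp
      also have "c v * real_of_int (v $ i) = (\<Sum>w\<in>S - {v}. c v * l w * real_of_int (w $ i))"
        using eq i by (simp add: sum_distrib_left mult.assoc)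
      finally show ?thesis by (simp add: distrib_right sum.distrib)
    qed
    moreover have "\<forall>w\<in>S - {v}. 0 \<le> c w + c v * l w" using c(2) l S(3) by auto
    moreover have fin: "finite (S - {v})" "S - {v} \<subseteq> carrier_vec n" using S by auto
    ultimately show "x \<in> cone_gen n (S - {v})"
      unfolding cone_gen_iff[OF fin] using c(1) by (intro conjI exI[of _ "\<lambda>w. c w + c v * l w"]) auto
  qed
qed

text \<open>Divide by the largest possible factor; a nonzero coordinate bounds the factors.\<close>

lemma primitive_multiple:
  assumes v: "v \<in> carrier_vec n" "v \<noteq> 0\<^sub>v n"
  obtains p k where "primitive_vec n p" "0 < k" "v = int k \<cdot>\<^sub>v p"
proof -
  obtain j where j: "j < n" "v $ j \<noteq> 0" using v by (metis carrier_vecD eq_vecI index_zero_vec)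
  define K where "K = {k. \<exists>w\<in>carrier_vec n. v = int k \<cdot>\<^sub>v w}"
  have bound: "k \<le> nat \<bar>v $ j\<bar>" if "k \<in> K" for k
  proof -
    obtain w where w: "w \<in> carrier_vec n" "v = int k \<cdot>\<^sub>v w" using \<open>k \<in> K\<close> by (auto simp: K_def)
    then have "v $ j = int k * w $ j" using j by auto
    then have "int k dvd v $ j" by simp
    then have "int k \<le> \<bar>v $ j\<bar>" using j(2) by (simp add: zdvd_imp_le dvd_imp_le_int)
    then show ?thesis by simp
  qed
  have fin: "finite K" using bound by (meson finite_nat_set_iff_bounded_le)
  have one: "1 \<in> K" using v by (auto simp: K_def intro!: bexI[of _ v])
  define k where "k = Max K"
  have k: "k \<in> K" unfolding k_def by (rule Max_in) (use fin one in auto)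
  have kpos: "0 < k" using Max_ge[OF fin one] by (simp add: k_def)
  obtain p where p: "p \<in> carrier_vec n" "v = int k \<cdot>\<^sub>v p" using k by (auto simp: K_def)
  have "p \<noteq> 0\<^sub>v n" using p v by auto
  moreover have "\<bar>l\<bar> = 1" if w: "w \<in> carrier_vec n" and eq: "p = l \<cdot>\<^sub>v w" for l w
  proof -
    have l0: "l \<noteq> 0" using eq w \<open>p \<noteq> 0\<^sub>v n\<close> by auto
    have "v = int (k * nat \<bar>l\<bar>) \<cdot>\<^sub>v (sgn l \<cdot>\<^sub>v w)"
      using p(2) eq w by (auto intro!: eq_vecI simp: mult.assoc abs_mult_sgn mult.left_commute)
    then have "k * nat \<bar>l\<bar> \<in> K" using w by (auto simp: K_def)
    then have "k * nat \<bar>l\<bar> \<le> k" unfolding k_def using fin by simp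
    then have "nat \<bar>l\<bar> \<le> 1" using kpos by simp
    then show ?thesis using l0 by linarith
  qed
  ultimately have "primitive_vec n p" using p(1) by (auto simp: primitive_vec_def)
  then show ?thesis using that kpos p(2) by blast
qed

text \<open>Each member of an irredundant generating set of a strongly convex cone spans a face.
  \<open>gordan_alternative\<close> is applied to the other generators projected along
  \<open>v\<close>: a relation among the projections would make \<open>v\<close> redundant or put a
  line into the cone.\<close>

lemma extremal_functional:
  assumes S: "finite S" "S \<subseteq> carrier_vec n" and conv: "strongly_convex n (cone_gen n S)"
    and min: "\<And>v. v \<in> S \<Longrightarrow> cone_gen n (S - {v}) \<noteq> cone_gen n S" and v: "v \<in> S"
  obtains m where "(\<Sum>i<n. m i * real_of_int (v $ i)) = 0"
    "\<And>w. w \<in> S - {v} \<Longrightarrow> 0 < (\<Sum>i<n. m i * real_of_int (w $ i))"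
proof -
  define dot where "dot x y = (\<Sum>i<n. x i * y i)" for x y :: "nat \<Rightarrow> real"
  define R where "R w = (\<lambda>i. real_of_int (w $ i))" for w :: "int vec"
  have nonzero: "\<exists>j<n. w $ j \<noteq> 0" if w: "w \<in> S" for w
  proof (rule ccontr)
    assume "\<not> ?thesis"
    then have "cone_gen n (S - {w}) = cone_gen n S"
      by (intro cone_gen_redundant[OF S w, of "\<lambda>_. 0"]) auto
    then show False using min[OF w] by blast
  qed
  define q where "q = dot (R v) (R v)"
  have q: "q > 0"
  proof -
    obtain j where "j < n" "v $ j \<noteq> 0" using nonzero[OF v] by blast
    then show ?thesis unfolding q_def dot_def R_def
      by (intro sum_pos2[of _ j]) (auto simp: zero_less_mult_iff)
  qed
  \<comment> \<open>The projection orthogonal to \<open>v\<close>, scaled by \<open>q\<close> to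
    avoid division.\<close>
  define f where "f w = (\<lambda>i. q * R w i - dot (R w) (R v) * R v i)" for w
  from gordan_alternative[where A = "S - {v}" and n = n and f = f] S(1)
  consider y where "\<forall>w\<in>S - {v}. 0 < dot y (f w)"
    | l where "\<forall>w\<in>S - {v}. 0 \<le> l w" "\<exists>w\<in>S - {v}. 0 < l w" "\<forall>i<n. (\<Sum>w\<in>S - {v}. l w * f w i) = 0"
    unfolding dot_def by auto
  then show thesis
  proof cases
    case (1 y)
    \<comment> \<open>The same projection applied to \<open>y\<close>: it vanishes at
      \<open>v\<close> and takes at \<open>w\<close> the value of \<open>y\<close> at
      \<open>f w\<close>.\<close>
    define m where "m i = q * y i - dot y (R v) * R v i" for i
    have m: "dot m x = q * dot y x - dot y (R v) * dot (R v) x" for x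
      by (simp add: m_def dot_def sum_subtractf sum_distrib_left left_diff_distrib mult.assoc)
    have f: "dot y (f w) = q * dot y (R w) - dot (R w) (R v) * dot y (R v)" for w
      by (simp add: f_def dot_def sum_subtractf sum_distrib_left right_diff_distrib mult.left_commute)
    have comm: "dot (R w) (R v) = dot (R v) (R w)" for w by (simp add: dot_def mult.commute)
    have "dot m (R v) = 0" unfolding m q_def[symmetric] by (simp add: mult.commute)
    moreover have "0 < dot m (R w)" if "w \<in> S - {v}" for w
    proof -
      have "0 < dot y (f w)" using 1 that by blast
      then show ?thesis unfolding m f comm by (simp add: mult.commute)
    qed
    ultimately show thesis by (intro that[of m]) (auto simp: dot_def R_def)
  next
    case (2 l)
    define \<mu> where "\<mu> = (\<Sum>w\<in>S - {v}. l w * dot (R w) (R v))"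
    have rel: "q * (\<Sum>w\<in>S - {v}. l w * R w i) = \<mu> * R v i" if "i < n" for i
    proof -
      have "0 = (\<Sum>w\<in>S - {v}. l w * f w i)" using 2(3) that by simp
      also have "\<dots> = q * (\<Sum>w\<in>S - {v}. l w * R w i) - \<mu> * R v i"
        by (simp add: f_def \<mu>_def sum_subtractf sum_distrib_left sum_distrib_right algebra_simps)
      finally show ?thesis by simp
    qed
    show thesis
    proof (cases "\<mu> > 0")
      case True
      have "cone_gen n (S - {v}) = cone_gen n S"
      proof (rule cone_gen_redundant[OF S v, of "\<lambda>w. q * l w / \<mu>"])
        show "\<forall>w\<in>S - {v}. 0 \<le> q * l w / \<mu>" using 2(1) True q by simp
        show "\<forall>i<n. real_of_int (v $ i) = (\<Sum>w\<in>S - {v}. q * l w / \<mu> * real_of_int (w $ i))"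
        proof (intro allI impI)
          fix i assume "i < n"
          have "(\<Sum>w\<in>S - {v}. q * l w / \<mu> * R w i) = (q * (\<Sum>w\<in>S - {v}. l w * R w i)) / \<mu>"
            by (simp add: sum_distrib_left sum_divide_distrib mult.assoc)
          then show "real_of_int (v $ i) = (\<Sum>w\<in>S - {v}. q * l w / \<mu> * real_of_int (w $ i))"
            using rel[OF \<open>i < n\<close>] True by (simp add: R_def)
        qed
      qed
      then show thesis using min[OF v] by blast
    next
      case False
      obtain w0 where w0: "w0 \<in> S" "w0 \<noteq> v" "0 < l w0" using 2(2) by blast
      let ?x = "map_vec real_of_int w0"
      have x: "?x \<in> cone_gen n S" by (rule cone_gen_generator[OF S w0(1)])
      \<comment> \<open>The relation solved for \<open>- w0\<close>; the coefficient of
        \<open>v\<close> is nonnegative because \<open>\<mu>\<close> is not positive.\<close>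
      define c where "c w = (if w = v then - \<mu> / (q * l w0) else if w = w0 then 0 else l w / l w0)" for w
      have c0: "\<forall>w\<in>S. 0 \<le> c w" using 2(1) False w0(3) q by (auto simp: c_def divide_nonpos_pos)
      have "(- ?x) $ i = (\<Sum>w\<in>S. c w * real_of_int (w $ i))" if i: "i < n" for i
      proof -
        have w0S: "w0 \<in> S - {v}" using w0 by blast
        have "(\<Sum>w\<in>S. c w * R w i) = c v * R v i + (\<Sum>w\<in>S - {v}. c w * R w i)"
          by (rule sum.remove[OF S(1) v])
        also have "(\<Sum>w\<in>S - {v}. c w * R w i) = (\<Sum>w\<in>S - {v} - {w0}. c w * R w i)"
          using sum.remove[of "S - {v}" w0 "\<lambda>w. c w * R w i"] S(1) w0S by (simp add: c_def)
        also have "\<dots> = (\<Sum>w\<in>S - {v} - {w0}. l w * R w i) / l w0"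
          unfolding sum_divide_distrib by (rule sum.cong) (auto simp: c_def)
        also have "(\<Sum>w\<in>S - {v} - {w0}. l w * R w i) = (\<Sum>w\<in>S - {v}. l w * R w i) - l w0 * R w0 i"
          using sum.remove[of "S - {v}" w0 "\<lambda>w. l w * R w i"] S(1) w0S by simp
        also have "(\<Sum>w\<in>S - {v}. l w * R w i) = \<mu> * R v i / q" using rel[OF i] q by (simp add: field_simps)
        finally have "(\<Sum>w\<in>S. c w * R w i) = - R w0 i"
          using w0(3) q by (simp add: c_def diff_divide_distrib mult.commute)
        then show ?thesis using S w0(1) i by (auto simp: R_def)
      qed
      then have "- ?x \<in> cone_gen n S" unfolding cone_gen_iff[OF S]
        using c0 S w0(1) by (intro conjI exI[of _ c]) auto
      then have "?x = 0\<^sub>v n" using conv x unfolding strongly_convex_def by blast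
      moreover obtain j where "j < n" "w0 $ j \<noteq> 0" using nonzero[OF w0(1)] by blast
      moreover have "?x $ j = real_of_int (w0 $ j)" using S w0(1) \<open>j < n\<close> by auto
      ultimately show thesis by simp
    qed
  qed
qed

text \<open>A generating set with the fewest elements is irredundant, so by
  \<open>extremal_functional\<close> each generator is a positive multiple of a primitive vector
  spanning a face.\<close>

lemma cone_rays_generate:
  assumes poly: "rational_polyhedral_cone n \<sigma>" and conv: "strongly_convex n \<sigma>" and x: "x \<in> \<sigma>"
  obtains R where "finite R" "R \<subseteq> cone_rays n \<sigma>" "x \<in> cone_gen n R"
proof -
  define P where "P S \<longleftrightarrow> finite S \<and> S \<subseteq> carrier_vec n \<and> \<sigma> = cone_gen n S" for S
  have "\<exists>S. P S" using poly by (auto simp: rational_polyhedral_cone_def P_def)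
  then obtain S where "P S" and least: "\<And>S'. P S' \<Longrightarrow> card S \<le> card S'"
    using ex_has_least_nat[of P _ card] by blast
  then have S: "finite S" "S \<subseteq> carrier_vec n" and \<sigma>: "\<sigma> = cone_gen n S" by (auto simp: P_def)
  have min: "cone_gen n (S - {v}) \<noteq> cone_gen n S" if v: "v \<in> S" for v
  proof
    assume "cone_gen n (S - {v}) = cone_gen n S"
    then have "P (S - {v})" using S \<sigma> by (auto simp: P_def)
    then show False using least card_Diff1_less[OF S(1) v] by fastforce
  qed
  have "\<exists>p k. p \<in> cone_rays n \<sigma> \<and> (0::nat) < k \<and> v = int k \<cdot>\<^sub>v p" if v: "v \<in> S" for v
  proof -
    have vc: "v \<in> carrier_vec n" using v S by blast
    obtain m where m: "(\<Sum>i<n. m i * real_of_int (v $ i)) = 0"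
      "\<And>w. w \<in> S - {v} \<Longrightarrow> 0 < (\<Sum>i<n. m i * real_of_int (w $ i))"
      using extremal_functional[OF S _ min v] conv \<sigma> by blast
    have "v \<noteq> 0\<^sub>v n"
    proof
      assume "v = 0\<^sub>v n"
      then have "cone_gen n (S - {v}) = cone_gen n S"
        by (intro cone_gen_redundant[OF S v, of "\<lambda>_. 0"]) auto
      then show False using min[OF v] by blast
    qed
    then obtain p k where p: "primitive_vec n p" "0 < k" "v = int k \<cdot>\<^sub>v p"
      using primitive_multiple[OF vc] by blast
    have pc: "p \<in> carrier_vec n" using p(1) by (simp add: primitive_vec_def)
    have vi: "v $ i = int k * p $ i" if "i < n" for i using p(3) pc that by simp
    define M where "M = vec n m"
    have Mx: "M \<bullet> x = (\<Sum>w\<in>S. c w * (\<Sum>i<n. m i * real_of_int (w $ i)))"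
      if "x \<in> carrier_vec n" "\<forall>i<n. x $ i = (\<Sum>v\<in>S. c v * real_of_int (v $ i))" for x c
    proof -
      have "M \<bullet> x = (\<Sum>i<n. m i * (\<Sum>w\<in>S. c w * real_of_int (w $ i)))"
        using that by (simp add: M_def scalar_prod_def lessThan_atLeast0)
      also have "\<dots> = (\<Sum>i<n. \<Sum>w\<in>S. c w * (m i * real_of_int (w $ i)))"
        by (simp add: sum_distrib_left mult.left_commute)
      also have "\<dots> = (\<Sum>w\<in>S. \<Sum>i<n. c w * (m i * real_of_int (w $ i)))" by (rule sum.swap)
      finally show ?thesis by (simp add: sum_distrib_left)
    qed
    have m0: "0 \<le> (\<Sum>i<n. m i * real_of_int (w $ i))" if "w \<in> S" for w
      using m that by (cases "w = v") (auto simp: less_imp_le)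
    have "is_face n (cone_gen n {p}) \<sigma>" unfolding is_face_def
    proof (intro bexI[of _ M] conjI ballI)
      show "M \<in> carrier_vec n" by (simp add: M_def)
      fix x assume "x \<in> \<sigma>"
      then obtain c where c: "x \<in> carrier_vec n" "\<forall>v\<in>S. 0 \<le> c v"
        "\<forall>i<n. x $ i = (\<Sum>v\<in>S. c v * real_of_int (v $ i))" unfolding \<sigma> cone_gen_iff[OF S] by blast
      show "0 \<le> M \<bullet> x" unfolding Mx[OF c(1,3)] using c(2) m0 by (auto intro!: sum_nonneg)
    next
      have pS: "finite {p}" "{p} \<subseteq> carrier_vec n" using pc by auto
      show "cone_gen n {p} = {x\<in>\<sigma>. M \<bullet> x = 0}"
      proof (intro equalityI subsetI)
        fix x assume "x \<in> cone_gen n {p}"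
        then obtain c where c: "x \<in> carrier_vec n" "0 \<le> c" "\<forall>i<n. x $ i = c * real_of_int (p $ i)"
          unfolding cone_gen_iff[OF pS] by auto
        define c' where "c' w = (if w = v then c / real k else 0)" for w
        have "(\<Sum>w\<in>S. c' w * g w) = (\<Sum>w\<in>{v}. c / real k * g w)" for g
          by (rule sum.mono_neutral_cong_right) (use S v in \<open>auto simp: c'_def\<close>)
        then have sum: "(\<Sum>w\<in>S. c' w * g w) = c / real k * g v" for g by simp
        have x': "\<forall>i<n. x $ i = (\<Sum>v\<in>S. c' v * real_of_int (v $ i))"
          unfolding sum using c(3) vi p(2) by simp
        have "x \<in> \<sigma>" unfolding \<sigma> cone_gen_iff[OF S]
          using c x' p(2) by (intro conjI exI[of _ c']) (auto simp: c'_def)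
        moreover have "M \<bullet> x = 0" unfolding Mx[OF c(1) x'] sum using m(1) by simp
        ultimately show "x \<in> {x\<in>\<sigma>. M \<bullet> x = 0}" by blast
      next
        fix x assume x: "x \<in> {x\<in>\<sigma>. M \<bullet> x = 0}"
        then obtain c where c: "x \<in> carrier_vec n" "\<forall>v\<in>S. 0 \<le> c v"
          "\<forall>i<n. x $ i = (\<Sum>v\<in>S. c v * real_of_int (v $ i))" unfolding \<sigma> cone_gen_iff[OF S] by blast
        have "(\<Sum>w\<in>S. c w * (\<Sum>i<n. m i * real_of_int (w $ i))) = 0" using x Mx[OF c(1,3)] by simp
        then have z: "c w * (\<Sum>i<n. m i * real_of_int (w $ i)) = 0" if "w \<in> S" for w
          using sum_nonneg_eq_0_iff[OF S(1), of "\<lambda>w. c w * (\<Sum>i<n. m i * real_of_int (w $ i))"] c(2) m0 that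
          by simp
        have c0: "c w = 0" if "w \<in> S" "w \<noteq> v" for w
        proof -
          have "0 < (\<Sum>i<n. m i * real_of_int (w $ i))" using m(2) that by blast
          then show ?thesis using z[OF that(1)] by simp
        qed
        have "x $ i = (c v * real k) * real_of_int (p $ i)" if "i < n" for i
        proof -
          have "(\<Sum>w\<in>S. c w * real_of_int (w $ i)) = (\<Sum>w\<in>{v}. c w * real_of_int (w $ i))"
            by (rule sum.mono_neutral_right) (use S v c0 in auto)
          then show ?thesis using c(3) vi that by simp
        qed
        then show "x \<in> cone_gen n {p}" unfolding cone_gen_iff[OF pS]
          using c v by (intro conjI exI[of _ "\<lambda>_. c v * real k"]) auto
      qed
    qed
    then show ?thesis using p by (auto simp: cone_rays_def)
  qed
  then obtain p k where pk: "\<And>v. v \<in> S \<Longrightarrow> p v \<in> cone_rays n \<sigma>" "\<And>v. v \<in> S \<Longrightarrow> (0::nat) < k v"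
    "\<And>v. v \<in> S \<Longrightarrow> v = int (k v) \<cdot>\<^sub>v p v" by metis
  have pc: "p v \<in> carrier_vec n" if "v \<in> S" for v
    using pk(1)[OF that] by (simp add: cone_rays_def primitive_vec_def)
  obtain c where c: "x \<in> carrier_vec n" "\<forall>v\<in>S. 0 \<le> c v"
    "\<forall>i<n. x $ i = (\<Sum>v\<in>S. c v * real_of_int (v $ i))" using x unfolding \<sigma> cone_gen_iff[OF S] by blast
  \<comment> \<open>Collects the coefficients of all generators on the same ray.\<close>
  define d where "d r = (\<Sum>v\<in>{v\<in>S. p v = r}. c v * real (k v))" for r
  have "x $ i = (\<Sum>r\<in>p ` S. d r * real_of_int (r $ i))" if i: "i < n" for i
  proof -
    have vi: "v $ i = int (k v) * p v $ i" if "v \<in> S" for v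
    proof -
      have "v $ i = (int (k v) \<cdot>\<^sub>v p v) $ i" using pk(3)[OF that] by simp
      then show ?thesis using pc[OF that] i by simp
    qed
    have "x $ i = (\<Sum>v\<in>S. c v * real (k v) * real_of_int (p v $ i))"
      using c(3) i vi by (simp add: mult.assoc)
    also have "\<dots> = (\<Sum>r\<in>p ` S. \<Sum>v\<in>{v\<in>S. p v = r}. c v * real (k v) * real_of_int (p v $ i))"
      by (rule sum.image_gen[OF S(1)])
    also have "\<dots> = (\<Sum>r\<in>p ` S. d r * real_of_int (r $ i))"
      by (rule sum.cong) (auto simp: d_def sum_distrib_right)
    finally show ?thesis .
  qed
  moreover have "\<forall>r\<in>p ` S. 0 \<le> d r" using c(2) by (auto simp: d_def intro!: sum_nonneg)
  moreover have pS: "finite (p ` S)" "p ` S \<subseteq> carrier_vec n" using S pc by auto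
  ultimately have "x \<in> cone_gen n (p ` S)" unfolding cone_gen_iff[OF pS] using c(1) by blast
  then show ?thesis using that[of "p ` S"] pS(1) pk(1) by blast
qed

section \<open>Toric Fano varieties\<close>

lemma scalar_prod_lessThan:
  assumes "w \<in> carrier_vec n"
  shows "m \<bullet> w = (\<Sum>i<n. m $ i * w $ i)"
  using assms by (simp add: scalar_prod_def lessThan_atLeast0)

text \<open>The coordinates of the unit vectors assemble to the dual vectors by linearity; duality
  is the uniqueness of the coordinates of a basis element.\<close>

lemma lattice_basis_dual:
  assumes B: "lattice_basis n B"
  obtains d where "\<And>b. b \<in> B \<Longrightarrow> d b \<in> carrier_vec n"
    "\<And>b b'. b \<in> B \<Longrightarrow> b' \<in> B \<Longrightarrow> d b \<bullet> b' = (if b = b' then 1 else 0)"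
    "\<And>w i. w \<in> carrier_vec n \<Longrightarrow> i < n \<Longrightarrow> w $ i = (\<Sum>b\<in>B. (d b \<bullet> w) * b $ i)"
proof -
  have fin: "finite B" and car: "B \<subseteq> carrier_vec n" using B by (auto simp: lattice_basis_def)
  have eq_iff: "w = finsum_vec TYPE(int) n (\<lambda>v. c v \<cdot>\<^sub>v v) B \<longleftrightarrow> (\<forall>i<n. w $ i = (\<Sum>b\<in>B. c b * b $ i))"
    if w: "w \<in> carrier_vec n" for w c
  proof -
    let ?g = "finsum_vec TYPE(int) n (\<lambda>v. c v \<cdot>\<^sub>v v) B"
    have f: "(\<lambda>v. c v \<cdot>\<^sub>v v) \<in> B \<rightarrow> carrier_vec n" using car by auto
    have "?g $ i = (\<Sum>b\<in>B. c b * b $ i)" if "i < n" for i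
    proof -
      have "?g $ i = (\<Sum>b\<in>B. (c b \<cdot>\<^sub>v b) $ i)" by (rule index_finsum_vec[OF fin that f])
      also have "\<dots> = (\<Sum>b\<in>B. c b * b $ i)" by (rule sum.cong) (use that car in auto)
      finally show ?thesis .
    qed
    moreover have "?g \<in> carrier_vec n" by (rule finsum_vec_closed[OF f])
    ultimately show ?thesis using w by (auto intro!: eq_vecI)
  qed
  have ex1: "\<exists>!c. c \<in> B \<rightarrow>\<^sub>E UNIV \<and> (\<forall>i<n. w $ i = (\<Sum>b\<in>B. c b * b $ i))" if w: "w \<in> carrier_vec n" for w
  proof -
    have "\<exists>!c. c \<in> B \<rightarrow>\<^sub>E UNIV \<and> w = finsum_vec TYPE(int) n (\<lambda>v. c v \<cdot>\<^sub>v v) B"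
      using B w unfolding lattice_basis_def by blast
    then show ?thesis unfolding eq_iff[OF w] .
  qed
  define cc where "cc w = (THE c. c \<in> B \<rightarrow>\<^sub>E UNIV \<and> (\<forall>i<n. w $ i = (\<Sum>b\<in>B. c b * b $ i)))" for w
  have cc: "\<forall>i<n. w $ i = (\<Sum>b\<in>B. cc w b * b $ i)" if w: "w \<in> carrier_vec n" for w
    using theI'[OF ex1[OF w]] unfolding cc_def by blast
  define d where "d b = vec n (\<lambda>i. cc (unit_vec n i) b)" for b
  have dc: "d b \<in> carrier_vec n" for b by (simp add: d_def)
  have rep: "w $ j = (\<Sum>b\<in>B. (d b \<bullet> w) * b $ j)" if w: "w \<in> carrier_vec n" and j: "j < n" for w j
  proof -
    have "(\<Sum>b\<in>B. (d b \<bullet> w) * b $ j) = (\<Sum>b\<in>B. \<Sum>i<n. w $ i * (cc (unit_vec n i) b * b $ j))"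
      unfolding scalar_prod_lessThan[OF w] sum_distrib_right
      by (intro sum.cong refl) (simp add: d_def)
    also have "\<dots> = (\<Sum>i<n. \<Sum>b\<in>B. w $ i * (cc (unit_vec n i) b * b $ j))" by (rule sum.swap)
    also have "\<dots> = (\<Sum>i<n. w $ i * (unit_vec n i $ j))"
    proof (rule sum.cong)
      fix i assume "i \<in> {..<n}"
      have "unit_vec n i $ j = (\<Sum>b\<in>B. cc (unit_vec n i) b * b $ j)" using cc[of "unit_vec n i"] j by simp
      then show "(\<Sum>b\<in>B. w $ i * (cc (unit_vec n i) b * b $ j)) = w $ i * (unit_vec n i $ j)"
        by (simp add: sum_distrib_left)
    qed simp
    also have "\<dots> = (\<Sum>i\<in>{j}. w $ i * (unit_vec n i $ j))"
      by (rule sum.mono_neutral_right) (use j in auto)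
    finally show ?thesis using j by simp
  qed
  have "d b \<bullet> b' = (if b = b' then 1 else 0)" if b: "b \<in> B" "b' \<in> B" for b b'
  proof -
    have b'c: "b' \<in> carrier_vec n" using b car by blast
    have 1: "\<forall>i<n. b' $ i = (\<Sum>b\<in>B. (\<lambda>b\<in>B. d b \<bullet> b') b * b $ i)" using rep[OF b'c] by simp
    have "(\<Sum>b\<in>B. (\<lambda>b\<in>B. if b = b' then 1 else 0) b * b $ i) = (\<Sum>b\<in>{b'}. b $ i)" for i
      by (rule sum.mono_neutral_cong_right) (use fin b in auto)
    then have 2: "\<forall>i<n. b' $ i = (\<Sum>b\<in>B. (\<lambda>b\<in>B. if b = b' then 1 else 0) b * b $ i)" by simp
    obtain c0 where c0: "\<And>c. c \<in> B \<rightarrow>\<^sub>E UNIV \<Longrightarrow> \<forall>i<n. b' $ i = (\<Sum>b\<in>B. c b * b $ i) \<Longrightarrow> c = c0"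
      using ex1[OF b'c] by blast
    have "(\<lambda>b\<in>B. d b \<bullet> b') = c0" by (rule c0[OF _ 1]) (auto simp: PiE_def extensional_def)
    moreover have "(\<lambda>b\<in>B. if b = b' then 1 else 0) = c0" by (rule c0[OF _ 2]) (auto simp: PiE_def extensional_def)
    ultimately have "(\<lambda>b\<in>B. d b \<bullet> b') b = (\<lambda>b\<in>B. if b = b' then 1 else 0) b" by simp
    then show ?thesis using b(1) by simp
  qed
  then show ?thesis using that dc rep by blast
qed

text \<open>More than \<open>n\<close> vectors with \<open>n\<close> entries are dependent, but
  pairing a dependency with the dual basis kills its coefficients.\<close>

lemma card_lattice_basis_le:
  assumes "lattice_basis n B"
  shows "card B \<le> n"
proof (rule ccontr)
  assume neg: "\<not> card B \<le> n"
  have fin: "finite B" and car: "B \<subseteq> carrier_vec n" using assms by (auto simp: lattice_basis_def)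
  obtain d where d: "\<And>b b'. b \<in> B \<Longrightarrow> b' \<in> B \<Longrightarrow> d b \<bullet> b' = (if b = b' then 1 else 0 :: int)"
    using lattice_basis_dual[OF assms] by metis
  let ?\<Phi> = "(\<lambda>i b. (b :: int vec) $ i) ` {..<n}"
  have "card ?\<Phi> \<le> n" using card_image_le[of "{..<n}"] by simp
  then have lt: "card ?\<Phi> < card B" using neg by linarith
  obtain e where e: "\<exists>x\<in>B. e x \<noteq> 0" "balanced ?\<Phi> B e"
    using exists_dependency[OF _ fin lt] by blast
  have "e b = 0" if b: "b \<in> B" for b
  proof -
    have "(\<Sum>x\<in>B. e x * (d b \<bullet> x)) = (\<Sum>x\<in>B. \<Sum>i<n. d b $ i * (e x * x $ i))"
    proof (rule sum.cong)
      fix x assume "x \<in> B"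
      then have "x \<in> carrier_vec n" using car by blast
      then show "e x * (d b \<bullet> x) = (\<Sum>i<n. d b $ i * (e x * x $ i))"
        unfolding scalar_prod_lessThan[OF \<open>x \<in> carrier_vec n\<close>] sum_distrib_left
        by (intro sum.cong refl) simp
    qed simp
    also have "\<dots> = (\<Sum>i<n. d b $ i * (\<Sum>x\<in>B. e x * x $ i))"
      by (subst sum.swap) (simp add: sum_distrib_left)
    also have "\<dots> = 0" using e(2) by (simp add: balanced_def)
    finally have "(\<Sum>x\<in>B. e x * (d b \<bullet> x)) = 0" .
    moreover have "(\<Sum>x\<in>B. e x * (d b \<bullet> x)) = (\<Sum>x\<in>{b}. e x)"
      by (rule sum.mono_neutral_cong_right) (use fin b d in auto)
    ultimately show ?thesis by simp
  qed
  then show False using e(1) by blast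
qed

lemma cone_rays_subset_fan_rays: "fan n \<Sigma> \<Longrightarrow> \<sigma> \<in> \<Sigma> \<Longrightarrow> cone_rays n \<sigma> \<subseteq> fan_rays n \<Sigma>"
  by (auto simp: cone_rays_def fan_rays_def fan_def)

text \<open>Coordinates in the lattice basis are integers; comparing them with the real expansion
  over the rays of the cone shows that they are nonnegative and vanish off those rays.\<close>

lemma integral_cone_coordinates:
  assumes f: "fan n \<Sigma>" and \<sigma>: "\<sigma> \<in> \<Sigma>" and B: "lattice_basis n B" "cone_rays n \<sigma> \<subseteq> B"
    and w: "w \<in> carrier_vec n" "map_vec real_of_int w \<in> \<sigma>"
  obtains a :: "int vec \<Rightarrow> nat" where "\<And>i. i < n \<Longrightarrow> w $ i = (\<Sum>b\<in>cone_rays n \<sigma>. int (a b) * b $ i)"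
proof -
  have fin: "finite B" and car: "B \<subseteq> carrier_vec n" using B by (auto simp: lattice_basis_def)
  obtain d where d: "\<And>b b'. b \<in> B \<Longrightarrow> b' \<in> B \<Longrightarrow> d b \<bullet> b' = (if b = b' then 1 else 0 :: int)"
    "\<And>w i. w \<in> carrier_vec n \<Longrightarrow> i < n \<Longrightarrow> w $ i = (\<Sum>b\<in>B. (d b \<bullet> w) * b $ i)"
    using lattice_basis_dual[OF B(1)] by metis
  obtain R where R: "finite R" "R \<subseteq> cone_rays n \<sigma>" "map_vec real_of_int w \<in> cone_gen n R"
    using cone_rays_generate[of n \<sigma>] f \<sigma> w(2) unfolding fan_def by blast
  have Rc: "R \<subseteq> carrier_vec n" using R B(2) car by blast
  obtain c where c: "\<forall>r\<in>R. 0 \<le> c r" "\<forall>i<n. map_vec real_of_int w $ i = (\<Sum>v\<in>R. c v * real_of_int (v $ i))"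
    using R(3) unfolding cone_gen_iff[OF R(1) Rc] by blast
  have coord: "real_of_int (d b \<bullet> w) = (if b \<in> R then c b else 0)" if b: "b \<in> B" for b
  proof -
    have "real_of_int (d b \<bullet> w) = (\<Sum>i<n. real_of_int (d b $ i) * (\<Sum>v\<in>R. c v * real_of_int (v $ i)))"
      unfolding scalar_prod_lessThan[OF w(1)] of_int_sum of_int_mult
      by (rule sum.cong) (use c(2) w(1) in auto)
    also have "\<dots> = (\<Sum>v\<in>R. c v * (\<Sum>i<n. real_of_int (d b $ i) * real_of_int (v $ i)))"
      unfolding sum_distrib_left by (subst sum.swap) (simp add: mult_ac)
    also have "\<dots> = (\<Sum>v\<in>R. c v * real_of_int (d b \<bullet> v))"
    proof (rule sum.cong)
      fix v assume "v \<in> R"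
      then have "v \<in> carrier_vec n" using Rc by blast
      then show "c v * (\<Sum>i<n. real_of_int (d b $ i) * real_of_int (v $ i)) = c v * real_of_int (d b \<bullet> v)"
        using scalar_prod_lessThan[of v n "d b"] by simp
    qed simp
    also have "\<dots> = (\<Sum>v\<in>R. c v * (if b = v then 1 else 0))"
      by (rule sum.cong) (use d(1)[OF b] R(2) B(2) in auto)
    also have "\<dots> = (if b \<in> R then c b else 0)" using R(1) by (simp add: sum.delta' if_distrib cong: if_cong)
    finally show ?thesis .
  qed
  have "w $ i = (\<Sum>b\<in>cone_rays n \<sigma>. int (nat (d b \<bullet> w)) * b $ i)" if i: "i < n" for i
  proof -
    have "w $ i = (\<Sum>b\<in>B. (d b \<bullet> w) * b $ i)" by (rule d(2)[OF w(1) i])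
    also have "\<dots> = (\<Sum>b\<in>cone_rays n \<sigma>. int (nat (d b \<bullet> w)) * b $ i)"
    proof (rule sum.mono_neutral_cong_right[OF fin B(2)])
      have "real_of_int (d b \<bullet> w) = 0" if "b \<in> B - cone_rays n \<sigma>" for b
      proof -
        have "b \<in> B" "b \<notin> R" using that R(2) by auto
        then show ?thesis using coord by simp
      qed
      then show "\<forall>b\<in>B - cone_rays n \<sigma>. (d b \<bullet> w) * b $ i = 0" by simp
      fix b assume "b \<in> cone_rays n \<sigma>"
      then have "b \<in> B" using B(2) by blast
      have "0 \<le> real_of_int (d b \<bullet> w)" unfolding coord[OF \<open>b \<in> B\<close>] using c(1) by auto
      then show "(d b \<bullet> w) * b $ i = int (nat (d b \<bullet> w)) * b $ i" by simp
    qed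
    finally show ?thesis .
  qed
  then show ?thesis by (rule that)
qed

section \<open>From the fan to the Fano polytope\<close>

text \<open>Functions form the additive group required by \<open>smooth_fano\<close>; with zeros
  from \<open>n\<close> on, equality of functions is equality of vectors of dimension
  \<open>n\<close>.\<close>

definition coords :: "nat \<Rightarrow> int vec \<Rightarrow> nat \<Rightarrow> int" where
  "coords n v = (\<lambda>i. if i < n then v $ i else 0)"

lemma sum_mset_fun_apply: "(\<Sum>x\<in>#M. f x) i = (\<Sum>x\<in>#M. f x i)"
  for f :: "'b \<Rightarrow> 'c \<Rightarrow> 'd::comm_monoid_add"
  by (induction M) (auto simp: zero_fun_def plus_fun_def)

lemma sum_mset_scalar_prod:
  assumes "set_mset M \<subseteq> carrier_vec n"
  shows "(\<Sum>v\<in>#M. m \<bullet> v) = (\<Sum>i<n. m $ i * (\<Sum>v\<in>#M. coords n v) i)"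
  using assms
proof (induction M)
  case (add x M)
  then show ?case using scalar_prod_lessThan[of x n m]
    by (simp add: plus_fun_def coords_def sum.distrib distrib_left)
qed (simp add: zero_fun_def)

text \<open>Converts coefficients into multisets, the form in which \<open>smooth_fano\<close>
  expresses relations.\<close>

lemma mset_of_coefficients:
  fixes a :: "'b \<Rightarrow> nat"
  assumes "finite A"
  shows "\<exists>M. set_mset M = {x\<in>A. 0 < a x} \<and> (\<forall>g. (\<Sum>x\<in>#M. g x) = (\<Sum>x\<in>A. int (a x) * g x))"
  using assms
proof (induction A rule: finite_induct)
  case (insert y A)
  then obtain M where M: "set_mset M = {x\<in>A. 0 < a x}"
    "\<And>g. (\<Sum>x\<in>#M. g x) = (\<Sum>x\<in>A. int (a x) * g x)" by blast
  have "set_mset (replicate_mset (a y) y + M) = {x\<in>insert y A. 0 < a x}" using M(1) by auto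
  moreover have "(\<Sum>x\<in>#replicate_mset (a y) y + M. g x) = (\<Sum>x\<in>insert y A. int (a x) * g x)" for g
    using insert.hyps by (simp add: M(2))
  ultimately show ?case by blast
qed (intro exI[of _ "{#}"], simp)

lemma coordinate_sum_mset:
  assumes "set_mset M \<subseteq> B" "b \<in> B"
    and "\<And>b'. b' \<in> B \<Longrightarrow> d \<bullet> b' = (if b = b' then 1 else 0 :: int)"
  shows "(\<Sum>x\<in>#M. d \<bullet> x) = int (count M b)"
  using assms(1)
proof (induction M)
  case (add x M)
  then show ?case using assms(3)[of x] by auto
qed simp

text \<open>Ampleness of the anticanonical divisor gives each maximal cone a functional equal to 1
  on its rays and smaller on all others. \<open>complete\<close> holds because the cones cover the
  space and are smooth, \<open>independent\<close> because the rays of a cone are part of a lattice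
  basis.\<close>

lemma smooth_toric_fano_polytope:
  assumes X: "smooth_toric_fano n \<Sigma>"
  shows "\<exists>U. smooth_fano (fan_rays n \<Sigma>) (coords n) U \<and>
    (\<forall>Q. finite Q \<and> Q \<subseteq> fan_rays n \<Sigma> \<and> cone_gen n Q \<in> \<Sigma> \<longrightarrow> (\<exists>u\<in>U. Q \<subseteq> {v\<in>fan_rays n \<Sigma>. u v = 1})) \<and>
    (\<forall>u\<in>U. \<exists>B. lattice_basis n B \<and> {v\<in>fan_rays n \<Sigma>. u v = 1} \<subseteq> B)"
proof -
  define V where "V = fan_rays n \<Sigma>"
  have f: "fan n \<Sigma>" and comp: "\<Union>\<Sigma> = carrier_vec n" and sm: "smooth_fan n \<Sigma>"
    and amp: "ample n \<Sigma> (anticanonical n \<Sigma>)"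
    using X by (auto simp: smooth_toric_fano_def complete_fan_def)
  have fin\<Sigma>: "finite \<Sigma>" using f by (simp add: fan_def)
  have Vc: "V \<subseteq> carrier_vec n" by (auto simp: V_def fan_rays_def primitive_vec_def)
  define Mx where "Mx = {\<sigma>\<in>\<Sigma>. \<forall>\<tau>\<in>\<Sigma>. \<sigma> \<subseteq> \<tau> \<longrightarrow> \<tau> = \<sigma>}"
  have ext: "\<exists>\<tau>\<in>Mx. \<sigma> \<subseteq> \<tau>" if "\<sigma> \<in> \<Sigma>" for \<sigma>
    using finite_has_maximal2[OF fin\<Sigma> that] by (auto simp: Mx_def)
  have "\<forall>\<sigma>\<in>Mx. \<exists>m. m \<in> carrier_vec n \<and> (\<forall>v\<in>cone_rays n \<sigma>. m \<bullet> v = 1) \<and> (\<forall>v\<in>V - cone_rays n \<sigma>. m \<bullet> v < 1)"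
  proof
    fix \<sigma> assume \<sigma>: "\<sigma> \<in> Mx"
    then have "\<sigma> \<in> \<Sigma>" by (simp add: Mx_def)
    obtain m where m: "m \<in> carrier_vec n" "\<forall>v\<in>cone_rays n \<sigma>. anticanonical n \<Sigma> v = - (m \<bullet> v)"
      "\<forall>v\<in>V - cone_rays n \<sigma>. anticanonical n \<Sigma> v > - (m \<bullet> v)"
      using amp \<sigma> unfolding ample_def Mx_def V_def by blast
    have one: "anticanonical n \<Sigma> v = 1" if "v \<in> V" for v using that by (simp add: anticanonical_def V_def)
    have neg: "(- m) \<bullet> v = - (m \<bullet> v)" if "v \<in> V" for v
      using that Vc m(1) by (intro scalar_prod_uminus_left) auto
    have sub: "cone_rays n \<sigma> \<subseteq> V" unfolding V_def by (rule cone_rays_subset_fan_rays[OF f \<open>\<sigma> \<in> \<Sigma>\<close>])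
    show "\<exists>m. m \<in> carrier_vec n \<and> (\<forall>v\<in>cone_rays n \<sigma>. m \<bullet> v = 1) \<and> (\<forall>v\<in>V - cone_rays n \<sigma>. m \<bullet> v < 1)"
      using m one neg sub by (intro exI[of _ "- m"]) (auto simp: subset_iff)
  qed
  from bchoice[OF this] obtain m where m: "\<And>\<sigma>. \<sigma> \<in> Mx \<Longrightarrow> m \<sigma> \<in> carrier_vec n"
    "\<And>\<sigma> v. \<sigma> \<in> Mx \<Longrightarrow> v \<in> cone_rays n \<sigma> \<Longrightarrow> m \<sigma> \<bullet> v = 1"
    "\<And>\<sigma> v. \<sigma> \<in> Mx \<Longrightarrow> v \<in> V - cone_rays n \<sigma> \<Longrightarrow> m \<sigma> \<bullet> v < 1" by blast
  define u where "u \<sigma> v = m \<sigma> \<bullet> v" for \<sigma> v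
  have sub: "cone_rays n \<sigma> \<subseteq> V" if "\<sigma> \<in> Mx" for \<sigma>
    unfolding V_def using that by (intro cone_rays_subset_fan_rays[OF f]) (simp add: Mx_def)
  have facet: "{v\<in>V. u \<sigma> v = 1} = cone_rays n \<sigma>" if "\<sigma> \<in> Mx" for \<sigma>
    using m(2,3)[OF that] sub[OF that] unfolding u_def by fastforce
  have basis: "\<exists>B. lattice_basis n B \<and> cone_rays n \<sigma> \<subseteq> B" if "\<sigma> \<in> Mx" for \<sigma>
    using sm that by (auto simp: smooth_fan_def Mx_def)
  have finrays: "finite (cone_rays n \<sigma>)" if "\<sigma> \<in> Mx" for \<sigma>
    using basis[OF that] finite_subset by (auto simp: lattice_basis_def)
  \<comment> \<open>Two cones of a fan meet in a common face, so a ray of the fan contained in a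
    cone is one of its rays.\<close>
  have ray: "v \<in> cone_rays n \<sigma>" if v: "v \<in> V" and \<sigma>: "\<sigma> \<in> \<Sigma>" and le: "cone_gen n {v} \<subseteq> \<sigma>" for v \<sigma>
  proof -
    have "primitive_vec n v" "cone_gen n {v} \<in> \<Sigma>" using v by (auto simp: V_def fan_rays_def)
    moreover have "is_face n (cone_gen n {v} \<inter> \<sigma>) \<sigma>" using f \<sigma> calculation(2) by (simp add: fan_def)
    moreover have "cone_gen n {v} \<inter> \<sigma> = cone_gen n {v}" using le by blast
    ultimately show ?thesis by (simp add: cone_rays_def)
  qed
  have faces: "\<exists>\<sigma>\<in>Mx. Q \<subseteq> cone_rays n \<sigma>" if Q: "finite Q" "Q \<subseteq> V" "cone_gen n Q \<in> \<Sigma>" for Q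
  proof -
    obtain \<tau> where \<tau>: "\<tau> \<in> Mx" "cone_gen n Q \<subseteq> \<tau>" using ext[OF Q(3)] by blast
    have "v \<in> cone_rays n \<tau>" if "v \<in> Q" for v
    proof (rule ray)
      have "cone_gen n {v} \<subseteq> cone_gen n Q" by (rule cone_gen_mono) (use Q Vc that in auto)
      then show "cone_gen n {v} \<subseteq> \<tau>" using \<tau> by blast
    qed (use Q that \<tau> in \<open>auto simp: Mx_def\<close>)
    then show ?thesis using \<tau>(1) by blast
  qed
  have "V \<subseteq> (\<Union>\<sigma>\<in>Mx. cone_rays n \<sigma>)"
  proof
    fix v assume v: "v \<in> V"
    then have "cone_gen n {v} \<in> \<Sigma>" by (simp add: V_def fan_rays_def)
    then show "v \<in> (\<Union>\<sigma>\<in>Mx. cone_rays n \<sigma>)" using faces[of "{v}"] v by auto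
  qed
  moreover have finMx: "finite Mx" using fin\<Sigma> by (simp add: Mx_def)
  ultimately have finV: "finite V" using finrays finite_subset[of V "\<Union>\<sigma>\<in>Mx. cone_rays n \<sigma>"] by auto
  have "smooth_fano V (coords n) (u ` Mx)"
  proof
    show "finite V" by (rule finV)
    show "finite (u ` Mx)" using finMx by simp
  next
    fix v assume "v \<in> V"
    then have "v \<in> carrier_vec n" "v \<noteq> 0\<^sub>v n" by (auto simp: V_def fan_rays_def primitive_vec_def)
    then obtain i where "i < n" "v $ i \<noteq> 0" by (metis carrier_vecD eq_vecI index_zero_vec)
    then have "coords n v i \<noteq> 0" by (simp add: coords_def)
    then show "coords n v \<noteq> 0" by (metis zero_fun_def)
  next
    fix w v assume "w \<in> u ` Mx" "v \<in> V"
    then obtain \<sigma> where \<sigma>: "\<sigma> \<in> Mx" "w = u \<sigma>" by blast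
    show "w v \<le> 1"
      using m(2)[OF \<sigma>(1), of v] m(3)[OF \<sigma>(1), of v] \<open>v \<in> V\<close> unfolding \<sigma>(2) u_def
      by (cases "v \<in> cone_rays n \<sigma>") auto
  next
    fix w :: "int vec \<Rightarrow> int" and A B :: "int vec multiset"
    assume "w \<in> u ` Mx" and A: "set_mset A \<subseteq> V" "set_mset B \<subseteq> V"
      and eq: "(\<Sum>x\<in>#A. coords n x) = (\<Sum>x\<in>#B. coords n x)"
    obtain \<sigma> where w: "w = (\<lambda>v. m \<sigma> \<bullet> v)" using \<open>w \<in> u ` Mx\<close> unfolding u_def by blast
    have "set_mset A \<subseteq> carrier_vec n" "set_mset B \<subseteq> carrier_vec n" using A Vc by blast+
    then show "(\<Sum>x\<in>#A. w x) = (\<Sum>x\<in>#B. w x)"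
      by (simp only: w sum_mset_scalar_prod eq)
  next
    fix A B :: "int vec multiset"
    assume A: "set_mset A \<subseteq> V" "set_mset B \<subseteq> V"
    \<comment> \<open>Completeness puts the difference of the two sums into a maximal cone, where
      smoothness expands it over the rays.\<close>
    define w where "w = vec n (\<lambda>i. (\<Sum>x\<in>#A. coords n x) i - (\<Sum>x\<in>#B. coords n x) i)"
    have w: "w \<in> carrier_vec n" by (simp add: w_def)
    then have "map_vec real_of_int w \<in> carrier_vec n" by simp
    then obtain \<sigma> where "\<sigma> \<in> \<Sigma>" "map_vec real_of_int w \<in> \<sigma>" using comp by blast
    then obtain \<tau> where \<tau>: "\<tau> \<in> Mx" "map_vec real_of_int w \<in> \<tau>" using ext by blast
    obtain L where L: "lattice_basis n L" "cone_rays n \<tau> \<subseteq> L" using basis[OF \<tau>(1)] by blast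
    have "\<tau> \<in> \<Sigma>" using \<tau>(1) by (simp add: Mx_def)
    then obtain a :: "int vec \<Rightarrow> nat" where a: "\<And>i. i < n \<Longrightarrow> w $ i = (\<Sum>b\<in>cone_rays n \<tau>. int (a b) * b $ i)"
      using integral_cone_coordinates[OF f _ L w \<tau>(2)] by blast
    obtain M where M: "set_mset M = {x\<in>cone_rays n \<tau>. 0 < a x}"
      "\<And>g. (\<Sum>x\<in>#M. g x) = (\<Sum>x\<in>cone_rays n \<tau>. int (a x) * g x)"
      using mset_of_coefficients[OF finrays[OF \<tau>(1)], of a] by blast
    have "(\<Sum>x\<in>#A. coords n x) = (\<Sum>x\<in>#B. coords n x) + (\<Sum>x\<in>#M. coords n x)"
    proof
      fix i
      show "(\<Sum>x\<in>#A. coords n x) i = ((\<Sum>x\<in>#B. coords n x) + (\<Sum>x\<in>#M. coords n x)) i"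
      proof (cases "i < n")
        case True
        have "(\<Sum>x\<in>#M. coords n x) i = w $ i"
          unfolding sum_mset_fun_apply M(2) a[OF True] by (simp add: coords_def True)
        then show ?thesis using True by (simp add: w_def plus_fun_def)
      next
        case False
        then have "(\<Sum>x\<in>#A. coords n x) i = 0" for A unfolding sum_mset_fun_apply by (simp add: coords_def)
        then show ?thesis by (simp add: plus_fun_def)
      qed
    qed
    moreover have "set_mset M \<subseteq> {v\<in>V. u \<tau> v = 1}" unfolding facet[OF \<tau>(1)] M(1) by blast
    ultimately show "\<exists>w\<in>u ` Mx. \<exists>M. set_mset M \<subseteq> {v \<in> V. w v = 1} \<and>
        (\<Sum>x\<in>#A. coords n x) = (\<Sum>x\<in>#B. coords n x) + (\<Sum>x\<in>#M. coords n x)"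
      using \<tau>(1) by blast
  next
    fix w :: "int vec \<Rightarrow> int" and A B :: "int vec multiset"
    assume w: "w \<in> u ` Mx" and A0: "set_mset A \<subseteq> {v \<in> V. w v = 1}" and B0: "set_mset B \<subseteq> {v \<in> V. w v = 1}"
      and eq: "(\<Sum>x\<in>#A. coords n x) = (\<Sum>x\<in>#B. coords n x)"
    obtain \<sigma> where \<sigma>: "\<sigma> \<in> Mx" "w = u \<sigma>" using w by blast
    obtain L where L: "lattice_basis n L" "cone_rays n \<sigma> \<subseteq> L" using basis[OF \<sigma>(1)] by blast
    have A: "set_mset A \<subseteq> L" "set_mset B \<subseteq> L" using A0 B0 facet[OF \<sigma>(1)] L(2) \<sigma>(2) by auto
    have Lc: "L \<subseteq> carrier_vec n" using L(1) by (simp add: lattice_basis_def)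
    obtain d where d: "\<And>b b'. b \<in> L \<Longrightarrow> b' \<in> L \<Longrightarrow> d b \<bullet> b' = (if b = b' then 1 else 0 :: int)"
      using lattice_basis_dual[OF L(1)] by metis
    show "A = B"
    proof (rule multiset_eqI)
      fix b
      show "count A b = count B b"
      proof (cases "b \<in> L")
        case True
        have "int (count A b) = (\<Sum>x\<in>#A. d b \<bullet> x)"
          by (rule coordinate_sum_mset[symmetric, OF A(1) True]) (rule d[OF True])
        also have "\<dots> = (\<Sum>x\<in>#B. d b \<bullet> x)"
          by (simp only: sum_mset_scalar_prod[OF subset_trans[OF A(1) Lc]] sum_mset_scalar_prod[OF subset_trans[OF A(2) Lc]] eq)
        also have "\<dots> = int (count B b)"
          by (rule coordinate_sum_mset[OF A(2) True]) (rule d[OF True])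
        finally show ?thesis by simp
      next
        case False
        then show ?thesis using A by (metis not_in_iff subsetD)
      qed
    qed
  qed
  moreover have "\<forall>Q. finite Q \<and> Q \<subseteq> V \<and> cone_gen n Q \<in> \<Sigma> \<longrightarrow> (\<exists>w\<in>u ` Mx. Q \<subseteq> {v\<in>V. w v = 1})"
  proof (intro allI impI)
    fix Q assume Q: "finite Q \<and> Q \<subseteq> V \<and> cone_gen n Q \<in> \<Sigma>"
    then obtain \<sigma> where "\<sigma> \<in> Mx" "Q \<subseteq> cone_rays n \<sigma>" using faces by blast
    then show "\<exists>w\<in>u ` Mx. Q \<subseteq> {v\<in>V. w v = 1}" using facet by (intro bexI[of _ "u \<sigma>"]) auto
  qed
  moreover have "\<forall>w\<in>u ` Mx. \<exists>B. lattice_basis n B \<and> {v\<in>V. w v = 1} \<subseteq> B"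
    using basis facet by auto
  ultimately show ?thesis unfolding V_def[symmetric] by (intro exI[of _ "u ` Mx"] conjI)
qed

section \<open>Rays outside a zero-sum primitive collection\<close>

lemma sum_mset_count_weighted: "(\<Sum>x\<in>#M. g x) = (\<Sum>y\<in>set_mset M. int (count M y) * g y)"
proof (induction M)
  case (add x M)
  have "(\<Sum>y\<in>set_mset (add_mset x M). int (count (add_mset x M) y) * g y)
      = (\<Sum>y\<in>insert x (set_mset M). (if y = x then g x else 0) + int (count M y) * g y)"
    by (rule sum.cong) (auto simp: distrib_right)
  also have "\<dots> = g x + (\<Sum>y\<in>insert x (set_mset M). int (count M y) * g y)"
    by (simp add: sum.distrib)
  also have "(\<Sum>y\<in>insert x (set_mset M). int (count M y) * g y) = (\<Sum>y\<in>set_mset M. int (count M y) * g y)"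
    by (rule sum.mono_neutral_right) (auto simp: not_in_iff)
  finally show ?case using add by simp
qed simp

text \<open>\<open>F\<close> is a facet through all rays of \<open>C\<close> but one. The
  coordinates of its lattice basis away from \<open>C\<close> are at most \<open>q\<close>
  functionals vanishing on \<open>C\<close>, so \<open>card_le_exhaust_bound\<close> bounds the rays
  outside \<open>C\<close>; \<open>Suc\<close> allows for the omitted ray.\<close>

lemma card_zero_sum_complement_le:
  assumes X: "smooth_toric_fano n \<Sigma>" and C: "C \<in> minimal_components n \<Sigma>" and q: "codegree n C = int q"
  obtains B F where "finite (fan_rays n \<Sigma>)" "lattice_basis n B" "F \<subseteq> B" "F \<subseteq> fan_rays n \<Sigma>"
    "card (fan_rays n \<Sigma> - F) \<le> Suc (exhaust_bound q (Suc q))"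
proof -
  define V where "V = fan_rays n \<Sigma>"
  define W where "W = V - C"
  obtain U where fano: "smooth_fano V (coords n) U"
    and cone: "\<And>Q. \<lbrakk>finite Q; Q \<subseteq> V; cone_gen n Q \<in> \<Sigma>\<rbrakk> \<Longrightarrow> \<exists>u\<in>U. Q \<subseteq> {v\<in>V. u v = 1}"
    and basis: "\<And>u. u \<in> U \<Longrightarrow> \<exists>B. lattice_basis n B \<and> {v\<in>V. u v = 1} \<subseteq> B"
    using smooth_toric_fano_polytope[OF X] unfolding V_def[symmetric] by (elim exE conjE) (rule that, assumption, simp, simp)
  interpret smooth_fano V "coords n" U by (rule fano)
  have Vc: "V \<subseteq> carrier_vec n" by (auto simp: V_def fan_rays_def primitive_vec_def)
  have CV: "C \<subseteq> V" and Cproper: "\<And>Q. Q \<subset> C \<Longrightarrow> cone_gen n Q \<in> \<Sigma>"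
    and C0: "finsum_vec TYPE(int) n (\<lambda>v. v) C = 0\<^sub>v n"
    using C by (auto simp: minimal_components_def primitive_collection_def V_def)
  have finC: "finite C" using CV finite_V finite_subset by blast
  have Csum: "(\<Sum>c\<in>C. c $ i) = 0" if "i < n" for i
  proof -
    have "(\<Sum>c\<in>C. c $ i) = finsum_vec TYPE(int) n (\<lambda>v. v) C $ i"
      by (rule index_finsum_vec[symmetric, OF finC that]) (use CV Vc in auto)
    then show ?thesis using C0 that by simp
  qed
  have proper_face: "face Q" if "Q \<subset> C" for Q
  proof -
    have "finite Q" "Q \<subseteq> V" using that finC CV finite_subset by auto
    then show ?thesis using cone[OF _ _ Cproper[OF that]] unfolding face_def F_def by blast
  qed
  \<comment> \<open>If \<open>C\<close> is empty, any facet and any \<open>c\<close> serve, hence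
    the conditional membership of \<open>c\<close>.\<close>
  obtain u c where u: "u \<in> U" "C - {c} \<subseteq> F u" "C \<noteq> {} \<Longrightarrow> c \<in> C"
  proof (cases "C = {}")
    case True
    obtain u where "u \<in> U" using complete[of "{#}" "{#}"] by auto
    then show ?thesis using that[of u] True by blast
  next
    case False
    then obtain c where "c \<in> C" by blast
    then have "face (C - {c})" by (intro proper_face) auto
    then show ?thesis using that \<open>c \<in> C\<close> unfolding face_def by blast
  qed
  define K where "K = C - {c}"
  obtain B where B: "lattice_basis n B" "F u \<subseteq> B" using basis[OF u(1)] unfolding F_def by blast
  have finB: "finite B" and Bc: "B \<subseteq> carrier_vec n" using B(1) by (auto simp: lattice_basis_def)
  have KB: "K \<subseteq> B" using u(2) B(2) by (auto simp: K_def)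
  obtain d where d: "\<And>b b'. b \<in> B \<Longrightarrow> b' \<in> B \<Longrightarrow> d b \<bullet> b' = (if b = b' then 1 else 0 :: int)"
    "\<And>w i. w \<in> carrier_vec n \<Longrightarrow> i < n \<Longrightarrow> w $ i = (\<Sum>b\<in>B. (d b \<bullet> w) * b $ i)"
    using lattice_basis_dual[OF B(1)] by metis
  define \<Phi> where "\<Phi> = (\<lambda>b v. d b \<bullet> v) ` (B - K)"
  have fin\<Phi>: "finite \<Phi>" using finB by (simp add: \<Phi>_def)
  have card\<Phi>: "card \<Phi> \<le> q"
  proof -
    have "card \<Phi> \<le> card (B - K)" unfolding \<Phi>_def by (rule card_image_le) (use finB in simp)
    also have "\<dots> = card B - card K" by (rule card_Diff_subset) (use KB finC in \<open>auto simp: K_def\<close>)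
    also have "\<dots> \<le> q"
    proof (cases "C = {}")
      case True
      then show ?thesis using q card_lattice_basis_le[OF B(1)] by (simp add: codegree_def component_degree_def)
    next
      case False
      then have "card K = card C - 1" "card C > 0" using u(3) finC by (auto simp: K_def card_gt_0_iff)
      then show ?thesis using q card_lattice_basis_le[OF B(1)]
        by (simp add: codegree_def component_degree_def)
    qed
    finally show ?thesis .
  qed
  \<comment> \<open>By duality the functionals vanish on \<open>K\<close>, and then also at
    \<open>c\<close>, because the rays of \<open>C\<close> sum to zero.\<close>
  have \<Phi>C: "\<phi> x = 0" if \<phi>: "\<phi> \<in> \<Phi>" and x: "x \<in> C" for \<phi> x
  proof -
    obtain b where b: "b \<in> B" "b \<notin> K" "\<phi> = (\<lambda>v. d b \<bullet> v)" using \<phi> by (auto simp: \<Phi>_def)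
    have K0: "\<phi> y = 0" if "y \<in> K" for y using d(1)[OF b(1), of y] that KB b by auto
    show ?thesis
    proof (cases "x = c")
      case False
      then show ?thesis using K0 x by (simp add: K_def)
    next
      case True
      have Cc: "y \<in> carrier_vec n" if "y \<in> C" for y using that CV Vc by blast
      have "(\<Sum>y\<in>C. \<phi> y) = (\<Sum>y\<in>C. \<Sum>i<n. d b $ i * y $ i)"
        unfolding b(3) by (rule sum.cong[OF refl], rule scalar_prod_lessThan, rule Cc)
      also have "\<dots> = (\<Sum>i<n. d b $ i * (\<Sum>y\<in>C. y $ i))"
        unfolding sum_distrib_left by (rule sum.swap)
      also have "\<dots> = 0" using Csum by simp
      finally have "(\<Sum>y\<in>C. \<phi> y) = 0" .
      moreover have "(\<Sum>y\<in>C. \<phi> y) = \<phi> c + (\<Sum>y\<in>K. \<phi> y)"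
        unfolding K_def by (rule sum.remove[OF finC]) (use x True in simp)
      moreover have "(\<Sum>y\<in>K. \<phi> y) = 0" using K0 by simp
      ultimately show ?thesis using True by simp
    qed
  qed
  have \<Phi>lin: "(\<Sum>x\<in>#A. \<phi> x) = (\<Sum>x\<in>#A'. \<phi> x)"
    if \<phi>: "\<phi> \<in> \<Phi>" and A: "set_mset A \<subseteq> V" "set_mset A' \<subseteq> V" "S A = S A'" for \<phi> A A'
  proof -
    obtain b where b: "\<phi> = (\<lambda>v. d b \<bullet> v)" using \<phi> by (auto simp: \<Phi>_def)
    show ?thesis
      by (simp only: b sum_mset_scalar_prod[OF subset_trans[OF A(1) Vc]] sum_mset_scalar_prod[OF subset_trans[OF A(2) Vc]] A(3))
  qed
  \<comment> \<open>The relation makes a point \<open>w\<close> in the span of \<open>K\<close> from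
    the rays of \<open>T\<close>. Adding a multiple of the zero sum of \<open>C\<close> expands
    \<open>w\<close> over a face inside \<open>C\<close>; expansions being unique, this contradicts
    that \<open>T\<close> avoids \<open>C\<close>.\<close>
  have "\<not> face T" if T: "T \<subseteq> W" "zero_set \<Phi> T" for T
  proof
    assume fT: "face T"
    have finT: "finite T" by (rule face_finite[OF fT])
    obtain e where e: "\<forall>x\<in>T. 0 \<le> e x" "\<exists>x\<in>T. 0 < e x" "balanced \<Phi> T e" using T(2) by (auto simp: zero_set_def)
    obtain M where M: "set_mset M = {x\<in>T. 0 < nat (e x)}" "\<And>g. (\<Sum>x\<in>#M. g x) = (\<Sum>x\<in>T. int (nat (e x)) * g x)"
      using mset_of_coefficients[OF finT, of "\<lambda>x. nat (e x)"] by blast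
    have Mf: "face (set_mset M)" by (rule face_subset[OF fT]) (use M(1) in auto)
    have MV: "set_mset M \<subseteq> V" by (rule face_in_V[OF Mf])
    have M0: "M \<noteq> {#}"
    proof
      assume "M = {#}"
      then have "{x\<in>T. 0 < nat (e x)} = {}" using M(1) by simp
      then show False using e(2) by auto
    qed
    define w where "w = vec n (S M)"
    have wc: "w \<in> carrier_vec n" by (simp add: w_def)
    have dw: "d b \<bullet> w = (\<Sum>x\<in>#M. d b \<bullet> x)" for b
      unfolding sum_mset_scalar_prod[OF subset_trans[OF MV Vc]] scalar_prod_lessThan[OF wc]
      by (rule sum.cong) (auto simp: w_def)
    have z: "d b \<bullet> w = 0" if "b \<in> B - K" for b
    proof -
      have "(\<Sum>x\<in>#M. d b \<bullet> x) = (\<Sum>x\<in>T. e x * (d b \<bullet> x))"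
        unfolding M(2) by (rule sum.cong) (use e(1) in auto)
      also have "\<dots> = 0" using e(3) that by (auto simp: balanced_def \<Phi>_def)
      finally show ?thesis using dw by simp
    qed
    have wK: "w $ i = (\<Sum>b\<in>K. (d b \<bullet> w) * b $ i)" if "i < n" for i
      unfolding d(2)[OF wc that]
      by (rule sum.mono_neutral_right[OF finB KB]) (use z in auto)
    have finK: "finite K" using finC by (simp add: K_def)
    \<comment> \<open>The least shift that makes all coefficients nonnegative, the inserted 0
      standing for the coefficient of \<open>c\<close>. The minimum is attained, so for nonempty
      \<open>C\<close> some coefficient becomes 0 and the support is a proper subset of
      \<open>C\<close>.\<close>
    define t where "t = - Min (insert 0 ((\<lambda>b. d b \<bullet> w) ` K))"
    have t: "0 \<le> t" "\<And>b. b \<in> K \<Longrightarrow> 0 \<le> d b \<bullet> w + t"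
    proof -
      have "Min (insert 0 ((\<lambda>b. d b \<bullet> w) ` K)) \<le> 0" using finK by (intro Min_le) auto
      then show "0 \<le> t" by (simp add: t_def)
      fix b assume "b \<in> K"
      then have "Min (insert 0 ((\<lambda>b. d b \<bullet> w) ` K)) \<le> d b \<bullet> w" using finK by (intro Min_le) auto
      then show "0 \<le> d b \<bullet> w + t" by (simp add: t_def)
    qed
    define a where "a x = nat (if x = c then t else d x \<bullet> w + t)" for x
    have aK: "int (a x) = d x \<bullet> w + t" if "x \<in> K" for x using t(2)[OF that] that by (auto simp: a_def K_def)
    obtain M' where M': "set_mset M' = {x\<in>C. 0 < a x}" "\<And>g. (\<Sum>x\<in>#M'. g x) = (\<Sum>x\<in>C. int (a x) * g x)"
      using mset_of_coefficients[OF finC, of a] by blast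
    have "set_mset M' \<subset> C \<or> C = {}"
    proof (cases "C = {}")
      case False
      then have cC: "c \<in> C" by (rule u(3))
      have "- t \<in> insert 0 ((\<lambda>b. d b \<bullet> w) ` K)" unfolding t_def minus_minus
        by (rule Min_in) (use finK in auto)
      then consider "t = 0" | b where "b \<in> K" "- t = d b \<bullet> w" by auto
      then have "\<exists>x\<in>C. a x = 0"
      proof cases
        case 1
        then show ?thesis using cC by (intro bexI[of _ c]) (auto simp: a_def)
      next
        case (2 b)
        then have "int (a b) = 0" using aK[OF 2(1)] by simp
        then show ?thesis using 2(1) by (auto simp: K_def)
      qed
      then obtain x0 where x0: "x0 \<in> C" "a x0 = 0" by blast
      then have "x0 \<notin> set_mset M'" unfolding M'(1) by simp
      then have "set_mset M' \<noteq> C" using x0(1) by blast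
      moreover have "set_mset M' \<subseteq> C" unfolding M'(1) by blast
      ultimately show ?thesis by blast
    qed simp
    then have M'f: "face (set_mset M')"
    proof
      assume "C = {}"
      then have "set_mset M' \<subseteq> set_mset M" using M'(1) by simp
      then show ?thesis using face_subset[OF Mf] by blast
    qed (rule proper_face)
    have "S M' = S M"
    proof
      fix i
      show "S M' i = S M i"
      proof (cases "i < n")
        case True
        have "S M' i = (\<Sum>x\<in>C. int (a x) * x $ i)"
          unfolding sum_mset_fun_apply M'(2) by (simp add: coords_def True)
        also have "\<dots> = (\<Sum>x\<in>K. (d x \<bullet> w) * x $ i) + t * (\<Sum>x\<in>C. x $ i)"
        proof (cases "C = {}")
          case False
          then have cC: "c \<in> C" by (rule u(3))
          have "(\<Sum>x\<in>C. int (a x) * x $ i) = t * c $ i + (\<Sum>x\<in>K. int (a x) * x $ i)"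
            using sum.remove[OF finC cC, of "\<lambda>x. int (a x) * x $ i"] t(1) by (simp add: K_def a_def)
          also have "(\<Sum>x\<in>K. int (a x) * x $ i) = (\<Sum>x\<in>K. (d x \<bullet> w) * x $ i) + t * (\<Sum>x\<in>K. x $ i)"
            using aK by (simp add: distrib_right sum.distrib sum_distrib_left)
          also have "(\<Sum>x\<in>K. x $ i) = (\<Sum>x\<in>C. x $ i) - c $ i"
            using sum.remove[OF finC cC, of "\<lambda>x. x $ i"] by (simp add: K_def)
          finally show ?thesis by (simp add: algebra_simps)
        qed (simp add: K_def)
        also have "\<dots> = w $ i" using wK[OF True] Csum[OF True] by simp
        finally show ?thesis using True by (simp add: w_def)
      next
        case False
        then have "S A i = 0" for A unfolding sum_mset_fun_apply by (simp add: coords_def)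
        then show ?thesis by simp
      qed
    qed
    then have "M' = M" by (rule face_unique[OF M'f Mf])
    then have "set_mset M \<subseteq> C" using M'(1) by auto
    moreover have "set_mset M \<subseteq> W" using M(1) T(1) by auto
    ultimately have "set_mset M = {}" by (auto simp: W_def)
    then show False using M0 by simp
  qed
  moreover have "\<exists>T\<subseteq>W. face T \<and> (\<exists>a>0. \<exists>e. (\<forall>y\<in>T. 0 \<le> e y) \<and>
      (\<forall>\<phi>\<in>\<Phi>. a * \<phi> v + (\<Sum>y\<in>T. e y * \<phi> y) = (0::int)))" if v: "v \<in> W" for v
  proof -
    have vV: "v \<in> V" using v by (simp add: W_def)
    obtain w M where M: "w \<in> U" "set_mset M \<subseteq> {v\<in>V. w v = 1}" "S {#} = S {#v#} + S M"
      using complete[of "{#}" "{#v#}"] vV by auto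
    have MV: "set_mset M \<subseteq> V" using M(2) by blast
    define T where "T = set_mset M - C"
    have "face T" unfolding face_def F_def T_def using M(1,2) by blast
    moreover have "T \<subseteq> W" using MV by (auto simp: T_def W_def)
    moreover have "1 * \<phi> v + (\<Sum>y\<in>T. int (count M y) * \<phi> y) = 0" if \<phi>: "\<phi> \<in> \<Phi>" for \<phi>
    proof -
      have "(\<Sum>x\<in>#add_mset v M. \<phi> x) = (\<Sum>x\<in>#{#}. \<phi> x)"
        by (rule \<Phi>lin[OF \<phi>]) (use vV MV M(3) in auto)
      then have "\<phi> v + (\<Sum>x\<in>#M. \<phi> x) = 0" by simp
      moreover have "(\<Sum>x\<in>#M. \<phi> x) = (\<Sum>y\<in>set_mset M. int (count M y) * \<phi> y)"
        by (rule sum_mset_count_weighted)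
      moreover have "\<dots> = (\<Sum>y\<in>T. int (count M y) * \<phi> y)"
        unfolding T_def by (rule sum.mono_neutral_right) (use \<Phi>C[OF \<phi>] in auto)
      ultimately show ?thesis by simp
    qed
    ultimately show ?thesis by (intro exI[of _ T]) (auto intro!: exI[of _ 1] exI[of _ "\<lambda>y. int (count M y)"])
  qed
  ultimately have cW: "card W \<le> exhaust_bound q (Suc q)"
    by (intro card_le_exhaust_bound[OF fin\<Phi> card\<Phi>]) (auto simp: W_def)
  \<comment> \<open>Of \<open>C\<close>, only \<open>c\<close> can lie off the facet.\<close>
  have "V - F u \<subseteq> insert c W" using u(2) by (auto simp: W_def)
  then have "card (V - F u) \<le> card (insert c W)"
    by (rule card_mono[rotated]) (use finite_V in \<open>simp add: W_def\<close>)
  also have "\<dots> \<le> Suc (card W)" by (rule card_insert_le_m1) auto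
  finally have "card (V - F u) \<le> Suc (exhaust_bound q (Suc q))" using cW by simp
  then show ?thesis using that[of B "F u"] B finite_V F_subset unfolding V_def by blast
qed

section \<open>The Picard rank\<close>

text \<open>Since \<open>F\<close> is part of a lattice basis, every divisor can be changed by a
  principal one to vanish on \<open>F\<close>. Classes are then governed by values on the rays
  outside \<open>F\<close>, and more classes than such rays satisfy an integral relation.\<close>

lemma picard_rank_le_card:
  assumes f: "fan n \<Sigma>" and finV: "finite (fan_rays n \<Sigma>)"
    and B: "lattice_basis n B" and FB: "F \<subseteq> B" and FV: "F \<subseteq> fan_rays n \<Sigma>"
  shows "picard_rank n \<Sigma> \<le> card (fan_rays n \<Sigma> - F)"
proof -
  define V where "V = fan_rays n \<Sigma>"
  define H where "H = (weil_divisors n \<Sigma>)\<lparr>carrier := cartier_divisors n \<Sigma>\<rparr>"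
  define N where "N = principal_divisors n \<Sigma>"
  define G where "G = H Mod N"
  have Vc: "v \<in> carrier_vec n" if "v \<in> V" for v using that by (simp add: V_def fan_rays_def primitive_vec_def)
  have rays: "v \<in> V" if "\<sigma> \<in> \<Sigma>" "v \<in> cone_rays n \<sigma>" for v \<sigma>
    using cone_rays_subset_fan_rays[OF f that(1)] that(2) by (auto simp: V_def)
  have mult: "x \<otimes>\<^bsub>H\<^esub> y = (\<lambda>v\<in>V. x v + y v)" for x y
    by (simp add: H_def weil_divisors_def product_group_def integer_group_def V_def)
  have one: "\<one>\<^bsub>H\<^esub> = (\<lambda>v\<in>V. 0)"
    by (simp add: H_def weil_divisors_def product_group_def integer_group_def V_def)
  have carH: "D \<in> carrier H \<longleftrightarrow> D \<in> extensional V \<and>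
      (\<forall>\<sigma>\<in>\<Sigma>. \<exists>m\<in>carrier_vec n. \<forall>v\<in>cone_rays n \<sigma>. D v = - (m \<bullet> v))" for D
    by (simp add: H_def cartier_divisors_def weil_divisors_def product_group_def integer_group_def V_def PiE_def)
  \<comment> \<open>Closure under integer combinations, from which products, inverses and multiples
    are obtained below.\<close>
  have lin: "(\<lambda>v\<in>V. a * D v + b * E v) \<in> carrier H" if DE: "D \<in> carrier H" "E \<in> carrier H" for a b D E
    unfolding carH
  proof (intro conjI ballI)
    fix \<sigma> assume \<sigma>: "\<sigma> \<in> \<Sigma>"
    obtain m where m: "m \<in> carrier_vec n" "\<And>v. v \<in> cone_rays n \<sigma> \<Longrightarrow> D v = - (m \<bullet> v)"
      using DE(1) \<sigma> unfolding carH by blast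
    obtain m' where m': "m' \<in> carrier_vec n" "\<And>v. v \<in> cone_rays n \<sigma> \<Longrightarrow> E v = - (m' \<bullet> v)"
      using DE(2) \<sigma> unfolding carH by blast
    have "(\<lambda>v\<in>V. a * D v + b * E v) v = - ((a \<cdot>\<^sub>v m + b \<cdot>\<^sub>v m') \<bullet> v)" if v: "v \<in> cone_rays n \<sigma>" for v
    proof -
      have "v \<in> V" "v \<in> carrier_vec n" using rays[OF \<sigma> v] Vc by auto
      then show ?thesis using m(1) m'(1) m(2)[OF v] m'(2)[OF v]
        by (simp add: add_scalar_prod_distrib[of _ n])
    qed
    then show "\<exists>m\<in>carrier_vec n. \<forall>v\<in>cone_rays n \<sigma>. (\<lambda>v\<in>V. a * D v + b * E v) v = - (m \<bullet> v)"
      using m(1) m'(1) by (intro bexI[of _ "a \<cdot>\<^sub>v m + b \<cdot>\<^sub>v m'"]) auto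
  qed simp
  have char: "char_divisor n \<Sigma> m = (\<lambda>v\<in>V. m \<bullet> v)" for m by (simp add: char_divisor_def V_def)
  have N: "N = (\<lambda>m. \<lambda>v\<in>V. m \<bullet> v) ` carrier_vec n"
    unfolding N_def principal_divisors_def char[abs_def] ..
  have char_in: "(\<lambda>v\<in>V. m \<bullet> v) \<in> carrier H" if m: "m \<in> carrier_vec n" for m
    unfolding carH
  proof (intro conjI ballI)
    fix \<sigma> assume \<sigma>: "\<sigma> \<in> \<Sigma>"
    show "\<exists>m'\<in>carrier_vec n. \<forall>v\<in>cone_rays n \<sigma>. (\<lambda>v\<in>V. m \<bullet> v) v = - (m' \<bullet> v)"
    \<comment> \<open>Cartier data carry the opposite sign.\<close>
    proof (intro bexI[of _ "- m"] ballI)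
      fix v assume "v \<in> cone_rays n \<sigma>"
      then have "v \<in> V" by (rule rays[OF \<sigma>])
      then show "(\<lambda>v\<in>V. m \<bullet> v) v = - (- m \<bullet> v)"
        using scalar_prod_uminus_left[of m v] Vc[of v] m by simp
    qed (use m in simp)
  qed simp
  have zero: "(\<lambda>v\<in>V. 0) = (\<lambda>v\<in>V. 0\<^sub>v n \<bullet> v)"
    by (rule restrict_ext) (simp add: Vc)
  have comm: "comm_group H"
  proof (rule comm_groupI)
    show "\<one>\<^bsub>H\<^esub> \<in> carrier H" unfolding one zero by (rule char_in) simp
    fix x y z assume x: "x \<in> carrier H"
    have ext: "x \<in> extensional V" using x by (simp add: carH)
    show "\<one>\<^bsub>H\<^esub> \<otimes>\<^bsub>H\<^esub> x = x" unfolding one mult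
      by (rule extensionalityI[OF _ ext]) auto
    show "\<exists>y\<in>carrier H. y \<otimes>\<^bsub>H\<^esub> x = \<one>\<^bsub>H\<^esub>" unfolding one mult
      by (rule bexI[OF _ lin[OF x x, of "-1" 0]]) (auto intro: restrict_ext)
    assume y: "y \<in> carrier H"
    show "x \<otimes>\<^bsub>H\<^esub> y \<in> carrier H" unfolding mult using lin[OF x y, of 1 1] by simp
    show "x \<otimes>\<^bsub>H\<^esub> y = y \<otimes>\<^bsub>H\<^esub> x" unfolding mult by (simp add: add.commute)
    show "x \<otimes>\<^bsub>H\<^esub> y \<otimes>\<^bsub>H\<^esub> z = x \<otimes>\<^bsub>H\<^esub> (y \<otimes>\<^bsub>H\<^esub> z)" unfolding mult by (auto intro: restrict_ext)
  qed
  interpret H: comm_group H by (rule comm)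
  have inv: "inv\<^bsub>H\<^esub> D = (\<lambda>v\<in>V. - D v)" if D: "D \<in> carrier H" for D
  proof (rule H.inv_equality[OF _ D])
    show "(\<lambda>v\<in>V. - D v) \<in> carrier H" using lin[OF D D, of "-1" 0] by simp
    show "(\<lambda>v\<in>V. - D v) \<otimes>\<^bsub>H\<^esub> D = \<one>\<^bsub>H\<^esub>" unfolding mult one by (auto intro: restrict_ext)
  qed
  have npow: "D [^]\<^bsub>H\<^esub> (k::nat) = (\<lambda>v\<in>V. int k * D v)" for D k
    by (induction k) (auto simp: one mult distrib_right add.commute intro: restrict_ext)
  have ipow: "D [^]\<^bsub>H\<^esub> (k::int) = (\<lambda>v\<in>V. k * D v)" if D: "D \<in> carrier H" for D k
  proof (cases "k < 0")
    case True
    have "D [^]\<^bsub>H\<^esub> k = inv\<^bsub>H\<^esub> (D [^]\<^bsub>H\<^esub> nat (- k))" unfolding int_pow_def2 by (rule if_P[OF True])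
    also have "\<dots> = (\<lambda>v\<in>V. - (D [^]\<^bsub>H\<^esub> nat (- k)) v)" by (rule inv[OF H.nat_pow_closed[OF D]])
    also have "\<dots> = (\<lambda>v\<in>V. k * D v)" unfolding npow
    proof (rule restrict_ext)
      fix v assume "v \<in> V"
      then show "- (\<lambda>v\<in>V. int (nat (- k)) * D v) v = k * D v" using True by simp
    qed
    finally show ?thesis .
  next
    case False
    have "D [^]\<^bsub>H\<^esub> k = D [^]\<^bsub>H\<^esub> nat k" unfolding int_pow_def2 by (rule if_not_P[OF False])
    then show ?thesis using False unfolding npow by simp
  qed
  have sub: "subgroup N H"
  proof (rule H.subgroupI)
    show "N \<subseteq> carrier H" unfolding N using char_in by blast
    show "N \<noteq> {}" unfolding N using zero_carrier_vec by blast
    fix x assume "x \<in> N"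
    then obtain m where m: "m \<in> carrier_vec n" "x = (\<lambda>v\<in>V. m \<bullet> v)" unfolding N by blast
    have "inv\<^bsub>H\<^esub> x = (\<lambda>v\<in>V. - m \<bullet> v)" unfolding m(2) inv[OF char_in[OF m(1)]]
    proof (rule restrict_ext)
      fix v assume v: "v \<in> V"
      then have "dim_vec m = dim_vec v" using Vc[OF v] m(1) by auto
      then show "- (\<lambda>v\<in>V. m \<bullet> v) v = - m \<bullet> v" using v scalar_prod_uminus_left[of m v] by simp
    qed
    then show "inv\<^bsub>H\<^esub> x \<in> N" unfolding N using m(1) by auto
    fix y assume "y \<in> N"
    then obtain m' where m': "m' \<in> carrier_vec n" "y = (\<lambda>v\<in>V. m' \<bullet> v)" unfolding N by blast
    have "x \<otimes>\<^bsub>H\<^esub> y = (\<lambda>v\<in>V. (m + m') \<bullet> v)" unfolding mult m(2) m'(2)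
      by (rule restrict_ext) (use Vc m(1) m'(1) in \<open>auto simp: add_scalar_prod_distrib[of _ n]\<close>)
    then show "x \<otimes>\<^bsub>H\<^esub> y \<in> N" unfolding N using m(1) m'(1) by auto
  qed
  have nrm: "normal N H" by (rule H.subgroup_imp_normal[OF sub])
  interpret G: comm_group G unfolding G_def by (rule H.abelian_FactGroup[OF sub])
  have oneG: "\<one>\<^bsub>G\<^esub> = N" by (simp add: G_def)
  have le: "card S \<le> card (V - F)" if S: "int_independent G S" for S
  proof (rule ccontr)
    assume "\<not> ?thesis"
    then have neg: "card (V - F) < card S" by simp
    have finS: "finite S" and SG: "S \<subseteq> carrier G"
      and indep: "\<And>c x. finprod G (\<lambda>x. x [^]\<^bsub>G\<^esub> (c x :: int)) S = \<one>\<^bsub>G\<^esub> \<Longrightarrow> x \<in> S \<Longrightarrow> c x = 0"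
      using S unfolding int_independent_def by blast+
    have "\<forall>x\<in>S. \<exists>D. D \<in> carrier H \<and> x = N #>\<^bsub>H\<^esub> D"
      using SG unfolding G_def carrier_FactGroup by blast
    then obtain D where D: "\<And>x. x \<in> S \<Longrightarrow> D x \<in> carrier H" "\<And>x. x \<in> S \<Longrightarrow> x = N #>\<^bsub>H\<^esub> D x"
      by metis
    obtain d where d: "\<And>b b'. b \<in> B \<Longrightarrow> b' \<in> B \<Longrightarrow> d b \<bullet> b' = (if b = b' then 1 else 0 :: int)"
      using lattice_basis_dual[OF B] by metis
    have finF: "finite F" using finV FV finite_subset by blast
    \<comment> \<open>A character agreeing with the representative \<open>D x\<close> on
      \<open>F\<close>, built from the dual basis.\<close>
    define m where "m x = vec n (\<lambda>i. \<Sum>b\<in>F. D x b * d b $ i)" for x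
    have mF: "m x \<bullet> v = D x v" if v: "v \<in> F" for x v
    proof -
      have vc: "v \<in> carrier_vec n" using v FV Vc by (auto simp: V_def)
      have "m x \<bullet> v = (\<Sum>i<n. \<Sum>b\<in>F. D x b * (d b $ i * v $ i))"
        unfolding scalar_prod_lessThan[OF vc]
        by (rule sum.cong) (auto simp: m_def sum_distrib_right mult.assoc)
      also have "\<dots> = (\<Sum>b\<in>F. \<Sum>i<n. D x b * (d b $ i * v $ i))" by (rule sum.swap)
      also have "\<dots> = (\<Sum>b\<in>F. D x b * (d b \<bullet> v))"
        unfolding scalar_prod_lessThan[OF vc] sum_distrib_left ..
      also have "\<dots> = (\<Sum>b\<in>{v}. D x b)"
      proof (rule sum.mono_neutral_cong_right[OF finF])
        show "\<forall>b\<in>F - {v}. D x b * (d b \<bullet> v) = 0"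
        proof
          fix b assume b: "b \<in> F - {v}"
          then have "b \<in> B" "v \<in> B" using FB v by auto
          then show "D x b * (d b \<bullet> v) = 0" using d[of b v] b by simp
        qed
        show "D x b * (d b \<bullet> v) = D x b" if "b \<in> {v}" for b using d[of b v] FB v that by auto
      qed (use v in simp)
      finally show ?thesis by simp
    qed
    \<comment> \<open>The values of the corrected divisors outside \<open>F\<close>, regarded as
      functionals on the classes \<open>x\<close>.\<close>
    define \<Phi> where "\<Phi> = (\<lambda>v x. D x v - m x \<bullet> v) ` (V - F)"
    have fin\<Phi>: "finite \<Phi>" using finV by (simp add: \<Phi>_def V_def)
    have "card \<Phi> \<le> card (V - F)" unfolding \<Phi>_def by (rule card_image_le) (use finV in \<open>simp add: V_def\<close>)
    then have lt: "card \<Phi> < card S" using neg by simp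
    obtain c where c: "\<exists>x\<in>S. c x \<noteq> 0" "balanced \<Phi> S c"
      using exists_dependency[OF fin\<Phi> finS lt] by blast
    have rel: "(\<Sum>x\<in>S. c x * D x v) = (\<Sum>x\<in>S. c x * (m x \<bullet> v))" if v: "v \<in> V" for v
    proof (cases "v \<in> F")
      case True
      then show ?thesis by (simp add: mF)
    next
      case False
      then have "(\<lambda>x. D x v - m x \<bullet> v) \<in> \<Phi>" using v by (auto simp: \<Phi>_def)
      then have "(\<Sum>x\<in>S. c x * (D x v - m x \<bullet> v)) = 0" using c(2) by (simp add: balanced_def)
      then show ?thesis by (simp add: right_diff_distrib sum_subtractf)
    qed
    have pw: "x [^]\<^bsub>G\<^esub> c x = N #>\<^bsub>H\<^esub> (\<lambda>v\<in>V. c x * D x v)" if x: "x \<in> S" for x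
    proof -
      have "x [^]\<^bsub>G\<^esub> c x = (N #>\<^bsub>H\<^esub> D x) [^]\<^bsub>G\<^esub> c x" using D(2)[OF x] by simp
      also have "\<dots> = N #>\<^bsub>H\<^esub> (D x [^]\<^bsub>H\<^esub> c x)"
        unfolding G_def by (rule normal.FactGroup_int_pow[OF nrm D(1)[OF x]])
      finally show ?thesis by (simp only: ipow[OF D(1)[OF x]])
    qed
    \<comment> \<open>Products in the quotient are computed on representatives.\<close>
    have prod: "(\<lambda>v\<in>V. \<Sum>x\<in>T. c x * D x v) \<in> carrier H \<and>
        finprod G (\<lambda>x. x [^]\<^bsub>G\<^esub> c x) T = N #>\<^bsub>H\<^esub> (\<lambda>v\<in>V. \<Sum>x\<in>T. c x * D x v)" if "finite T" "T \<subseteq> S" for T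
      using that
    proof (induction T rule: finite_induct)
      case empty
      have "N #>\<^bsub>H\<^esub> \<one>\<^bsub>H\<^esub> = N" by (rule H.coset_join2[OF H.one_closed sub subgroup.one_closed[OF sub]])
      moreover have "(\<lambda>v\<in>V. \<Sum>x\<in>{}. c x * D x v) = \<one>\<^bsub>H\<^esub>" by (simp only: one sum.empty)
      ultimately show ?case using H.one_closed by (simp only: G.finprod_empty oneG)
    next
      case (insert y T)
      let ?E = "\<lambda>v\<in>V. \<Sum>x\<in>T. c x * D x v"
      have y: "y \<in> S" and TS: "T \<subseteq> S" using insert.prems by auto
      note IH = conjunct1[OF insert.IH[OF TS]] conjunct2[OF insert.IH[OF TS]]
      have cy: "(\<lambda>v\<in>V. c y * D y v) \<in> carrier H" using lin[OF D(1)[OF y] D(1)[OF y], of "c y" 0] by simp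
      have E: "(\<lambda>v\<in>V. \<Sum>x\<in>insert y T. c x * D x v) = (\<lambda>v\<in>V. c y * D y v) \<otimes>\<^bsub>H\<^esub> ?E"
        unfolding mult by (rule restrict_ext) (use insert.hyps in simp)
      have "finprod G (\<lambda>x. x [^]\<^bsub>G\<^esub> c x) (insert y T) =
          (y [^]\<^bsub>G\<^esub> c y) \<otimes>\<^bsub>G\<^esub> finprod G (\<lambda>x. x [^]\<^bsub>G\<^esub> c x) T"
        by (rule G.finprod_insert) (use insert.hyps y TS SG in \<open>auto intro!: G.int_pow_closed\<close>)
      also have "\<dots> = (N #>\<^bsub>H\<^esub> (\<lambda>v\<in>V. c y * D y v)) <#>\<^bsub>H\<^esub> (N #>\<^bsub>H\<^esub> ?E)"
        unfolding pw[OF y] IH(2) by (simp add: G_def)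
      also have "\<dots> = N #>\<^bsub>H\<^esub> ((\<lambda>v\<in>V. c y * D y v) \<otimes>\<^bsub>H\<^esub> ?E)"
        by (rule normal.rcos_sum[OF nrm cy IH(1)])
      finally show ?case unfolding E using H.m_closed[OF cy IH(1)] by blast
    qed
    \<comment> \<open>The same combination of the characters \<open>m x\<close>; its divisor is the
      combination of the \<open>D x\<close>, which is therefore principal.\<close>
    define M where "M = vec n (\<lambda>i. \<Sum>x\<in>S. c x * m x $ i)"
    have "(\<lambda>v\<in>V. \<Sum>x\<in>S. c x * D x v) = (\<lambda>v\<in>V. M \<bullet> v)"
    proof (rule restrict_ext)
      fix v assume v: "v \<in> V"
      have "M \<bullet> v = (\<Sum>i<n. \<Sum>x\<in>S. c x * (m x $ i * v $ i))"
        unfolding scalar_prod_lessThan[OF Vc[OF v]]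
        by (rule sum.cong) (auto simp: M_def sum_distrib_right mult.assoc)
      also have "\<dots> = (\<Sum>x\<in>S. \<Sum>i<n. c x * (m x $ i * v $ i))" by (rule sum.swap)
      also have "\<dots> = (\<Sum>x\<in>S. c x * (m x \<bullet> v))"
        unfolding scalar_prod_lessThan[OF Vc[OF v]] sum_distrib_left ..
      finally show "(\<Sum>x\<in>S. c x * D x v) = M \<bullet> v" using rel[OF v] by simp
    qed
    then have "(\<lambda>v\<in>V. \<Sum>x\<in>S. c x * D x v) \<in> N" unfolding N by (auto simp: M_def)
    then have "N #>\<^bsub>H\<^esub> (\<lambda>v\<in>V. \<Sum>x\<in>S. c x * D x v) = N"
      using prod[OF finS] by (intro H.coset_join2[OF _ sub]) auto
    then have "finprod G (\<lambda>x. x [^]\<^bsub>G\<^esub> c x) S = \<one>\<^bsub>G\<^esub>" using prod[OF finS] oneG by simp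
    then show False using indep c(1) by blast
  qed
  \<comment> \<open>Makes the set under the supremum nonempty, as \<open>cSup_least\<close>
    demands.\<close>
  have "int_independent G {}" by (simp add: int_independent_def)
  then have "abelian_rank G \<le> card (V - F)"
    unfolding abelian_rank_def by (intro cSup_least) (use le in auto)
  then show ?thesis by (simp add: picard_rank_def picard_group_def G_def H_def N_def V_def)
qed

theorem theorem1p4:
  shows "\<forall>q::nat. \<exists>A::nat. \<forall>(n::nat) (\<Sigma>::real vec set set).
           smooth_toric_fano n \<Sigma> \<and> (\<exists>C\<in>minimal_components n \<Sigma>. codegree n C = int q) \<longrightarrow>
           picard_rank n \<Sigma> \<le> A"
proof
  fix q
  show "\<exists>A::nat. \<forall>(n::nat) (\<Sigma>::real vec set set).
      smooth_toric_fano n \<Sigma> \<and> (\<exists>C\<in>minimal_components n \<Sigma>. codegree n C = int q) \<longrightarrow>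
      picard_rank n \<Sigma> \<le> A"
  \<comment> \<open>The bound from \<open>card_zero_sum_complement_le\<close>, in which the
    dimension does not occur.\<close>
  proof (intro exI[of _ "Suc (exhaust_bound q (Suc q))"] allI impI)
    fix n and \<Sigma> :: "real vec set set"
    assume "smooth_toric_fano n \<Sigma> \<and> (\<exists>C\<in>minimal_components n \<Sigma>. codegree n C = int q)"
    then obtain C where X: "smooth_toric_fano n \<Sigma>" and C: "C \<in> minimal_components n \<Sigma>" "codegree n C = int q"
      by blast
    obtain B F where BF: "finite (fan_rays n \<Sigma>)" "lattice_basis n B" "F \<subseteq> B" "F \<subseteq> fan_rays n \<Sigma>"
      "card (fan_rays n \<Sigma> - F) \<le> Suc (exhaust_bound q (Suc q))"
      by (rule card_zero_sum_complement_le[OF X C])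
    have "fan n \<Sigma>" using X by (simp add: smooth_toric_fano_def)
    from picard_rank_le_card[OF this BF(1-4)] BF(5)
    show "picard_rank n \<Sigma> \<le> Suc (exhaust_bound q (Suc q))" by (rule order_trans)
  qed
qed

end
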